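(* If the polarised manifolds $(X_1,E_1)$ and $(X_2,E_2)$ have the polarised density property, then the product $(X_1\times X_2,E_1\boxtimes E_2)$ also has the polarised density property.
   Context: A polarised manifold is a pair $(X,E)$ of a compact complex manifold $X$ and an ample holomorphic line bundle $E$ on $X$. $|E|$ is the complete linear system of $E$: its elements are the divisors of nontrivial holomorphic sections of $E$; a divisor is identified with its support when taking complements. The polarised manifold $(X,E)$ has the polarised density property if for each point $x\in X$ there exists a divisor $D\in|E|$ whose complement $X\setminus D$ is a Stein neighbourhood of $x$ with the density property. The external tensor product is $E_1\boxtimes E_2=(\pi_1^*E_1)\otimes(\pi_2^*E_2)\to X_1\times X_2$, where $\pi_i:X_1\times X_2\to X_i$ are the projections. A holomorphic vector field on a complex manifold is complete if its flow exists for all complex values of time. A complex manifold has the density property if every holomorphic vector field on it can be approximated uniformly on compacts by sums and commutators of complete holomorphic vector fields. *)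

theory Defs
  imports "HOL-Analysis.Analysis"
begin

section \<open>Complex manifolds\<close>

text \<open>
  As for \<open>Euclidean_space\<close> in the library, \<open>\<complex>\<^sup>n\<close> is rendered as the space of sequences
  vanishing from index \<open>n\<close> on, so that the dimension is an ordinary natural number.
\<close>

definition Cn :: "nat \<Rightarrow> (nat \<Rightarrow> complex) set"
  where "Cn n = {z. \<forall>i\<ge>n. z i = 0}"

text \<open>
  A function on an open subset \<open>S\<close> of \<open>\<complex>\<^sup>n\<close> is holomorphic if it is continuous and holomorphic
  in each variable separately.
\<close>

definition holomorphic_Cn :: "nat \<Rightarrow> (nat \<Rightarrow> complex) set \<Rightarrow> ((nat \<Rightarrow> complex) \<Rightarrow> complex) \<Rightarrow> bool"
  where "holomorphic_Cn n S f \<longleftrightarrow>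
    continuous_on S f \<and>
    (\<forall>z\<in>S. \<forall>i<n. (\<lambda>t. f (z(i := t))) field_differentiable at (z i))"

text \<open>A chart is a pair of its domain and its coordinate map; values of the coordinate map
  off the domain are irrelevant. The atlas need not be maximal.\<close>

type_synonym 'a chart = "'a set \<times> ('a \<Rightarrow> nat \<Rightarrow> complex)"

record 'a cmfd =
  cm_top :: "'a topology"
  cm_dim :: nat
  cm_atlas :: "'a chart set"

abbreviation cm_space :: "'a cmfd \<Rightarrow> 'a set"
  where "cm_space M \<equiv> topspace (cm_top M)"

definition complex_manifold :: "'a cmfd \<Rightarrow> bool"
  where "complex_manifold M \<longleftrightarrow>
    Hausdorff_space (cm_top M) \<and> second_countable (cm_top M) \<and>
    (\<Union>(U, \<phi>)\<in>cm_atlas M. U) = cm_space M \<and>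
    (\<forall>(U, \<phi>)\<in>cm_atlas M.
       openin (cm_top M) U \<and>
       openin (top_of_set (Cn (cm_dim M))) (\<phi> ` U) \<and>
       homeomorphic_map (subtopology (cm_top M) U) (top_of_set (\<phi> ` U)) \<phi>) \<and>
    (\<forall>(U, \<phi>)\<in>cm_atlas M. \<forall>(V, \<psi>)\<in>cm_atlas M. \<forall>j<cm_dim M.
       holomorphic_Cn (cm_dim M) (\<phi> ` (U \<inter> V)) (\<lambda>z. \<psi> (inv_into U \<phi> z) j))"

text \<open>Holomorphy of a function on an open subset \<open>S\<close> of the manifold.\<close>

definition holomorphic_fun :: "'a cmfd \<Rightarrow> 'a set \<Rightarrow> ('a \<Rightarrow> complex) \<Rightarrow> bool"
  where "holomorphic_fun M S f \<longleftrightarrow>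
    (\<forall>(U, \<phi>)\<in>cm_atlas M. holomorphic_Cn (cm_dim M) (\<phi> ` (U \<inter> S)) (\<lambda>z. f (inv_into U \<phi> z)))"

definition holomorphic_map :: "'a cmfd \<Rightarrow> 'b cmfd \<Rightarrow> ('a \<Rightarrow> 'b) \<Rightarrow> bool"
  where "holomorphic_map M N f \<longleftrightarrow>
    continuous_map (cm_top M) (cm_top N) f \<and>
    (\<forall>(V, \<psi>)\<in>cm_atlas N. \<forall>j<cm_dim N.
       holomorphic_fun M {x \<in> cm_space M. f x \<in> V} (\<lambda>x. \<psi> (f x) j))"

text \<open>The partial derivative of \<open>f\<close> at \<open>x\<close> with respect to the \<open>i\<close>-th coordinate of a chart
  around \<open>x\<close>.\<close>

definition chart_deriv :: "'a chart \<Rightarrow> nat \<Rightarrow> ('a \<Rightarrow> complex) \<Rightarrow> 'a \<Rightarrow> complex"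
  where "chart_deriv c i f x =
    deriv (\<lambda>t. f (inv_into (fst c) (snd c) ((snd c x)(i := t)))) (snd c x i)"

definition open_submanifold :: "'a cmfd \<Rightarrow> 'a set \<Rightarrow> 'a cmfd"
  where "open_submanifold M W =
    \<lparr>cm_top = subtopology (cm_top M) W, cm_dim = cm_dim M,
     cm_atlas = (\<lambda>(U, \<phi>). (U \<inter> W, \<phi>)) ` cm_atlas M\<rparr>"

definition product_manifold :: "'a cmfd \<Rightarrow> 'b cmfd \<Rightarrow> ('a \<times> 'b) cmfd"
  where "product_manifold M N =
    \<lparr>cm_top = prod_topology (cm_top M) (cm_top N), cm_dim = cm_dim M + cm_dim N,
     cm_atlas = {(U \<times> V, \<lambda>(x, y) i. if i < cm_dim M then \<phi> x i else \<psi> y (i - cm_dim M)) | U \<phi> V \<psi>.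
       (U, \<phi>) \<in> cm_atlas M \<and> (V, \<psi>) \<in> cm_atlas N}\<rparr>"

definition holomorphic_immersion :: "'a cmfd \<Rightarrow> 'b cmfd \<Rightarrow> ('a \<Rightarrow> 'b) \<Rightarrow> bool"
  where "holomorphic_immersion M N f \<longleftrightarrow>
    holomorphic_map M N f \<and>
    (\<forall>(U, \<phi>)\<in>cm_atlas M. \<forall>(V, \<psi>)\<in>cm_atlas N. \<forall>x\<in>U. f x \<in> V \<longrightarrow>
       (\<forall>\<xi>. (\<forall>j<cm_dim N. (\<Sum>i<cm_dim M. \<xi> i * chart_deriv (U, \<phi>) i (\<lambda>y. \<psi> (f y) j) x) = 0)
          \<longrightarrow> (\<forall>i<cm_dim M. \<xi> i = 0)))"

definition holomorphic_embedding :: "'a cmfd \<Rightarrow> 'b cmfd \<Rightarrow> ('a \<Rightarrow> 'b) \<Rightarrow> bool"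
  where "holomorphic_embedding M N f \<longleftrightarrow>
    holomorphic_immersion M N f \<and> embedding_map (cm_top M) (cm_top N) f"


section \<open>Stein manifolds\<close>

text \<open>For \<open>K = {}\<close> the bound \<open>b\<close> may be negative, so that the hull is empty.\<close>

definition holomorphic_hull :: "'a cmfd \<Rightarrow> 'a set \<Rightarrow> 'a set"
  where "holomorphic_hull M K =
    {x \<in> cm_space M. \<forall>f b. holomorphic_fun M (cm_space M) f \<and> (\<forall>y\<in>K. cmod (f y) \<le> b)
       \<longrightarrow> cmod (f x) \<le> b}"

text \<open>Holomorphic convexity, separation of points, and local coordinates given by global functions
  (whose differentials are linearly independent at the given point).\<close>

definition stein_manifold :: "'a cmfd \<Rightarrow> bool"
  where "stein_manifold M \<longleftrightarrow>
    complex_manifold M \<and>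
    (\<forall>K. compactin (cm_top M) K \<longrightarrow> compactin (cm_top M) (holomorphic_hull M K)) \<and>
    (\<forall>x\<in>cm_space M. \<forall>y\<in>cm_space M. x \<noteq> y \<longrightarrow>
       (\<exists>f. holomorphic_fun M (cm_space M) f \<and> f x \<noteq> f y)) \<and>
    (\<forall>x\<in>cm_space M. \<exists>f :: nat \<Rightarrow> 'a \<Rightarrow> complex.
       (\<forall>j<cm_dim M. holomorphic_fun M (cm_space M) (f j)) \<and>
       (\<forall>c\<in>cm_atlas M. x \<in> fst c \<longrightarrow>
          (\<forall>a. (\<forall>i<cm_dim M. (\<Sum>j<cm_dim M. a j * chart_deriv c i (f j) x) = 0)
             \<longrightarrow> (\<forall>j<cm_dim M. a j = 0))))"


section \<open>Holomorphic vector fields and the density property\<close>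

text \<open>A tangent vector at \<open>x\<close> is given by its components with respect to each chart around \<open>x\<close>,
  subject to the usual transformation law. Thus \<open>V x c i\<close> is the \<open>i\<close>-th component of the vector
  field \<open>V\<close> at \<open>x\<close> in the chart \<open>c\<close>; only \<open>x \<in> fst c\<close> and \<open>i < cm_dim M\<close> matter.\<close>

type_synonym 'a vfield = "'a \<Rightarrow> 'a chart \<Rightarrow> nat \<Rightarrow> complex"

definition holomorphic_vfield :: "'a cmfd \<Rightarrow> 'a vfield \<Rightarrow> bool"
  where "holomorphic_vfield M V \<longleftrightarrow>
    (\<forall>c\<in>cm_atlas M. \<forall>d\<in>cm_atlas M. \<forall>x\<in>fst c \<inter> fst d. \<forall>j<cm_dim M.
       V x d j = (\<Sum>i<cm_dim M. chart_deriv c i (\<lambda>y. snd d y j) x * V x c i)) \<and>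
    (\<forall>c\<in>cm_atlas M. \<forall>i<cm_dim M. holomorphic_fun M (fst c) (\<lambda>x. V x c i))"

definition vfield_add :: "'a vfield \<Rightarrow> 'a vfield \<Rightarrow> 'a vfield"
  where "vfield_add V W = (\<lambda>x c i. V x c i + W x c i)"

definition vfield_commutator :: "'a cmfd \<Rightarrow> 'a vfield \<Rightarrow> 'a vfield \<Rightarrow> 'a vfield"
  where "vfield_commutator M V W = (\<lambda>x c j.
    \<Sum>i<cm_dim M. V x c i * chart_deriv c i (\<lambda>y. W y c j) x
                - W x c i * chart_deriv c i (\<lambda>y. V y c j) x)"

definition complex_integral_curve :: "'a cmfd \<Rightarrow> 'a vfield \<Rightarrow> (complex \<Rightarrow> 'a) \<Rightarrow> bool"
  where "complex_integral_curve M V \<gamma> \<longleftrightarrow>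
    continuous_map euclidean (cm_top M) \<gamma> \<and>
    (\<forall>t. \<forall>c\<in>cm_atlas M. \<gamma> t \<in> fst c \<longrightarrow>
       (\<forall>i<cm_dim M. ((\<lambda>s. snd c (\<gamma> s) i) has_field_derivative V (\<gamma> t) c i) (at t)))"

definition complete_vfield :: "'a cmfd \<Rightarrow> 'a vfield \<Rightarrow> bool"
  where "complete_vfield M V \<longleftrightarrow>
    holomorphic_vfield M V \<and>
    (\<forall>x\<in>cm_space M. \<exists>\<gamma>. \<gamma> 0 = x \<and> complex_integral_curve M V \<gamma>)"

inductive complete_generated :: "'a cmfd \<Rightarrow> 'a vfield \<Rightarrow> bool" for M
  where
    complete: "complete_vfield M V \<Longrightarrow> complete_generated M V"
  | sum: "complete_generated M V \<Longrightarrow> complete_generated M W \<Longrightarrow>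
      complete_generated M (vfield_add V W)"
  | commutator: "complete_generated M V \<Longrightarrow> complete_generated M W \<Longrightarrow>
      complete_generated M (vfield_commutator M V W)"

text \<open>Uniform approximation on compacts is measured in charts: every compact subset of the manifold
  is a finite union of compact sets \<open>K\<close>, each contained in the domain of a chart \<open>c\<close>.\<close>

definition approximable_on_compacts :: "'a cmfd \<Rightarrow> ('a vfield \<Rightarrow> bool) \<Rightarrow> 'a vfield \<Rightarrow> bool"
  where "approximable_on_compacts M P V \<longleftrightarrow>
    (\<forall>F \<epsilon>. finite F \<and> (\<forall>(c, K)\<in>F. c \<in> cm_atlas M \<and> compactin (cm_top M) K \<and> K \<subseteq> fst c) \<and> \<epsilon> > 0
       \<longrightarrow> (\<exists>W. P W \<and> (\<forall>(c, K)\<in>F. \<forall>x\<in>K. \<forall>i<cm_dim M. cmod (V x c i - W x c i) < \<epsilon>)))"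

definition density_property :: "'a cmfd \<Rightarrow> bool"
  where "density_property M \<longleftrightarrow>
    complex_manifold M \<and>
    (\<forall>V. holomorphic_vfield M V \<longrightarrow> approximable_on_compacts M (complete_generated M) V)"


section \<open>Holomorphic line bundles\<close>

text \<open>A holomorphic line bundle is given by a trivialising open cover \<open>U\<^sub>i\<close> and a cocycle of
  holomorphic transition functions \<open>g\<^sub>i\<^sub>j\<close> on \<open>U\<^sub>i \<inter> U\<^sub>j\<close>; the fibre coordinates of a vector
  over \<open>x\<close> are related by \<open>v\<^sub>i = g\<^sub>i\<^sub>j(x) v\<^sub>j\<close>.\<close>

record ('i, 'a) line_bundle =
  lb_index :: "'i set"
  lb_dom :: "'i \<Rightarrow> 'a set"
  lb_trans :: "'i \<Rightarrow> 'i \<Rightarrow> 'a \<Rightarrow> complex"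

definition holomorphic_line_bundle :: "'a cmfd \<Rightarrow> ('i, 'a) line_bundle \<Rightarrow> bool"
  where "holomorphic_line_bundle M E \<longleftrightarrow>
    (\<forall>i\<in>lb_index E. openin (cm_top M) (lb_dom E i)) \<and>
    (\<Union>i\<in>lb_index E. lb_dom E i) = cm_space M \<and>
    (\<forall>i\<in>lb_index E. \<forall>j\<in>lb_index E.
       holomorphic_fun M (lb_dom E i \<inter> lb_dom E j) (lb_trans E i j) \<and>
       (\<forall>x\<in>lb_dom E i \<inter> lb_dom E j. lb_trans E i j x \<noteq> 0)) \<and>
    (\<forall>i\<in>lb_index E. \<forall>x\<in>lb_dom E i. lb_trans E i i x = 1) \<and>
    (\<forall>i\<in>lb_index E. \<forall>j\<in>lb_index E. \<forall>k\<in>lb_index E. \<forall>x\<in>lb_dom E i \<inter> lb_dom E j \<inter> lb_dom E k.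
       lb_trans E i j x * lb_trans E j k x = lb_trans E i k x)"

text \<open>A holomorphic section is given by its fibre coordinates in the trivialisations.\<close>

definition holomorphic_section ::
    "'a cmfd \<Rightarrow> ('i, 'a) line_bundle \<Rightarrow> ('i \<Rightarrow> 'a \<Rightarrow> complex) \<Rightarrow> bool"
  where "holomorphic_section M E s \<longleftrightarrow>
    (\<forall>i\<in>lb_index E. holomorphic_fun M (lb_dom E i) (s i)) \<and>
    (\<forall>i\<in>lb_index E. \<forall>j\<in>lb_index E. \<forall>x\<in>lb_dom E i \<inter> lb_dom E j. s i x = lb_trans E i j x * s j x)"

definition lb_pullback :: "'b cmfd \<Rightarrow> ('b \<Rightarrow> 'a) \<Rightarrow> ('i, 'a) line_bundle \<Rightarrow> ('i, 'b) line_bundle"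
  where "lb_pullback M f E =
    \<lparr>lb_index = lb_index E, lb_dom = (\<lambda>i. {x \<in> cm_space M. f x \<in> lb_dom E i}),
     lb_trans = (\<lambda>i j x. lb_trans E i j (f x))\<rparr>"

definition lb_tensor ::
    "('i, 'a) line_bundle \<Rightarrow> ('j, 'a) line_bundle \<Rightarrow> ('i \<times> 'j, 'a) line_bundle"
  where "lb_tensor E F =
    \<lparr>lb_index = lb_index E \<times> lb_index F,
     lb_dom = (\<lambda>(i, k). lb_dom E i \<inter> lb_dom F k),
     lb_trans = (\<lambda>(i, k) (j, l) x. lb_trans E i j x * lb_trans F k l x)\<rparr>"

text \<open>The \<open>k\<close>-th tensor power, with respect to the given cover rather than its refinement by
  \<open>k\<close>-fold intersections.\<close>

definition lb_power :: "nat \<Rightarrow> ('i, 'a) line_bundle \<Rightarrow> ('i, 'a) line_bundle"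
  where "lb_power k E =
    \<lparr>lb_index = lb_index E, lb_dom = lb_dom E, lb_trans = (\<lambda>i j x. lb_trans E i j x ^ k)\<rparr>"

definition external_tensor ::
    "'a cmfd \<Rightarrow> ('i, 'a) line_bundle \<Rightarrow> 'b cmfd \<Rightarrow> ('j, 'b) line_bundle
      \<Rightarrow> ('i \<times> 'j, 'a \<times> 'b) line_bundle"
  where "external_tensor M E N F =
    lb_tensor (lb_pullback (product_manifold M N) fst E) (lb_pullback (product_manifold M N) snd F)"


section \<open>Projective space and ampleness\<close>

text \<open>A point of \<open>\<complex>P\<^sup>N\<close> is the set of nonzero vectors on a line through the origin in
  \<open>\<complex>\<^sup>N\<^sup>+\<^sup>1\<close>, and \<open>\<complex>P\<^sup>N\<close> carries the quotient topology.\<close>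

definition proj_point :: "(nat \<Rightarrow> complex) \<Rightarrow> (nat \<Rightarrow> complex) set"
  where "proj_point z = {\<lambda>j. a * z j | a. a \<noteq> 0}"

definition proj_topology :: "nat \<Rightarrow> (nat \<Rightarrow> complex) set topology"
  where "proj_topology N = topology (\<lambda>A.
    A \<subseteq> proj_point ` (Cn (Suc N) - {\<lambda>_. 0}) \<and>
    openin (top_of_set (Cn (Suc N) - {\<lambda>_. 0})) {z \<in> Cn (Suc N) - {\<lambda>_. 0}. proj_point z \<in> A})"

lemma openin_proj_topology:
  "openin (proj_topology N) A \<longleftrightarrow>
    A \<subseteq> proj_point ` (Cn (Suc N) - {\<lambda>_. 0}) \<and>
    openin (top_of_set (Cn (Suc N) - {\<lambda>_. 0})) {z \<in> Cn (Suc N) - {\<lambda>_. 0}. proj_point z \<in> A}"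
proof -
  define C where "C = Cn (Suc N) - {\<lambda>_. 0}"
  have "istopology (\<lambda>A. A \<subseteq> proj_point ` C \<and> openin (top_of_set C) {z \<in> C. proj_point z \<in> A})"
    unfolding istopology_def
  proof (intro conjI allI impI)
    fix A B
    assume A: "A \<subseteq> proj_point ` C \<and> openin (top_of_set C) {z \<in> C. proj_point z \<in> A}"
      and B: "B \<subseteq> proj_point ` C \<and> openin (top_of_set C) {z \<in> C. proj_point z \<in> B}"
    show "A \<inter> B \<subseteq> proj_point ` C" using A by blast
    have "{z \<in> C. proj_point z \<in> A \<inter> B} = {z \<in> C. proj_point z \<in> A} \<inter> {z \<in> C. proj_point z \<in> B}"
      by blast
    then show "openin (top_of_set C) {z \<in> C. proj_point z \<in> A \<inter> B}"
      using A B by (simp only: openin_Int)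
  next
    fix \<A>
    assume *: "\<forall>A\<in>\<A>. A \<subseteq> proj_point ` C \<and> openin (top_of_set C) {z \<in> C. proj_point z \<in> A}"
    then show "\<Union>\<A> \<subseteq> proj_point ` C" by blast
    have "{z \<in> C. proj_point z \<in> \<Union>\<A>} = (\<Union>A\<in>\<A>. {z \<in> C. proj_point z \<in> A})"
      by blast
    then show "openin (top_of_set C) {z \<in> C. proj_point z \<in> \<Union>\<A>}"
      using * by (auto intro!: openin_Union)
  qed
  then show ?thesis
    unfolding proj_topology_def C_def by (simp only: topology_inverse')
qed

text \<open>The chart \<open>[z\<^sub>0 : \<dots> : z\<^sub>N] \<mapsto> (z\<^sub>0/z\<^sub>i, \<dots>, z\<^sub>N/z\<^sub>i)\<close>, the \<open>i\<close>-th entry being omitted,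
  computed from an arbitrary representative.\<close>

definition proj_coord :: "nat \<Rightarrow> (nat \<Rightarrow> complex) set \<Rightarrow> nat \<Rightarrow> complex"
  where "proj_coord i L = (let z = (SOME z. z \<in> L) in (\<lambda>j. z (if j < i then j else Suc j) / z i))"

definition projective_space :: "nat \<Rightarrow> (nat \<Rightarrow> complex) set cmfd"
  where "projective_space N =
    \<lparr>cm_top = proj_topology N, cm_dim = N,
     cm_atlas = {(proj_point ` {z \<in> Cn (Suc N). z i \<noteq> 0}, proj_coord i) | i. i \<le> N}\<rparr>"

text \<open>Very ample: finitely many holomorphic sections without common zeros define a holomorphic
  embedding \<open>x \<mapsto> [s\<^sub>0(x) : \<dots> : s\<^sub>N(x)]\<close> into projective space. In \<open>s m i x\<close>, \<open>m\<close> numbers the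
  sections and \<open>i\<close> is the index of a trivialisation, on the choice of which the point
  \<open>[s\<^sub>0(x) : \<dots> : s\<^sub>N(x)]\<close> does not depend.\<close>

definition very_ample :: "'a cmfd \<Rightarrow> ('i, 'a) line_bundle \<Rightarrow> bool"
  where "very_ample M E \<longleftrightarrow>
    (\<exists>(N :: nat) s f.
       (\<forall>m\<le>N. holomorphic_section M E (s m)) \<and>
       (\<forall>i\<in>lb_index E. \<forall>x\<in>lb_dom E i. \<exists>m\<le>N. s m i x \<noteq> 0) \<and>
       (\<forall>i\<in>lb_index E. \<forall>x\<in>lb_dom E i. f x = proj_point (\<lambda>m. if m \<le> N then s m i x else 0)) \<and>
       holomorphic_embedding M (projective_space N) f)"

definition ample :: "'a cmfd \<Rightarrow> ('i, 'a) line_bundle \<Rightarrow> bool"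
  where "ample M E \<longleftrightarrow> (\<exists>k\<ge>1. very_ample M (lb_power k E))"


section \<open>Polarised manifolds\<close>

definition polarised_manifold :: "'a cmfd \<Rightarrow> ('i, 'a) line_bundle \<Rightarrow> bool"
  where "polarised_manifold M E \<longleftrightarrow>
    complex_manifold M \<and> compact_space (cm_top M) \<and> holomorphic_line_bundle M E \<and> ample M E"

text \<open>On a connected manifold this just says that \<open>s\<close> is not the zero section. In general a section
  has a divisor only if it does not vanish identically on any connected component.\<close>

definition nontrivial_section :: "'a cmfd \<Rightarrow> ('i, 'a) line_bundle \<Rightarrow> ('i \<Rightarrow> 'a \<Rightarrow> complex) \<Rightarrow> bool"
  where "nontrivial_section M E s \<longleftrightarrow>
    (\<forall>C\<in>connected_components_of (cm_top M). \<exists>i\<in>lb_index E. \<exists>x\<in>C \<inter> lb_dom E i. s i x \<noteq> 0)"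

text \<open>Only complements of divisors matter here, so a divisor is represented by its support,
  which for the divisor of a section is the zero set of the section.\<close>

definition divisor_support :: "('i, 'a) line_bundle \<Rightarrow> ('i \<Rightarrow> 'a \<Rightarrow> complex) \<Rightarrow> 'a set"
  where "divisor_support E s = {x. \<exists>i\<in>lb_index E. x \<in> lb_dom E i \<and> s i x = 0}"

definition complete_linear_system :: "'a cmfd \<Rightarrow> ('i, 'a) line_bundle \<Rightarrow> 'a set set"
  where "complete_linear_system M E =
    {divisor_support E s | s. holomorphic_section M E s \<and> nontrivial_section M E s}"

definition polarised_density_property :: "'a cmfd \<Rightarrow> ('i, 'a) line_bundle \<Rightarrow> bool"
  where "polarised_density_property M E \<longleftrightarrow>
    (\<forall>x\<in>cm_space M. \<exists>D\<in>complete_linear_system M E.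
       x \<in> cm_space M - D \<and>
       stein_manifold (open_submanifold M (cm_space M - D)) \<and>
       density_property (open_submanifold M (cm_space M - D)))"

end

theory Submission
  imports Defs "HOL-Complex_Analysis.Complex_Analysis" "Jordan_Normal_Form.Determinant" "HOL-Real_Asymp.Real_Asymp"
begin

text \<open>The complement of the divisor of \<open>s \<otimes> t\<close> is the product of the complements of the divisors of \<open>s\<close> and \<open>t\<close>,
  so the point is that products preserve the density property. A vector field on \<open>M \<times> N\<close> is a sum of two fields
  tangent to the factors. A field \<open>V\<close> tangent to \<open>M\<close> is a holomorphic function of \<open>y \<in> N\<close> with values in the fields
  on \<open>M\<close>, and it is approximated by finite sums \<open>\<Sum>\<^sub>j g\<^sub>j(y) V(\<cdot>, y\<^sub>j)\<close>. To this end the nodes \<open>y\<^sub>j\<close> (and points \<open>x\<^sub>i\<close>) are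
  chosen such that the determinants of the values of \<open>V\<close> at \<open>p\<close> nodes are nearly maximal: interpolation at
  roots of unity in polydiscs approximates \<open>V\<close> exponentially well by functions of rank polynomial in the degree, so
  these determinants decay faster than any geometric sequence in \<open>p\<close>, some successive ratio is small, and it
  bounds the interpolation error by Laplace expansion. Each \<open>V(\<cdot>, y\<^sub>j)\<close> is then approximated by
  combinations of complete fields on \<open>M\<close>; multiplication by \<open>g\<^sub>j\<close> preserves completeness and passes through
  commutators, because \<open>g\<^sub>j\<close> is constant along the fields on \<open>M\<close>.

  Ampleness of the external tensor product is seen from a Segre embedding, after the two very ample powers
  \<open>k\<close>, \<open>l\<close> have been replaced by their common multiple \<open>k l\<close>.\<close>

section \<open>Cross approximation of kernels by near-maximal determinants\<close>

text \<open>The obstacle is that the factors of the approximating sums have to be holomorphic on all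
  of \<open>N\<close> and vector fields on all of \<open>M\<close>, whereas interpolation in
  polydiscs yields local functions only. Cross approximation avoids every extension or gluing: both
  kinds of factors are restrictions of the given field itself, namely its slices at the nodes
  \<open>y_j\<close> and linear combinations of the functions \<open>y \<mapsto> V(x_i, y)\<close>.
  The local interpolants serve for a rank estimate on a compact set and nothing else, so they may
  jump from one polydisc to the next. The balance is this: \<open>m\<close> nodes in each of
  \<open>n\<close> variables cost rank of order \<open>m^n\<close> and leave an error of order
  \<open>2^-m\<close>, so even the cube of the rank times the error tends to 0. The cube arises
  because determinants of size \<open>3q\<close> are compared with \<open>q\<close>-th powers. All
  components of \<open>V\<close> in all relevant charts form a single scalar kernel, so that common
  nodes and common functions \<open>g_j\<close> serve all of them.\<close>

lemma norm_prod_permutation_bound: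
  fixes A :: "nat \<Rightarrow> nat \<Rightarrow> complex"
  assumes \<pi>: "\<pi> permutes {0..<q + p}"
    and B: "\<And>i j. i < q + p \<Longrightarrow> j < q + p \<Longrightarrow> cmod (A i j) \<le> B" "1 \<le> B"
    and d: "\<And>i j. q \<le> i \<Longrightarrow> i < q + p \<Longrightarrow> q \<le> j \<Longrightarrow> j < q + p \<Longrightarrow> cmod (A i j) \<le> \<delta>" "0 \<le> \<delta>" "\<delta> \<le> 1"
  shows "cmod (\<Prod>i = 0..<q + p. A i (\<pi> i)) \<le> B ^ (q + p) * \<delta> ^ (p - q)"
proof -
  define S where "S = {i \<in> {q..<q + p}. q \<le> \<pi> i}"
  have lt: "\<pi> i < q + p" if "i < q + p" for i
    using permutes_in_image[OF \<pi>, of i] that by simp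
  have fS: "finite S" "S \<subseteq> {0..<q + p}"
    by (auto simp: S_def)
  \<comment> \<open>The rows from \<open>q\<close> on that lie outside \<open>S\<close> are sent
    injectively into the first \<open>q\<close> columns, so at least \<open>p - q\<close> factors
    come from the small block. For \<open>p < q\<close> the truncated exponent is 0 and no small
    factor is claimed.\<close>
  have "card ({q..<q + p} - S) \<le> card {0..<q}"
  proof (rule card_inj_on_le)
    show "inj_on \<pi> ({q..<q + p} - S)"
      using permutes_inj_on[OF \<pi>] .
  qed (auto simp: S_def)
  then have cS: "p - q \<le> card S"
    using card_Diff_subset[of S "{q..<q + p}"] fS(1) by (simp add: S_def subset_iff)
  have "cmod (\<Prod>i = 0..<q + p. A i (\<pi> i)) = (\<Prod>i\<in>{0..<q + p}. cmod (A i (\<pi> i)))"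
    by (simp add: prod_norm)
  also have "\<dots> = (\<Prod>i\<in>{0..<q + p} - S. cmod (A i (\<pi> i))) * (\<Prod>i\<in>S. cmod (A i (\<pi> i)))"
    by (rule prod.subset_diff) (use fS in auto)
  also have "\<dots> \<le> (\<Prod>i\<in>{0..<q + p} - S. B) * (\<Prod>i\<in>S. \<delta>)"
    using B d lt by (intro mult_mono prod_mono prod_nonneg) (auto simp: S_def)
  also have "\<dots> = B ^ card ({0..<q + p} - S) * \<delta> ^ card S"
    by simp
  also have "\<dots> \<le> B ^ (q + p) * \<delta> ^ (p - q)"
  proof (rule mult_mono)
    have "card ({0..<q + p} - S) \<le> card {0..<q + p}"
      by (rule card_mono) auto
    then show "B ^ card ({0..<q + p} - S) \<le> B ^ (q + p)"
      using B(2) by (intro power_increasing) auto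
    show "\<delta> ^ card S \<le> \<delta> ^ (p - q)"
      using d cS by (intro power_decreasing) auto
  qed (use B d in auto)
  finally show ?thesis .
qed

text \<open>Leibniz formula: the bound on a single product is uniform over the
  \<open>(q + p)!\<close> permutations.\<close>

lemma norm_det_block_bound:
  fixes A :: "nat \<Rightarrow> nat \<Rightarrow> complex"
  assumes B: "\<And>i j. i < q + p \<Longrightarrow> j < q + p \<Longrightarrow> cmod (A i j) \<le> B" "1 \<le> B"
    and d: "\<And>i j. q \<le> i \<Longrightarrow> i < q + p \<Longrightarrow> q \<le> j \<Longrightarrow> j < q + p \<Longrightarrow> cmod (A i j) \<le> \<delta>" "0 \<le> \<delta>" "\<delta> \<le> 1"
  shows "cmod (Determinant.det (Matrix.mat (q + p) (q + p) (\<lambda>(i, j). A i j)))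
    \<le> fact (q + p) * (B ^ (q + p) * \<delta> ^ (p - q))"
proof -
  let ?P = "{\<pi>. \<pi> permutes {0..<q + p}}"
  have "Determinant.det (Matrix.mat (q + p) (q + p) (\<lambda>(i, j). A i j))
      = (\<Sum>\<pi>\<in>?P. signof \<pi> * (\<Prod>i = 0..<q + p. Matrix.mat (q + p) (q + p) (\<lambda>(i, j). A i j) $$ (i, \<pi> i)))"
    by (rule det_def') simp
  also have "\<dots> = (\<Sum>\<pi>\<in>?P. signof \<pi> * (\<Prod>i = 0..<q + p. A i (\<pi> i)))"
    using permutes_in_image by (intro sum.cong refl arg_cong2[where f = "(*)"] prod.cong) fastforce+
  finally have det: "Determinant.det (Matrix.mat (q + p) (q + p) (\<lambda>(i, j). A i j))
      = (\<Sum>\<pi>\<in>?P. signof \<pi> * (\<Prod>i = 0..<q + p. A i (\<pi> i)))" .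
  have "cmod (Determinant.det (Matrix.mat (q + p) (q + p) (\<lambda>(i, j). A i j)))
      \<le> (\<Sum>\<pi>\<in>?P. B ^ (q + p) * \<delta> ^ (p - q))"
    unfolding det
  proof (rule sum_norm_le)
    fix \<pi> assume "\<pi> \<in> ?P"
    then have "cmod (\<Prod>i = 0..<q + p. A i (\<pi> i)) \<le> B ^ (q + p) * \<delta> ^ (p - q)"
      using B d by (intro norm_prod_permutation_bound) auto
    then show "cmod (signof \<pi> * (\<Prod>i = 0..<q + p. A i (\<pi> i))) \<le> B ^ (q + p) * \<delta> ^ (p - q)"
      by (simp add: norm_mult sign_def)
  qed
  also have "\<dots> = fact (q + p) * (B ^ (q + p) * \<delta> ^ (p - q))"
    by (simp add: card_permutations[OF refl])
  finally show ?thesis .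
qed

text \<open>The perturbation of a matrix of rank \<open>q\<close> is a Schur complement in a block matrix whose large
  entries lie in \<open>q\<close> rows and \<open>q\<close> columns.\<close>

lemma norm_det_low_rank_bound:
  fixes f :: "nat \<Rightarrow> nat \<Rightarrow> complex" and u w :: "nat \<Rightarrow> nat \<Rightarrow> complex"
  assumes u: "\<And>i t. i < p \<Longrightarrow> t < q \<Longrightarrow> cmod (u i t) \<le> B"
    and w: "\<And>j t. j < p \<Longrightarrow> t < q \<Longrightarrow> cmod (w t j) \<le> B" and B: "1 \<le> B"
    and d: "\<And>i j. i < p \<Longrightarrow> j < p \<Longrightarrow> cmod (f i j - (\<Sum>t<q. u i t * w t j)) \<le> \<delta>" "0 \<le> \<delta>" "\<delta> \<le> 1"
  shows "cmod (Determinant.det (Matrix.mat p p (\<lambda>(i, j). f i j)))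
    \<le> fact (q + p) * (B ^ (q + p) * \<delta> ^ (p - q))"
proof -
  define U where "U = Matrix.mat p q (\<lambda>(i, t). u i t)"
  define W where "W = Matrix.mat q p (\<lambda>(t, j). w t j)"
  define R where "R = Matrix.mat p p (\<lambda>(i, j). f i j - (\<Sum>t<q. u i t * w t j))"
  define F where "F = Matrix.mat p p (\<lambda>(i, j). f i j)"
  have car: "U \<in> carrier_mat p q" "W \<in> carrier_mat q p" "R \<in> carrier_mat p p" "F \<in> carrier_mat p p"
    by (auto simp: U_def W_def R_def F_def)
  have UW: "(U * W) $$ (i, j) = (\<Sum>t<q. u i t * w t j)" if "i < p" "j < p" for i j
    using that by (simp add: U_def W_def scalar_prod_def atLeast0LessThan)
  have F: "U * W + R = F"
    using UW car by (intro eq_matI) (auto simp: R_def F_def)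
  define M where "M = four_block_mat (1\<^sub>m q) (- W) U R"
  have M: "M \<in> carrier_mat (q + p) (q + p)"
    using car by (simp add: M_def)
  \<comment> \<open>Adding the first \<open>q\<close> columns times \<open>W\<close> to the last
    \<open>p\<close> columns clears the block \<open>- W\<close> and turns \<open>R\<close> into
    \<open>U * W + R = F\<close>. The multiplier has determinant 1, so \<open>M\<close> has the
    determinant of \<open>F\<close>, while its own lower right block \<open>R\<close> is
    small.\<close>
  have "M * four_block_mat (1\<^sub>m q) W (0\<^sub>m p q) (1\<^sub>m p)
      = four_block_mat (1\<^sub>m q * 1\<^sub>m q + - W * 0\<^sub>m p q) (1\<^sub>m q * W + - W * 1\<^sub>m p)
          (U * 1\<^sub>m q + R * 0\<^sub>m p q) (U * W + R * 1\<^sub>m p)"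
    unfolding M_def using car by (intro mult_four_block_mat) auto
  also have "\<dots> = four_block_mat (1\<^sub>m q) (0\<^sub>m q p) U F"
  proof -
    have "1\<^sub>m q * W + - W * 1\<^sub>m p = 0\<^sub>m q p"
      using car by (simp add: left_mult_one_mat right_mult_one_mat[of _ q p] minus_add_uminus_mat[of W q p W, symmetric])
    moreover have "1\<^sub>m q * 1\<^sub>m q + - W * 0\<^sub>m p q = 1\<^sub>m q"
      using car by (simp add: right_mult_zero_mat[of _ q p])
    moreover have "U * 1\<^sub>m q + R * 0\<^sub>m p q = U" "U * W + R * 1\<^sub>m p = F"
      using car F by (simp_all add: right_mult_zero_mat[of _ p p])
    ultimately show ?thesis by simp
  qed
  finally have "Determinant.det (M * four_block_mat (1\<^sub>m q) W (0\<^sub>m p q) (1\<^sub>m p))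
      = Determinant.det (four_block_mat (1\<^sub>m q) (0\<^sub>m q p) U F)" by simp
  moreover have "Determinant.det (M * four_block_mat (1\<^sub>m q) W (0\<^sub>m p q) (1\<^sub>m p)) = Determinant.det M"
    using car M det_mult[OF M, of "four_block_mat (1\<^sub>m q) W (0\<^sub>m p q) (1\<^sub>m p)"]
    by (simp add: det_four_block_mat_lower_left_zero[where n = q and m = p])
  ultimately have det: "Determinant.det M = Determinant.det F"
    using car by (simp add: det_four_block_mat_upper_right_zero[where n = q and m = p])
  have "M = Matrix.mat (q + p) (q + p) (\<lambda>(i, j). M $$ (i, j))"
    using M by (intro eq_matI) auto
  moreover have "cmod (Determinant.det (Matrix.mat (q + p) (q + p) (\<lambda>(i, j). M $$ (i, j))))
    \<le> fact (q + p) * (B ^ (q + p) * \<delta> ^ (p - q))"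
  proof (rule norm_det_block_bound)
    show "cmod (M $$ (i, j)) \<le> \<delta>" if "q \<le> i" "i < q + p" "q \<le> j" "j < q + p" for i j
      using that d car by (auto simp: M_def R_def)
    show "cmod (M $$ (i, j)) \<le> B" if ij: "i < q + p" "j < q + p" for i j
    proof -
      \<comment> \<open>The entries of the small block satisfy the general bound as well, since
        \<delta> \<le> 1 \<le> B.\<close>
      have "cmod (f (i - q) (j - q) - (\<Sum>t<q. u (i - q) t * w t (j - q))) \<le> B" if "q \<le> i" "q \<le> j"
        using d(1)[of "i - q" "j - q"] d(3) B ij that by (smt (verit) less_diff_conv2 add.commute)
      then show ?thesis
        using u w B ij by (auto simp: M_def U_def W_def R_def one_mat_def)
    qed
  qed (use B d in auto)
  ultimately show ?thesis
    using det by (simp add: F_def)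
qed

text \<open>A matrix of nodes with nonzero determinant whose bordered determinants are relatively small
  interpolates well, by Laplace expansion.\<close>

lemma interpolation_of_det_ratio:
  fixes f :: "'x \<Rightarrow> 'y \<Rightarrow> complex" and p :: nat
  defines "D \<equiv> \<lambda>p xs ys. Determinant.det (Matrix.mat p p (\<lambda>(i, j). f (xs i) (ys j)))"
  assumes D0: "D p xs ys \<noteq> 0"
    and ratio: "\<And>x y. x \<in> X \<Longrightarrow> y \<in> Y \<Longrightarrow> cmod (D (Suc p) (xs(p := x)) (ys(p := y))) \<le> \<epsilon> * cmod (D p xs ys)"
  shows "\<exists>a. \<forall>x\<in>X. \<forall>y\<in>Y. cmod (f x y - (\<Sum>j<p. f x (ys j) * (\<Sum>i<p. a i j * f (xs i) y))) \<le> \<epsilon>"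
proof -
  define C where "C x y = Matrix.mat (Suc p) (Suc p) (\<lambda>(i, j). f ((xs(p := x)) i) ((ys(p := y)) j))" for x y
  have carC: "C x y \<in> carrier_mat (Suc p) (Suc p)" for x y
    by (simp add: C_def)
  have DC: "D (Suc p) (xs(p := x)) (ys(p := y)) = Determinant.det (C x y)" for x y
    by (simp add: D_def C_def)
  \<comment> \<open>The minor of the bordered matrix without its last row and its column
    \<open>j < p\<close>. Deleting column \<open>j\<close> shifts the later ones, so the bordering
    point \<open>y\<close> occurs in the last column \<open>p - 1\<close> and nowhere else.\<close>
  define G where "G j y = Matrix.mat p p (\<lambda>(i, k). if k < j then f (xs i) (ys k)
      else if Suc k = p then f (xs i) y else f (xs i) (ys (Suc k)))" for j y
  have del: "mat_delete (C x y) p j = (if j = p then Matrix.mat p p (\<lambda>(i, j). f (xs i) (ys j)) else G j y)"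
    if "j \<le> p" for x y j
    using that by (intro eq_matI) (auto simp: mat_delete_def C_def G_def)
  \<comment> \<open>Cofactors along the last column of \<open>G j y\<close>. That column is deleted,
    so they do not depend on \<open>y\<close>, and \<open>undefined\<close> may stand for it; the
    case \<open>p = 0\<close> only guards the subtraction \<open>p - 1\<close>.\<close>
  define E where "E j i = (if 0 < p then
      (-1) ^ (i + (p - 1)) * Determinant.det (mat_delete (G j undefined) i (p - 1)) else 0)" for i j
  have G: "Determinant.det (G j y) = (\<Sum>i<p. f (xs i) y * E j i)" if "j < p" for j y
  proof -
    have "Determinant.det (G j y) = (\<Sum>i<p. G j y $$ (i, p - 1) * cofactor (G j y) i (p - 1))"
      by (rule laplace_expansion_column) (use that in \<open>auto simp: G_def\<close>)
    also have "\<dots> = (\<Sum>i<p. f (xs i) y * E j i)"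
    proof (rule sum.cong[OF refl])
      fix i assume "i \<in> {..<p}"
      moreover have "mat_delete (G j y) i (p - 1) = mat_delete (G j undefined) i (p - 1)"
        using that by (intro eq_matI) (auto simp: mat_delete_def G_def)
      ultimately show "G j y $$ (i, p - 1) * cofactor (G j y) i (p - 1) = f (xs i) y * E j i"
        using that by (auto simp: cofactor_def E_def G_def)
    qed
    finally show ?thesis .
  qed
  \<comment> \<open>Read off from the expansion of the bordered determinant along its last row: the
    coefficient of \<open>f x y\<close> is \<open>D p xs ys\<close>, the other terms are
    \<open>f x (ys j)\<close> times a combination of the \<open>f (xs i) y\<close>. Dividing by
    \<open>D p xs ys\<close> leaves the interpolation error.\<close>
  define a where "a i j = - ((-1) ^ (p + j) * E j i / D p xs ys)" for i j
  have "cmod (f x y - (\<Sum>j<p. f x (ys j) * (\<Sum>i<p. a i j * f (xs i) y))) \<le> \<epsilon>"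
    if "x \<in> X" "y \<in> Y" for x y
  proof -
    have "Determinant.det (C x y) = (\<Sum>j<Suc p. C x y $$ (p, j) * cofactor (C x y) p j)"
      by (rule laplace_expansion_row[OF carC]) simp
    also have "\<dots> = (\<Sum>j<p. f x (ys j) * ((-1) ^ (p + j) * Determinant.det (G j y))) + f x y * D p xs ys"
      by (simp add: cofactor_def del D_def flip: mult_2) (simp add: C_def cong: if_cong)
    also have "\<dots> = (f x y - (\<Sum>j<p. f x (ys j) * (\<Sum>i<p. a i j * f (xs i) y))) * D p xs ys"
    proof -
      have "(\<Sum>i<p. a i j * f (xs i) y) * D p xs ys = - ((-1) ^ (p + j) * Determinant.det (G j y))"
        if "j < p" for j
        using D0 by (simp add: G that a_def sum_distrib_left sum_distrib_right sum_negf mult_ac)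
      then show ?thesis
        by (simp add: ring_distribs sum_distrib_right mult.assoc sum_negf)
    qed
    finally have "cmod (f x y - (\<Sum>j<p. f x (ys j) * (\<Sum>i<p. a i j * f (xs i) y))) * cmod (D p xs ys)
        \<le> \<epsilon> * cmod (D p xs ys)"
      using ratio[OF that] by (simp add: DC norm_mult)
    then show ?thesis
      using D0 by simp
  qed
  then show ?thesis by blast
qed

text \<open>If no nodes interpolate with error \<epsilon>, then any nonzero determinant can be
  bordered so as to grow by a factor larger than \<epsilon>, whence determinants of every size
  \<open>p\<close> with modulus at least \<open>\<epsilon> ^ p\<close> exist. A kernel close to rank
  \<open>q\<close> forbids this for \<open>p = 2q\<close>. No maximum has to be attained, so
  \<open>X\<close> and \<open>Y\<close> carry no topology and the approximants \<open>u\<close>,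
  \<open>w\<close> need no regularity.\<close>

theorem cross_approximation:
  fixes f :: "'x \<Rightarrow> 'y \<Rightarrow> complex"
  assumes low_rank: "\<And>\<eta>. 0 < \<eta> \<Longrightarrow> \<exists>q \<delta> u w. 1 \<le> q \<and> 0 \<le> \<delta> \<and> \<delta> \<le> 1 \<and> (real (3 * q) * B) ^ 3 * \<delta> < \<eta> \<and>
      (\<forall>x\<in>X. \<forall>t<q. cmod (u x t) \<le> B) \<and> (\<forall>y\<in>Y. \<forall>t<q. cmod (w t y) \<le> B) \<and>
      (\<forall>x\<in>X. \<forall>y\<in>Y. cmod (f x y - (\<Sum>t<q. u x t * w t y)) \<le> \<delta>)"
    and B: "1 \<le> B" and "0 < \<epsilon>"
  shows "\<exists>(p::nat) xs ys a. (\<forall>i<p. xs i \<in> X) \<and> (\<forall>j<p. ys j \<in> Y) \<and>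
    (\<forall>x\<in>X. \<forall>y\<in>Y. cmod (f x y - (\<Sum>j<p. f x (ys j) * (\<Sum>i<p. a i j * f (xs i) y))) \<le> \<epsilon>)"
proof (rule ccontr)
  assume none: "\<not> ?thesis"
  define D where "D p xs ys = Determinant.det (Matrix.mat p p (\<lambda>(i, j). f (xs i) (ys j)))"
    for p and xs :: "nat \<Rightarrow> 'x" and ys :: "nat \<Rightarrow> 'y"
  have large: "\<exists>xs ys. (\<forall>i<p. xs i \<in> X) \<and> (\<forall>j<p. ys j \<in> Y) \<and> \<epsilon> ^ p \<le> cmod (D p xs ys)" for p
  proof (induction p)
    case 0
    then show ?case by (simp add: D_def det_dim_zero)
  next
    case (Suc p)
    then obtain xs ys where IH: "\<forall>i<p. xs i \<in> X" "\<forall>j<p. ys j \<in> Y" "\<epsilon> ^ p \<le> cmod (D p xs ys)"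
      by blast
    then have "D p xs ys \<noteq> 0"
      using \<open>0 < \<epsilon>\<close> by (metis norm_zero not_less zero_less_power)
    have "\<exists>x\<in>X. \<exists>y\<in>Y. \<epsilon> * cmod (D p xs ys) < cmod (D (Suc p) (xs(p := x)) (ys(p := y)))"
    proof (rule ccontr)
      assume "\<not> ?thesis"
      then have "\<exists>a. \<forall>x\<in>X. \<forall>y\<in>Y. cmod (f x y - (\<Sum>j<p. f x (ys j) * (\<Sum>i<p. a i j * f (xs i) y))) \<le> \<epsilon>"
        using \<open>D p xs ys \<noteq> 0\<close> unfolding D_def
        by (intro interpolation_of_det_ratio) (auto simp: not_less)
      then show False
        using none IH(1,2) by blast
    qed
    then obtain x y where xy: "x \<in> X" "y \<in> Y" "\<epsilon> * cmod (D p xs ys) < cmod (D (Suc p) (xs(p := x)) (ys(p := y)))"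
      by blast
    have "\<epsilon> ^ Suc p \<le> \<epsilon> * cmod (D p xs ys)"
      using IH \<open>0 < \<epsilon>\<close> by simp
    then have "\<epsilon> ^ Suc p \<le> cmod (D (Suc p) (xs(p := x)) (ys(p := y)))"
      using xy(3) by linarith
    moreover have "\<forall>i<Suc p. (xs(p := x)) i \<in> X" "\<forall>j<Suc p. (ys(p := y)) j \<in> Y"
      using xy IH(1,2) by (auto simp: less_Suc_eq)
    ultimately show ?case
      by blast
  qed
  \<comment> \<open>With \<open>p = 2q\<close> the block bound has size \<open>q + p = 3q\<close>
    and contains \<open>p - q = q\<close> small factors. It becomes the \<open>q\<close>-th power of
    \<open>(3 q B)^3 \<delta>\<close>, to be compared with \<open>\<epsilon> ^ (2 * q)\<close>;
    hence the choice \<open>\<epsilon>\<^sup>2\<close> for \<eta>.\<close>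
  obtain q \<delta> u w where q: "1 \<le> q" "0 \<le> \<delta>" "\<delta> \<le> 1" "(real (3 * q) * B) ^ 3 * \<delta> < \<epsilon>\<^sup>2"
    and uw: "\<forall>x\<in>X. \<forall>t<q. cmod (u x t) \<le> B" "\<forall>y\<in>Y. \<forall>t<q. cmod (w t y) \<le> B"
      "\<forall>x\<in>X. \<forall>y\<in>Y. cmod (f x y - (\<Sum>t<q. u x t * w t y)) \<le> \<delta>"
    using low_rank[of "\<epsilon>\<^sup>2"] \<open>0 < \<epsilon>\<close> by auto
  obtain xs ys where xs: "\<forall>i<2 * q. xs i \<in> X" and ys: "\<forall>j<2 * q. ys j \<in> Y"
    and big: "\<epsilon> ^ (2 * q) \<le> cmod (D (2 * q) xs ys)"
    using large by blast
  have "cmod (D (2 * q) xs ys) \<le> fact (q + 2 * q) * (B ^ (q + 2 * q) * \<delta> ^ (2 * q - q))"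
    unfolding D_def
    by (rule norm_det_low_rank_bound[where u = "\<lambda>i. u (xs i)" and w = "\<lambda>t j. w t (ys j)"])
      (use uw xs ys q B in auto)
  also have "\<dots> = fact (3 * q) * (B ^ (3 * q) * \<delta> ^ q)"
    by simp
  also have "\<dots> \<le> real (3 * q) ^ (3 * q) * (B ^ (3 * q) * \<delta> ^ q)"
  proof (rule mult_right_mono)
    show "fact (3 * q) \<le> real (3 * q) ^ (3 * q)"
      using fact_le_power[of "3 * q", where 'a = real] by (simp only: of_nat_power)
  qed (use B q in auto)
  also have "\<dots> = ((real (3 * q) * B) ^ 3 * \<delta>) ^ q"
    by (simp only: power_mult_distrib power_mult mult.assoc)
  also have "\<dots> < (\<epsilon>\<^sup>2) ^ q"
    using q B by (intro power_strict_mono) auto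
  finally show False
    using big by (simp add: power_mult)
qed

section \<open>Interpolation at roots of unity in polydiscs\<close>

text \<open>The Lagrange basis polynomial for the \<open>m\<close>-th roots of unity scaled by
  \<open>r\<close>, written as a geometric sum. In this form both its values on monomials and its
  size can be computed directly.\<close>

definition unity_interp :: "nat \<Rightarrow> real \<Rightarrow> nat \<Rightarrow> complex \<Rightarrow> complex"
  where "unity_interp m r l t = (\<Sum>k<m. (t / (of_real r * exp (2 * of_real pi * \<i> * of_nat l / of_nat m))) ^ k) / of_nat m"

abbreviation unity_node :: "nat \<Rightarrow> real \<Rightarrow> nat \<Rightarrow> complex"
  where "unity_node m r l \<equiv> of_real r * exp (2 * of_real pi * \<i> * of_nat l / of_nat m)"

lemma norm_unity_node: "0 \<le> r \<Longrightarrow> cmod (unity_node m r l) = r"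
  using norm_exp_i_times[of "2 * pi * real l / real m"] by (simp add: norm_mult mult_ac)

text \<open>Orthogonality of the characters of the cyclic group of order \<open>m\<close>:
  exchanging the roles of index and exponent turns the sum into a geometric one.\<close>

lemma sum_unity_powers:
  assumes "0 < m" "j < m"
  shows "(\<Sum>l<m. exp (2 * of_real pi * \<i> * of_nat l / of_nat m) ^ k / exp (2 * of_real pi * \<i> * of_nat l / of_nat m) ^ j)
    = (if k mod m = j then of_nat m else 0 :: complex)"
proof -
  define \<omega> where "\<omega> i = exp (2 * of_real pi * \<i> * of_nat i / of_nat m)" for i :: nat
  have pow: "\<omega> i ^ n = \<omega> n ^ i" for i n
    by (simp add: \<omega>_def mult_ac flip: exp_of_nat_mult)
  have one: "\<omega> i ^ m = 1" for i
    using assms by (simp add: \<omega>_def exp_eq_1 flip: exp_of_nat_mult) (metis of_int_of_nat_eq mult.commute)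
  have eq: "\<omega> k = \<omega> j \<longleftrightarrow> k mod m = j"
    using complex_root_unity_eq[of m k j] assms by (simp add: \<omega>_def cong_def)
  have "(\<Sum>l<m. \<omega> l ^ k / \<omega> l ^ j) = (\<Sum>l<m. (\<omega> k / \<omega> j) ^ l)"
    by (simp add: pow[of _ k] pow[of _ j] power_divide)
  also have "\<dots> = (if k mod m = j then of_nat m else 0)"
  proof (cases "k mod m = j")
    case True
    then show ?thesis using eq by (simp add: \<omega>_def)
  next
    case False
    then have "\<omega> k / \<omega> j \<noteq> 1"
      using eq by (simp add: \<omega>_def)
    from geometric_sum[OF this, of m] show ?thesis
      using False by (simp add: power_divide one)
  qed
  finally show ?thesis by (simp add: \<omega>_def)
qed

text \<open>Aliasing: all nodes have the same \<open>m\<close>-th power \<open>r ^ m\<close>, so on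
  them a monomial coincides with its reduction to degree below \<open>m\<close>, which is
  interpolated exactly.\<close>

lemma unity_interp_power:
  assumes "0 < m" "0 < r"
  shows "(\<Sum>l<m. unity_interp m r l t * unity_node m r l ^ k) = t ^ (k mod m) * of_real r ^ (k - k mod m)"
proof -
  define \<omega> where "\<omega> i = exp (2 * of_real pi * \<i> * of_nat i / of_nat m)" for i :: nat
  have "(\<Sum>l<m. unity_interp m r l t * unity_node m r l ^ k)
      = (\<Sum>l<m. \<Sum>j<m. t ^ j * (of_real r ^ k / of_real r ^ j) / of_nat m * (\<omega> l ^ k / \<omega> l ^ j))"
  proof (rule sum.cong[OF refl])
    fix l
    have "(t / (of_real r * \<omega> l)) ^ j / of_nat m * (of_real r * \<omega> l) ^ k
        = t ^ j * (of_real r ^ k / of_real r ^ j) / of_nat m * (\<omega> l ^ k / \<omega> l ^ j)" for j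
      unfolding power_mult_distrib power_divide times_divide_times_eq times_divide_eq_left times_divide_eq_right
        divide_divide_eq_left by (simp only: mult_ac)
    then show "unity_interp m r l t * unity_node m r l ^ k
        = (\<Sum>j<m. t ^ j * (of_real r ^ k / of_real r ^ j) / of_nat m * (\<omega> l ^ k / \<omega> l ^ j))"
      by (simp add: unity_interp_def flip: \<omega>_def) (simp add: sum_divide_distrib sum_distrib_right)
  qed
  also have "\<dots> = (\<Sum>j<m. t ^ j * (of_real r ^ k / of_real r ^ j) / of_nat m * (\<Sum>l<m. \<omega> l ^ k / \<omega> l ^ j))"
    by (subst sum.swap) (simp add: sum_distrib_left)
  also have "\<dots> = (\<Sum>j<m. if k mod m = j then t ^ j * (of_real r ^ k / of_real r ^ j) else 0)"
    using assms sum_unity_powers[of m _ k] by (intro sum.cong) (auto simp: \<omega>_def)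
  also have "\<dots> = t ^ (k mod m) * (of_real r ^ k / of_real r ^ (k mod m))"
    using assms by (simp add: sum.delta')
  also have "(of_real r :: complex) ^ k / of_real r ^ (k mod m) = of_real r ^ (k - k mod m)"
    using assms by (simp add: power_diff)
  finally show ?thesis .
qed

text \<open>On the disc of half the radius of the nodes the geometric sums are at most 2. The
  Lebesgue constant is thus bounded independently of \<open>m\<close>, which makes the iteration
  over several variables harmless.\<close>

lemma norm_unity_interp_le:
  assumes "0 < r" "cmod t \<le> r / 2"
  shows "(\<Sum>l<m. cmod (unity_interp m r l t)) \<le> 2"
proof (cases "m = 0")
  case False
  have "cmod (unity_interp m r l t) \<le> 2 / m" for l
  proof -
    have "cmod (\<Sum>k<m. (t / unity_node m r l) ^ k) \<le> (\<Sum>k<m. (1 / 2) ^ k)"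
    proof (rule sum_norm_le)
      fix k
      have "cmod (t / unity_node m r l) \<le> 1 / 2"
        unfolding norm_divide norm_unity_node[OF less_imp_le[OF assms(1)]] using assms
        by (simp add: divide_le_eq)
      then show "cmod ((t / unity_node m r l) ^ k) \<le> (1 / 2) ^ k"
        unfolding norm_power by (intro power_mono) auto
    qed
    also have "\<dots> \<le> 2"
      by (simp add: geometric_sum)
    finally show ?thesis
      unfolding unity_interp_def by (simp add: norm_divide divide_right_mono)
  qed
  then have "(\<Sum>l<m. cmod (unity_interp m r l t)) \<le> (\<Sum>l<m. 2 / m)"
    by (intro sum_mono)
  then show ?thesis using False by simp
qed simp

text \<open>Three radii occur: the nodes and \<open>z\<close> are within \<open>r\<close>, Cauchy's
  estimate is applied at \<open>2 * r\<close>, and \<open>h\<close> is bounded on the open disc of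
  radius \<open>3 * r\<close>. The \<open>k\<close>-th Taylor term is reproduced exactly for
  \<open>k < m\<close> and otherwise contributes at most \<open>2 * r ^ k * C / (2 * r) ^ k\<close>;
  these bounds sum to \<open>4 * C / 2 ^ m\<close>.\<close>

lemma unity_interp_error:
  assumes h: "h holomorphic_on ball z0 (3 * r)" and C: "\<And>z. z \<in> ball z0 (3 * r) \<Longrightarrow> cmod (h z) \<le> C"
    and "0 < m" "0 < r" and z: "cmod (z - z0) \<le> r"
  shows "cmod (h z - (\<Sum>l<m. unity_interp m r l (z - z0) * h (z0 + unity_node m r l))) \<le> 4 * C / 2 ^ m"
proof -
  define a where "a k = (deriv ^^ k) h z0 / fact k" for k
  have a: "cmod (a k) \<le> C / (2 * r) ^ k" for k
  proof -
    have "cmod ((deriv ^^ k) h z0) \<le> fact k * C / (2 * r) ^ k"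
    proof (rule Cauchy_inequality)
      show "h holomorphic_on ball z0 (2 * r)" "continuous_on (cball z0 (2 * r)) h"
        using \<open>0 < r\<close> by (auto intro!: holomorphic_on_imp_continuous_on holomorphic_on_subset[OF h])
      show "cmod (h x) \<le> C" if "cmod (z0 - x) = 2 * r" for x
        using that \<open>0 < r\<close> by (intro C) (simp add: dist_norm)
    qed (use \<open>0 < r\<close> in auto)
    then show ?thesis
      by (simp add: a_def norm_divide field_simps)
  qed
  have "0 \<le> C"
    using order_trans[OF norm_ge_zero a[of 0]] by simp
  have sums: "(\<lambda>k. a k * (w - z0) ^ k) sums h w" if "cmod (w - z0) \<le> r" for w
    unfolding a_def using that \<open>0 < r\<close>
    by (intro holomorphic_power_series[OF h]) (simp add: dist_norm norm_minus_commute)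
  define e where "e k = a k * ((z - z0) ^ k - (z - z0) ^ (k mod m) * of_real r ^ (k - k mod m))" for k
  have "(\<lambda>k. \<Sum>l<m. unity_interp m r l (z - z0) * (a k * (z0 + unity_node m r l - z0) ^ k))
      sums (\<Sum>l<m. unity_interp m r l (z - z0) * h (z0 + unity_node m r l))"
    using \<open>0 < r\<close> by (intro sums_sum sums_mult sums) (simp add: norm_unity_node)
  moreover have "(\<Sum>l<m. unity_interp m r l (z - z0) * (a k * (z0 + unity_node m r l - z0) ^ k))
      = a k * ((z - z0) ^ (k mod m) * of_real r ^ (k - k mod m))" for k
    unfolding unity_interp_power[OF \<open>0 < m\<close> \<open>0 < r\<close>, symmetric] by (simp add: sum_distrib_left mult_ac)
  ultimately have e: "e sums (h z - (\<Sum>l<m. unity_interp m r l (z - z0) * h (z0 + unity_node m r l)))"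
    using sums_diff[OF sums[OF z]] unfolding e_def by (simp add: right_diff_distrib)
  define b where "b k = 2 * C * (1 / 2) ^ (k + m)" for k
  have b: "b sums (2 * C * (1 / 2) ^ m * 2)"
  proof -
    have "(\<lambda>k. (1 / 2 :: real) ^ k) sums 2"
      using geometric_sums[of "1 / 2 :: real"] by simp
    from sums_mult[OF this, of "2 * C * (1 / 2) ^ m"] show ?thesis
      unfolding b_def power_add by (simp only: mult_ac)
  qed
  have "e k = 0" if "k < m" for k
    using that by (simp add: e_def)
  then have "(\<lambda>k. e (k + m)) sums (h z - (\<Sum>l<m. unity_interp m r l (z - z0) * h (z0 + unity_node m r l)))"
    using sums_iff_shift[of e m] e by simp
  moreover have "cmod (e k) \<le> 2 * C * (1 / 2) ^ k" for k
  proof -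
    have "cmod ((z - z0) ^ k - (z - z0) ^ (k mod m) * of_real r ^ (k - k mod m)) \<le> r ^ k + r ^ (k mod m) * r ^ (k - k mod m)"
      using z \<open>0 < r\<close> by (intro order_trans[OF norm_triangle_ineq4] add_mono)
        (auto simp: norm_power norm_mult intro!: power_mono mult_right_mono)
    also have "\<dots> = 2 * r ^ k"
      by (simp flip: power_add)
    finally have "cmod (e k) \<le> C / (2 * r) ^ k * (2 * r ^ k)"
      unfolding e_def norm_mult using a[of k] \<open>0 < r\<close> \<open>0 \<le> C\<close> by (intro mult_mono) auto
    also have "\<dots> = 2 * C * (1 / 2) ^ k"
      using \<open>0 < r\<close> by (simp add: power_mult_distrib power_divide field_simps)
    finally show ?thesis .
  qed
  ultimately have "cmod (h z - (\<Sum>l<m. unity_interp m r l (z - z0) * h (z0 + unity_node m r l))) \<le> 2 * C * (1 / 2) ^ m * 2"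
    using b norm_suminf_le[of "\<lambda>k. e (k + m)" b] by (simp add: b_def sums_iff)
  then show ?thesis
    by (simp add: power_divide field_simps)
qed

definition polydisc :: "nat \<Rightarrow> (nat \<Rightarrow> complex) \<Rightarrow> real \<Rightarrow> (nat \<Rightarrow> complex) set"
  where "polydisc n z0 \<rho> = {z. (\<forall>i<n. cmod (z i - z0 i) < \<rho>) \<and> (\<forall>i\<ge>n. z i = 0)}"

text \<open>Encodes a pair of indices by one number. Grids of nodes, and later pairs of a polydisc
  and a node, are numbered by an initial segment of the naturals in this way.\<close>

lemma sum_div_mod:
  fixes f :: "nat \<Rightarrow> nat \<Rightarrow> 'a::comm_monoid_add"
  assumes "0 < b"
  shows "(\<Sum>t<a * b. f (t div b) (t mod b)) = (\<Sum>i<a. \<Sum>j<b. f i j)"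
proof -
  have "(\<Sum>t<a * b. f (t div b) (t mod b)) = (\<Sum>i<a. \<Sum>t\<in>{i * b..<i * b + b}. f (t div b) (t mod b))"
    by (rule sum.nat_group[symmetric])
  also have "\<dots> = (\<Sum>i<a. \<Sum>j<b. f i j)"
  proof (rule sum.cong[OF refl])
    fix i
    have "(\<Sum>t\<in>{i * b..<i * b + b}. f (t div b) (t mod b)) = (\<Sum>j\<in>{0..<b}. f ((j + i * b) div b) ((j + i * b) mod b))"
      using sum.shift_bounds_nat_ivl[of "\<lambda>t. f (t div b) (t mod b)" 0 "i * b" b] by (simp add: add.commute)
    also have "\<dots> = (\<Sum>j<b. f i j)"
      using assms by (intro sum.cong) auto
    finally show "(\<Sum>t\<in>{i * b..<i * b + b}. f (t div b) (t mod b)) = (\<Sum>j<b. f i j)" .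
  qed
  finally show ?thesis .
qed

text \<open>One variable is interpolated at a time: the first \<open>k\<close> coordinates are moved
  to nodes, the others stay at \<open>z\<close>. A further variable adds its one-dimensional error
  multiplied by the sum of the previous weights, at most \<open>2 ^ k\<close>, which yields the
  factor \<open>2 ^ k - 1\<close> by \<open>(2 ^ k - 1) + 2 ^ k = 2 ^ Suc k - 1\<close>.\<close>

lemma polydisc_interpolation_aux:
  assumes "0 < r" "0 < m" "k \<le> n"
  shows "\<exists>(\<nu> :: nat \<Rightarrow> nat \<Rightarrow> complex) w. (\<forall>t<m ^ k. \<forall>i<k. cmod (\<nu> t i - z0 i) \<le> r) \<and>
    (\<forall>z. (\<forall>i<k. cmod (z i - z0 i) \<le> r / 2) \<longrightarrow> (\<Sum>t<m ^ k. cmod (w t z)) \<le> 2 ^ k) \<and>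
    (\<forall>G C z. (\<forall>z\<in>polydisc n z0 (3 * r). cmod (G z) \<le> C \<and> (\<forall>i<n. (\<lambda>t. G (z(i := t))) field_differentiable at (z i))) \<and>
       (\<forall>i<n. cmod (z i - z0 i) \<le> r / 2) \<and> (\<forall>i\<ge>n. z i = 0) \<longrightarrow>
       cmod (G z - (\<Sum>t<m ^ k. w t z * G (\<lambda>i. if i < k then \<nu> t i else z i))) \<le> (2 ^ k - 1) * (4 * C / 2 ^ m))"
  using \<open>k \<le> n\<close>
proof (induction k)
  case 0
  show ?case
    by (intro exI[of _ "\<lambda>t i. 0"] exI[of _ "\<lambda>t z. 1"]) auto
next
  case (Suc k)
  from Suc.IH[OF Suc_leD[OF Suc.prems]] obtain \<nu> w where
      \<nu>: "\<forall>t<m ^ k. \<forall>i<k. cmod (\<nu> t i - z0 i) \<le> r"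
    and w: "\<forall>z. (\<forall>i<k. cmod (z i - z0 i) \<le> r / 2) \<longrightarrow> (\<Sum>t<m ^ k. cmod (w t z)) \<le> 2 ^ k"
    and err: "\<forall>G C z. (\<forall>z\<in>polydisc n z0 (3 * r). cmod (G z) \<le> C \<and> (\<forall>i<n. (\<lambda>t. G (z(i := t))) field_differentiable at (z i))) \<and>
       (\<forall>i<n. cmod (z i - z0 i) \<le> r / 2) \<and> (\<forall>i\<ge>n. z i = 0) \<longrightarrow>
       cmod (G z - (\<Sum>t<m ^ k. w t z * G (\<lambda>i. if i < k then \<nu> t i else z i))) \<le> (2 ^ k - 1) * (4 * C / 2 ^ m)"
    by (elim exE conjE) (rule that)
  \<comment> \<open>Base \<open>m\<close> numbering: \<open>t mod m\<close> selects the node in the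
    new coordinate \<open>k\<close>, and \<open>t div m\<close> the old grid point.\<close>
  define \<nu>' where "\<nu>' t i = (if i < k then \<nu> (t div m) i else z0 k + unity_node m r (t mod m))" for t i
  define w' where "w' t z = w (t div m) z * unity_interp m r (t mod m) (z k - z0 k)" for t z
  have div: "t div m < m ^ k" if "t < m ^ Suc k" for t
    using that by (simp add: less_mult_imp_div_less mult.commute)
  have S: "(\<Sum>t<m ^ Suc k. f (t div m) (t mod m)) = (\<Sum>i<m ^ k. \<Sum>j<m. f i j)" for f :: "nat \<Rightarrow> nat \<Rightarrow> 'z::comm_monoid_add"
    using sum_div_mod[OF \<open>0 < m\<close>, of f "m ^ k"] by (simp add: mult.commute)
  show ?case
  proof (intro exI[of _ \<nu>'] exI[of _ w'] conjI allI impI)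
    show "cmod (\<nu>' t i - z0 i) \<le> r" if "t < m ^ Suc k" "i < Suc k" for t i
      using that \<nu> div \<open>0 < r\<close> by (auto simp: \<nu>'_def norm_unity_node less_Suc_eq)
    show "(\<Sum>t<m ^ Suc k. cmod (w' t z)) \<le> 2 ^ Suc k" if z: "\<forall>i<Suc k. cmod (z i - z0 i) \<le> r / 2" for z
    proof -
      have "(\<Sum>t<m ^ Suc k. cmod (w' t z)) = (\<Sum>t<m ^ k. cmod (w t z) * (\<Sum>l<m. cmod (unity_interp m r l (z k - z0 k))))"
        unfolding w'_def norm_mult sum_distrib_left by (rule S)
      also have "\<dots> \<le> (\<Sum>t<m ^ k. cmod (w t z) * 2)"
        using z \<open>0 < r\<close> by (intro sum_mono mult_left_mono norm_unity_interp_le) auto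
      also have "\<dots> \<le> 2 ^ Suc k"
        using w[rule_format, of z] z by (simp flip: sum_distrib_right)
      finally show ?thesis .
    qed
    fix G C z
    assume *: "(\<forall>z\<in>polydisc n z0 (3 * r). cmod (G z) \<le> C \<and> (\<forall>i<n. (\<lambda>t. G (z(i := t))) field_differentiable at (z i))) \<and>
       (\<forall>i<n. cmod (z i - z0 i) \<le> r / 2) \<and> (\<forall>i\<ge>n. z i = 0)"
    then have G: "\<And>z. z \<in> polydisc n z0 (3 * r) \<Longrightarrow> cmod (G z) \<le> C"
        "\<And>z i. z \<in> polydisc n z0 (3 * r) \<Longrightarrow> i < n \<Longrightarrow> (\<lambda>t. G (z(i := t))) field_differentiable at (z i)"
      and z: "\<And>i. i < n \<Longrightarrow> cmod (z i - z0 i) \<le> r / 2" "\<And>i. i \<ge> n \<Longrightarrow> z i = 0"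
      by blast+
    define y where "y t = (\<lambda>i. if i < k then \<nu> t i else z i)" for t
    have one: "cmod (G (y t) - (\<Sum>l<m. unity_interp m r l (z k - z0 k) * G ((y t)(k := z0 k + unity_node m r l)))) \<le> 4 * C / 2 ^ m"
      if t: "t < m ^ k" for t
    proof -
      have yt: "(y t)(k := x) \<in> polydisc n z0 (3 * r)" if "x \<in> ball (z0 k) (3 * r)" for x
        unfolding polydisc_def
      proof (intro CollectI conjI allI impI)
        fix i assume "i < n"
        then show "cmod (((y t)(k := x)) i - z0 i) < 3 * r"
          using that \<nu>[rule_format, OF t, of i] z(1)[of i] \<open>0 < r\<close> by (auto simp: y_def dist_norm norm_minus_commute)
      next
        fix i assume "n \<le> i"
        then show "((y t)(k := x)) i = 0"
          using Suc.prems z by (auto simp: y_def)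
      qed
      have "(\<lambda>x. G ((y t)(k := x))) field_differentiable at x" if "x \<in> ball (z0 k) (3 * r)" for x
        using G(2)[OF yt[OF that], of k] Suc.prems by simp
      then have "(\<lambda>x. G ((y t)(k := x))) holomorphic_on ball (z0 k) (3 * r)"
        by (simp add: holomorphic_on_def field_differentiable_at_within)
      from unity_interp_error[OF this _ \<open>0 < m\<close> \<open>0 < r\<close>, of C "z k"]
      show ?thesis
        using G(1)[OF yt] z(1)[of k] Suc.prems \<open>0 < r\<close> by (simp add: y_def fun_upd_idem)
    qed
    have node: "(\<lambda>i. if i < Suc k then \<nu>' t i else z i) = (y (t div m))(k := z0 k + unity_node m r (t mod m))" for t
      by (rule ext) (auto simp: \<nu>'_def y_def less_Suc_eq)
    have "(\<Sum>t<m ^ Suc k. w' t z * G (\<lambda>i. if i < Suc k then \<nu>' t i else z i))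
        = (\<Sum>t<m ^ k. w t z * (\<Sum>l<m. unity_interp m r l (z k - z0 k) * G ((y t)(k := z0 k + unity_node m r l))))"
      unfolding w'_def node sum_distrib_left mult.assoc by (rule S)
    \<comment> \<open>The old interpolation sum is subtracted and added; what remains is a weighted
      sum of errors in coordinate \<open>k\<close> alone.\<close>
    then have "G z - (\<Sum>t<m ^ Suc k. w' t z * G (\<lambda>i. if i < Suc k then \<nu>' t i else z i))
      = (G z - (\<Sum>t<m ^ k. w t z * G (y t)))
        + (\<Sum>t<m ^ k. w t z * (G (y t) - (\<Sum>l<m. unity_interp m r l (z k - z0 k) * G ((y t)(k := z0 k + unity_node m r l)))))"
      by (simp add: right_diff_distrib sum_subtractf)
    also have "cmod \<dots> \<le> (2 ^ k - 1) * (4 * C / 2 ^ m) + 2 ^ k * (4 * C / 2 ^ m)"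
    proof (rule norm_triangle_mono)
      show "cmod (G z - (\<Sum>t<m ^ k. w t z * G (y t))) \<le> (2 ^ k - 1) * (4 * C / 2 ^ m)"
        unfolding y_def by (rule err[rule_format, OF *])
      have "z \<in> polydisc n z0 (3 * r)"
        using z \<open>0 < r\<close> by (force simp: polydisc_def)
      \<comment> \<open>\<open>z\<close> itself lies in the polydisc, so the bound \<open>C\<close>
        cannot be negative; monotonicity in the weights relies on this.\<close>
      then have "0 \<le> C"
        using G(1) norm_ge_zero order_trans by blast
      have "cmod (\<Sum>t<m ^ k. w t z * (G (y t) - (\<Sum>l<m. unity_interp m r l (z k - z0 k) * G ((y t)(k := z0 k + unity_node m r l)))))
          \<le> (\<Sum>t<m ^ k. cmod (w t z) * (4 * C / 2 ^ m))"
        by (intro sum_norm_le) (simp only: norm_mult, intro mult_left_mono one, auto)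
      also have "\<dots> \<le> 2 ^ k * (4 * C / 2 ^ m)"
        unfolding sum_distrib_right[symmetric] using w[rule_format, of z] z Suc.prems \<open>0 \<le> C\<close> by (intro mult_right_mono) auto
      finally show "cmod (\<Sum>t<m ^ k. w t z * (G (y t) - (\<Sum>l<m. unity_interp m r l (z k - z0 k) * G ((y t)(k := z0 k + unity_node m r l)))))
          \<le> 2 ^ k * (4 * C / 2 ^ m)" .
    qed
    also have "(2 ^ k - 1) * x + 2 ^ k * x = (2 ^ Suc k - 1) * x" for x :: real
      by (simp add: algebra_simps)
    finally show "cmod (G z - (\<Sum>t<m ^ Suc k. w' t z * G (\<lambda>i. if i < Suc k then \<nu>' t i else z i)))
        \<le> (2 ^ Suc k - 1) * (4 * C / 2 ^ m)" .
  qed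
qed

text \<open>The form that \<open>cross_approximation\<close> asks for: a sum of \<open>m ^ n\<close>
  products of a function of \<open>G\<close> and a function of \<open>z\<close>. Each weight is
  bounded by the sum of all, and the nodes lie in the polydisc on which \<open>G\<close> is
  bounded.\<close>

lemma polydisc_interpolation:
  assumes "0 < r" "0 < m"
  shows "\<exists>\<nu> w. (\<forall>t<m ^ n. \<nu> t \<in> polydisc n z0 (3 * r)) \<and>
    (\<forall>z. (\<forall>i<n. cmod (z i - z0 i) \<le> r / 2) \<longrightarrow> (\<forall>t<m ^ n. cmod (w t z) \<le> 2 ^ n)) \<and>
    (\<forall>G C z. (\<forall>z\<in>polydisc n z0 (3 * r). cmod (G z) \<le> C \<and> (\<forall>i<n. (\<lambda>t. G (z(i := t))) field_differentiable at (z i))) \<and>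
       (\<forall>i<n. cmod (z i - z0 i) \<le> r / 2) \<and> (\<forall>i\<ge>n. z i = 0) \<longrightarrow>
       cmod (G z - (\<Sum>t<m ^ n. G (\<nu> t) * w t z)) \<le> 2 ^ n * (4 * C / 2 ^ m))"
proof -
  obtain \<nu> w where \<nu>: "\<forall>t<m ^ n. \<forall>i<n. cmod (\<nu> t i - z0 i) \<le> r"
    and w: "\<forall>z. (\<forall>i<n. cmod (z i - z0 i) \<le> r / 2) \<longrightarrow> (\<Sum>t<m ^ n. cmod (w t z)) \<le> 2 ^ n"
    and err: "\<forall>G C z. (\<forall>z\<in>polydisc n z0 (3 * r). cmod (G z) \<le> C \<and> (\<forall>i<n. (\<lambda>t. G (z(i := t))) field_differentiable at (z i))) \<and>
       (\<forall>i<n. cmod (z i - z0 i) \<le> r / 2) \<and> (\<forall>i\<ge>n. z i = 0) \<longrightarrow>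
       cmod (G z - (\<Sum>t<m ^ n. w t z * G (\<lambda>i. if i < n then \<nu> t i else z i))) \<le> (2 ^ n - 1) * (4 * C / 2 ^ m)"
    using polydisc_interpolation_aux[OF assms order.refl, of n z0] by (elim exE conjE) (rule that)
  show ?thesis
  proof (intro exI[of _ "\<lambda>t i. if i < n then \<nu> t i else 0"] exI[of _ w] conjI allI impI)
    show "(\<lambda>i. if i < n then \<nu> t i else 0) \<in> polydisc n z0 (3 * r)" if "t < m ^ n" for t
      using \<nu> that \<open>0 < r\<close> by (force simp: polydisc_def)
    show "cmod (w t z) \<le> 2 ^ n" if "\<forall>i<n. cmod (z i - z0 i) \<le> r / 2" "t < m ^ n" for z t
      using w that member_le_sum[of t "{..<m ^ n}" "\<lambda>t. cmod (w t z)"] by force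
    fix G C z
    assume *: "(\<forall>z\<in>polydisc n z0 (3 * r). cmod (G z) \<le> C \<and> (\<forall>i<n. (\<lambda>t. G (z(i := t))) field_differentiable at (z i))) \<and>
       (\<forall>i<n. cmod (z i - z0 i) \<le> r / 2) \<and> (\<forall>i\<ge>n. z i = 0)"
    then have "z \<in> polydisc n z0 (3 * r)"
      using \<open>0 < r\<close> by (force simp: polydisc_def)
    then have "0 \<le> C"
      using * norm_ge_zero order_trans by blast
    have "(\<lambda>i. if i < n then \<nu> t i else z i) = (\<lambda>i. if i < n then \<nu> t i else 0)" for t
      using * by auto
    then have "cmod (G z - (\<Sum>t<m ^ n. G (\<lambda>i. if i < n then \<nu> t i else 0) * w t z)) \<le> (2 ^ n - 1) * (4 * C / 2 ^ m)"
      using err[rule_format, OF *] by (simp add: mult.commute)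
    also have "\<dots> \<le> 2 ^ n * (4 * C / 2 ^ m)"
      using \<open>0 \<le> C\<close> by (intro mult_right_mono) auto
    finally show "cmod (G z - (\<Sum>t<m ^ n. G (\<lambda>i. if i < n then \<nu> t i else 0) * w t z)) \<le> 2 ^ n * (4 * C / 2 ^ m)" .
  qed
qed

section \<open>Holomorphic functions in charts\<close>

text \<open>The complex coordinate line through \<open>x\<close>. Once \<open>t\<close> leaves the
  image of the chart, \<open>inv_into\<close> returns an arbitrary point, so statements about it
  hold only eventually near \<open>snd c x i\<close>; this suffices for derivatives.\<close>

definition chart_line :: "'a chart \<Rightarrow> nat \<Rightarrow> 'a \<Rightarrow> complex \<Rightarrow> 'a"
  where "chart_line c i x t = inv_into (fst c) (snd c) ((snd c x)(i := t))"

definition chart_diff :: "'a chart \<Rightarrow> nat \<Rightarrow> ('a \<Rightarrow> complex) \<Rightarrow> 'a \<Rightarrow> bool"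
  where "chart_diff c i f x \<longleftrightarrow> (\<lambda>t. f (chart_line c i x t)) field_differentiable at (snd c x i)"

lemma chart_deriv_line: "chart_deriv c i f x = deriv (\<lambda>t. f (chart_line c i x t)) (snd c x i)"
  by (simp add: chart_deriv_def chart_line_def)

lemma continuous_map_mult_complex:
  fixes f g :: "'a \<Rightarrow> complex"
  assumes "continuous_map X euclidean f" "continuous_map X euclidean g"
  shows "continuous_map X euclidean (\<lambda>x. f x * g x)"
  using assms by (simp add: continuous_map_atin tendsto_mult)

lemma continuous_map_locally:
  assumes "\<And>x. x \<in> topspace X \<Longrightarrow> \<exists>T. openin X T \<and> x \<in> T \<and> continuous_map (subtopology X T) Y f"
  shows "continuous_map X Y f"
proof -
  obtain T where T: "\<And>x. x \<in> topspace X \<Longrightarrow> openin X (T x) \<and> x \<in> T x \<and> continuous_map (subtopology X (T x)) Y f"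
    using assms by metis
  show ?thesis
    by (rule pasting_lemma[where I = "topspace X" and T = T and f = "\<lambda>_. f"]) (use T in auto)
qed

context
  fixes M :: "'a cmfd" and c :: "'a chart"
  assumes M: "complex_manifold M" and c: "c \<in> cm_atlas M"
begin

lemma chart_open: "openin (cm_top M) (fst c)"
  using M c unfolding complex_manifold_def by (simp add: case_prod_beta)

lemma chart_subset: "fst c \<subseteq> cm_space M"
  using chart_open by (rule openin_subset)

lemma chart_homeomorphic: "homeomorphic_map (subtopology (cm_top M) (fst c)) (top_of_set (snd c ` fst c)) (snd c)"
  using M c unfolding complex_manifold_def by (simp add: case_prod_beta)

lemma chart_image_open: "openin (top_of_set (Cn (cm_dim M))) (snd c ` fst c)"
  using M c unfolding complex_manifold_def by (simp add: case_prod_beta)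

lemma chart_inj: "inj_on (snd c) (fst c)"
  using homeomorphic_imp_injective_map[OF chart_homeomorphic] chart_subset
  by (simp add: Int_absorb1)

lemma chart_inv: "x \<in> fst c \<Longrightarrow> inv_into (fst c) (snd c) (snd c x) = x"
  using chart_inj by (rule inv_into_f_f)

lemma chart_Cn: "x \<in> fst c \<Longrightarrow> snd c x \<in> Cn (cm_dim M)"
  using openin_imp_subset[OF chart_image_open] by auto

lemma chart_zero: "x \<in> fst c \<Longrightarrow> cm_dim M \<le> i \<Longrightarrow> snd c x i = 0"
  using chart_Cn by (auto simp: Cn_def)

text \<open>\<open>homeomorphic_map\<close> asserts that some inverse exists. Here it is identified
  with the \<open>inv_into\<close> by which holomorphy is defined, and then restricted.\<close>

lemma chart_homeomorphic_subset:
  assumes "S \<subseteq> fst c"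
  shows "homeomorphic_maps (subtopology (cm_top M) S) (top_of_set (snd c ` S)) (snd c) (inv_into (fst c) (snd c))"
proof -
  obtain g where g: "homeomorphic_maps (subtopology (cm_top M) (fst c)) (top_of_set (snd c ` fst c)) (snd c) g"
    using chart_homeomorphic by (auto simp: homeomorphic_map_maps)
  have "homeomorphic_maps (subtopology (cm_top M) (fst c)) (top_of_set (snd c ` fst c)) (snd c) (inv_into (fst c) (snd c))"
    by (rule homeomorphic_maps_eq[OF g])
      (use g chart_inv chart_subset in \<open>auto simp: homeomorphic_maps_def Int_absorb1\<close>)
  then have "homeomorphic_maps (subtopology (subtopology (cm_top M) (fst c)) S)
      (subtopology (top_of_set (snd c ` fst c)) (snd c ` S)) (snd c) (inv_into (fst c) (snd c))"
    by (rule homeomorphic_maps_subtopologies) (use assms chart_subset in auto)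
  then show ?thesis
    using assms by (simp add: subtopology_subtopology Int_absorb1 image_mono)
qed

lemma chart_image_openin:
  assumes "openin (cm_top M) S" "S \<subseteq> fst c"
  shows "openin (top_of_set (Cn (cm_dim M))) (snd c ` S)"
proof -
  have "openin (subtopology (cm_top M) (fst c)) S"
    using assms by (simp add: openin_subset_topspace_eq openin_open_subtopology chart_open)
  then have "openin (top_of_set (snd c ` fst c)) (snd c ` S)"
    using homeomorphic_map_openness_eq[OF chart_homeomorphic] by blast
  then show ?thesis
    using chart_image_open openin_trans by blast
qed

text \<open>Images of charts are open only relative to \<open>Cn (cm_dim M)\<close>. For
  \<open>i < cm_dim M\<close> a change of the coordinate stays in that space, and the admissible
  \<open>t\<close> are the preimage of an open set under a continuous map.\<close>

lemma eventually_chart_upd: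
  assumes x: "x \<in> fst c" "x \<in> S" and S: "openin (cm_top M) S" and i: "i < cm_dim M"
  shows "\<forall>\<^sub>F t in nhds (snd c x i). (snd c x)(i := t) \<in> snd c ` (fst c \<inter> S)"
proof -
  obtain T where T: "open T" "snd c ` (fst c \<inter> S) = Cn (cm_dim M) \<inter> T"
    using chart_image_openin[of "fst c \<inter> S"] S chart_open by (auto simp: openin_open)
  have "continuous_on UNIV (\<lambda>t. ((snd c x)(i := t)) j)" for j
    by (cases "j = i") auto
  then have "continuous_on UNIV (\<lambda>t. (snd c x)(i := t))"
    by (rule continuous_on_coordinatewise_then_product)
  then have "open ((\<lambda>t. (snd c x)(i := t)) -` T)"
    using T(1) by (simp add: continuous_on_open_vimage)
  moreover have "snd c x \<in> T"
    using T(2) x by auto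
  ultimately have "\<forall>\<^sub>F t in nhds (snd c x i). (snd c x)(i := t) \<in> T"
    using eventually_nhds_in_open[of "(\<lambda>t. (snd c x)(i := t)) -` T" "snd c x i"] by simp
  then show ?thesis
    using T(2) chart_Cn[OF x(1)] i by (auto elim!: eventually_mono simp: Cn_def)
qed

lemma chart_line_props:
  assumes "(snd c x)(i := t) \<in> snd c ` S" "S \<subseteq> fst c"
  shows "chart_line c i x t \<in> S" "snd c (chart_line c i x t) = (snd c x)(i := t)"
  using assms chart_inv by (auto simp: chart_line_def)

lemma chart_line_self: "x \<in> fst c \<Longrightarrow> chart_line c i x (snd c x i) = x"
  by (simp add: chart_line_def chart_inv)

lemma eventually_chart_line:
  assumes x: "x \<in> fst c" "x \<in> S" and S: "openin (cm_top M) S" and i: "i < cm_dim M"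
  shows "\<forall>\<^sub>F t in nhds (snd c x i). chart_line c i x t \<in> fst c \<inter> S \<and> snd c (chart_line c i x t) = (snd c x)(i := t)"
  using eventually_chart_upd[OF assms] by eventually_elim (use chart_line_props[of x i _ "fst c \<inter> S"] in auto)

lemma eventually_chart_line_eq:
  assumes x: "x \<in> fst c" "x \<in> S" and S: "openin (cm_top M) S" and i: "i < cm_dim M"
    and eq: "\<And>y. y \<in> fst c \<inter> S \<Longrightarrow> f y = g y"
  shows "\<forall>\<^sub>F t in nhds (snd c x i). f (chart_line c i x t) = g (chart_line c i x t)"
  using eventually_chart_line[OF x S i] by eventually_elim (use eq in auto)

lemma chart_deriv_cong:
  assumes "x \<in> fst c" "x \<in> S" "openin (cm_top M) S" "i < cm_dim M" "\<And>y. y \<in> fst c \<inter> S \<Longrightarrow> f y = g y"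
  shows "chart_deriv c i f x = chart_deriv c i g x"
  unfolding chart_deriv_line by (rule deriv_cong_ev[OF eventually_chart_line_eq[OF assms] refl])

lemma chart_diff_cong:
  assumes "x \<in> fst c" "x \<in> S" "openin (cm_top M) S" "i < cm_dim M" "\<And>y. y \<in> fst c \<inter> S \<Longrightarrow> f y = g y"
  shows "chart_diff c i f x \<longleftrightarrow> chart_diff c i g x"
  unfolding chart_diff_def field_differentiable_def
  by (simp only: DERIV_cong_ev[OF refl eventually_chart_line_eq[where f = f and g = g, OF assms] refl])

lemma chart_deriv_coord:
  assumes "x \<in> fst c" "i < cm_dim M"
  shows "chart_deriv c i (\<lambda>y. snd c y j) x = (if i = j then 1 else 0)"
proof -
  have ev: "\<forall>\<^sub>F t in nhds (snd c x i). snd c (chart_line c i x t) j = (if i = j then t else snd c x j)"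
    using eventually_chart_line[OF assms(1,1) chart_open assms(2)] by eventually_elim auto
  show ?thesis
    unfolding chart_deriv_line deriv_cong_ev[OF ev refl] by (cases "i = j") auto
qed

lemma chart_deriv_cmult: "chart_diff c i f x \<Longrightarrow> chart_deriv c i (\<lambda>y. k * f y) x = k * chart_deriv c i f x"
  by (simp add: chart_deriv_line chart_diff_def)

lemma chart_deriv_mult:
  assumes "x \<in> fst c" "chart_diff c i f x" "chart_diff c i g x"
  shows "chart_deriv c i (\<lambda>y. f y * g y) x = f x * chart_deriv c i g x + chart_deriv c i f x * g x"
  using assms chart_line_self[OF assms(1)] by (simp add: chart_deriv_line chart_diff_def)

lemma chart_deriv_divide:
  assumes "x \<in> fst c" "chart_diff c i f x" "chart_diff c i g x" "g x \<noteq> 0"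
  shows "chart_deriv c i (\<lambda>y. f y / g y) x = (chart_deriv c i f x * g x - f x * chart_deriv c i g x) / (g x)\<^sup>2"
  using assms chart_line_self[OF assms(1)] by (simp add: chart_deriv_line chart_diff_def deriv_divide)

text \<open>Moves holomorphy from the image of the chart to the manifold, where sums, products and
  changes of domain are handled without \<open>inv_into\<close>.\<close>

lemma holomorphic_chart_iff:
  assumes S: "openin (cm_top M) S"
  shows "holomorphic_Cn (cm_dim M) (snd c ` (fst c \<inter> S)) (\<lambda>z. f (inv_into (fst c) (snd c) z)) \<longleftrightarrow>
    continuous_map (subtopology (cm_top M) (fst c \<inter> S)) euclidean f \<and> (\<forall>x\<in>fst c \<inter> S. \<forall>i<cm_dim M. chart_diff c i f x)"
proof -
  have hom: "homeomorphic_maps (subtopology (cm_top M) (fst c \<inter> S)) (top_of_set (snd c ` (fst c \<inter> S))) (snd c)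
      (inv_into (fst c) (snd c))"
    by (rule chart_homeomorphic_subset) simp
  have "continuous_on (snd c ` (fst c \<inter> S)) (\<lambda>z. f (inv_into (fst c) (snd c) z)) \<longleftrightarrow>
      continuous_map (subtopology (cm_top M) (fst c \<inter> S)) euclidean f" (is "?L \<longleftrightarrow> ?R")
  proof
    assume ?L
    then have "continuous_map (subtopology (cm_top M) (fst c \<inter> S)) euclidean ((\<lambda>z. f (inv_into (fst c) (snd c) z)) \<circ> snd c)"
      using hom by (intro continuous_map_compose[where X' = "top_of_set (snd c ` (fst c \<inter> S))"])
        (auto simp: homeomorphic_maps_def)
    then show ?R
      by (rule continuous_map_eq) (auto simp: chart_inv)
  next
    assume ?R
    then have "continuous_map (top_of_set (snd c ` (fst c \<inter> S))) euclidean (f \<circ> inv_into (fst c) (snd c))"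
      using hom by (intro continuous_map_compose) (auto simp: homeomorphic_maps_def)
    then show ?L
      by (simp add: o_def)
  qed
  then show ?thesis
    by (auto simp: holomorphic_Cn_def chart_diff_def chart_line_def chart_inv)
qed

end

section \<open>Holomorphic functions on open subsets of a manifold\<close>

context
  fixes M :: "'a cmfd"
  assumes M: "complex_manifold M"
begin

lemma chart_around:
  assumes "x \<in> cm_space M"
  obtains c where "c \<in> cm_atlas M" "x \<in> fst c"
  using assms M unfolding complex_manifold_def by (simp add: case_prod_beta) blast

text \<open>Continuity is local and the charts cover the manifold, so it can be stated once for all
  of \<open>S\<close>; only differentiability keeps its reference to charts.\<close>

lemma holomorphic_fun_iff:
  assumes S: "openin (cm_top M) S"
  shows "holomorphic_fun M S f \<longleftrightarrow> continuous_map (subtopology (cm_top M) S) euclidean f \<and>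
    (\<forall>c\<in>cm_atlas M. \<forall>x\<in>fst c \<inter> S. \<forall>i<cm_dim M. chart_diff c i f x)"
proof -
  have "holomorphic_fun M S f \<longleftrightarrow> (\<forall>c\<in>cm_atlas M. continuous_map (subtopology (cm_top M) (fst c \<inter> S)) euclidean f \<and>
      (\<forall>x\<in>fst c \<inter> S. \<forall>i<cm_dim M. chart_diff c i f x))"
    unfolding holomorphic_fun_def case_prod_beta using holomorphic_chart_iff[OF M _ S] by (intro ball_cong refl) auto
  moreover have "(\<forall>c\<in>cm_atlas M. continuous_map (subtopology (cm_top M) (fst c \<inter> S)) euclidean f) \<longleftrightarrow>
      continuous_map (subtopology (cm_top M) S) euclidean f" (is "?L \<longleftrightarrow> ?R")
  proof
    assume L: ?L
    show ?R
    proof (rule continuous_map_locally)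
      fix x assume "x \<in> topspace (subtopology (cm_top M) S)"
      then obtain c where c: "c \<in> cm_atlas M" "x \<in> fst c" "x \<in> S"
        using chart_around by auto
      have "openin (cm_top M) (fst c \<inter> S)"
        using S chart_open[OF M c(1)] by blast
      then show "\<exists>T. openin (subtopology (cm_top M) S) T \<and> x \<in> T \<and>
          continuous_map (subtopology (subtopology (cm_top M) S) T) euclidean f"
        using L c S
        by (intro exI[of _ "fst c \<inter> S"]) (auto simp: subtopology_subtopology openin_open_subtopology Int_commute inf_left_commute)
    qed
  next
    assume ?R
    then show ?L
      by (metis continuous_map_from_subtopology_mono inf_le2)
  qed
  ultimately show ?thesis by blast
qed

lemma holomorphic_fun_continuous:
  "openin (cm_top M) S \<Longrightarrow> holomorphic_fun M S f \<Longrightarrow> continuous_map (subtopology (cm_top M) S) euclidean f"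
  by (simp add: holomorphic_fun_iff)

lemma holomorphic_fun_chart_diff:
  "openin (cm_top M) S \<Longrightarrow> holomorphic_fun M S f \<Longrightarrow> c \<in> cm_atlas M \<Longrightarrow> x \<in> fst c \<Longrightarrow> x \<in> S \<Longrightarrow> i < cm_dim M
    \<Longrightarrow> chart_diff c i f x"
  by (simp add: holomorphic_fun_iff)

text \<open>The sheaf property: continuity and partial derivatives at a point depend only on the
  values nearby.\<close>

lemma holomorphic_fun_locally:
  assumes S: "openin (cm_top M) S"
    and loc: "\<And>x. x \<in> S \<Longrightarrow> \<exists>T g. openin (cm_top M) T \<and> x \<in> T \<and> holomorphic_fun M T g \<and> (\<forall>y\<in>T \<inter> S. f y = g y)"
  shows "holomorphic_fun M S f"
  unfolding holomorphic_fun_iff[OF S]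
proof (intro conjI ballI allI impI)
  show "continuous_map (subtopology (cm_top M) S) euclidean f"
  proof (rule continuous_map_locally)
    fix x assume "x \<in> topspace (subtopology (cm_top M) S)"
    then obtain T g where T: "openin (cm_top M) T" "x \<in> T" "x \<in> S" "holomorphic_fun M T g" "\<forall>y\<in>T \<inter> S. f y = g y"
      using loc[of x] by (auto simp del: split_paired_Ex)
    have "continuous_map (subtopology (cm_top M) (T \<inter> S)) euclidean g"
      using holomorphic_fun_continuous[OF T(1,4)] by (rule continuous_map_from_subtopology_mono) simp
    then have "continuous_map (subtopology (cm_top M) (T \<inter> S)) euclidean f"
      by (rule continuous_map_eq) (use T in auto)
    then show "\<exists>T. openin (subtopology (cm_top M) S) T \<and> x \<in> T \<and>
        continuous_map (subtopology (subtopology (cm_top M) S) T) euclidean f"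
      using T S by (intro exI[of _ "T \<inter> S"]) (auto simp: subtopology_subtopology openin_open_subtopology Int_commute inf_left_commute)
  qed
next
  fix c x i assume *: "c \<in> cm_atlas M" "x \<in> fst c \<inter> S" "i < cm_dim M"
  then obtain T g where T: "openin (cm_top M) T" "x \<in> T" "holomorphic_fun M T g" "\<forall>y\<in>T \<inter> S. f y = g y"
    using loc by blast
  then have "chart_diff c i g x"
    using * holomorphic_fun_chart_diff by blast
  moreover have "chart_diff c i f x \<longleftrightarrow> chart_diff c i g x"
    by (rule chart_diff_cong[OF M, where S = "T \<inter> S"]) (use T * S in auto)
  ultimately show "chart_diff c i f x" by simp
qed

lemma holomorphic_fun_subset:
  assumes "holomorphic_fun M S f" "openin (cm_top M) S" "openin (cm_top M) T" "T \<subseteq> S"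
  shows "holomorphic_fun M T f"
  using assms by (intro holomorphic_fun_locally[OF assms(3)]) blast

lemma holomorphic_fun_const: "openin (cm_top M) S \<Longrightarrow> holomorphic_fun M S (\<lambda>x. k)"
  by (simp add: holomorphic_fun_iff chart_diff_def)

lemma holomorphic_fun_add:
  assumes S: "openin (cm_top M) S" and "holomorphic_fun M S f" "holomorphic_fun M S g"
  shows "holomorphic_fun M S (\<lambda>x. f x + g x)"
  using assms(2,3) unfolding holomorphic_fun_iff[OF S] chart_diff_def
  by (auto intro!: continuous_map_add field_differentiable_add)

lemma holomorphic_fun_mult:
  assumes S: "openin (cm_top M) S" and "holomorphic_fun M S f" "holomorphic_fun M S g"
  shows "holomorphic_fun M S (\<lambda>x. f x * g x)"
  using assms(2,3) unfolding holomorphic_fun_iff[OF S] chart_diff_def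
  by (auto intro!: continuous_map_mult_complex field_differentiable_mult)

lemma holomorphic_fun_sum:
  assumes S: "openin (cm_top M) S" and "\<And>k. k \<in> K \<Longrightarrow> holomorphic_fun M S (f k)"
  shows "holomorphic_fun M S (\<lambda>x. \<Sum>k\<in>K. f k x)"
  using assms(2)
  by (induction K rule: infinite_finite_induct) (simp_all add: holomorphic_fun_const holomorphic_fun_add S)

lemma holomorphic_fun_power:
  assumes S: "openin (cm_top M) S" and "holomorphic_fun M S f"
  shows "holomorphic_fun M S (\<lambda>x. f x ^ k)"
  by (induction k) (simp_all add: holomorphic_fun_const holomorphic_fun_mult assms)

lemma holomorphic_fun_divide:
  assumes S: "openin (cm_top M) S" and "holomorphic_fun M S f" "holomorphic_fun M S g" and nz: "\<And>x. x \<in> S \<Longrightarrow> g x \<noteq> 0"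
  shows "holomorphic_fun M S (\<lambda>x. f x / g x)"
  using assms(2,3) unfolding holomorphic_fun_iff[OF S] chart_diff_def
proof (intro conjI ballI allI impI)
  assume *: "continuous_map (subtopology (cm_top M) S) euclidean f \<and>
     (\<forall>c\<in>cm_atlas M. \<forall>x\<in>fst c \<inter> S. \<forall>i<cm_dim M. (\<lambda>t. f (chart_line c i x t)) field_differentiable at (snd c x i))"
    "continuous_map (subtopology (cm_top M) S) euclidean g \<and>
     (\<forall>c\<in>cm_atlas M. \<forall>x\<in>fst c \<inter> S. \<forall>i<cm_dim M. (\<lambda>t. g (chart_line c i x t)) field_differentiable at (snd c x i))"
  show "continuous_map (subtopology (cm_top M) S) euclidean (\<lambda>x. f x / g x)"
    using * nz by (auto simp: continuous_map_atin intro!: tendsto_divide)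
  fix c x i assume "c \<in> cm_atlas M" "x \<in> fst c \<inter> S" "i < cm_dim M"
  then show "(\<lambda>t. f (chart_line c i x t) / g (chart_line c i x t)) field_differentiable at (snd c x i)"
    using * nz by (intro field_differentiable_divide) (auto simp: chart_line_self[OF M])
qed

lemma holomorphic_fun_coord:
  assumes "c \<in> cm_atlas M" "j < cm_dim M"
  shows "holomorphic_fun M (fst c) (\<lambda>x. snd c x j)"
proof -
  have "\<forall>d\<in>cm_atlas M. \<forall>c\<in>cm_atlas M. \<forall>j<cm_dim M.
      holomorphic_Cn (cm_dim M) (snd d ` (fst d \<inter> fst c)) (\<lambda>z. snd c (inv_into (fst d) (snd d) z) j)"
    using M unfolding complex_manifold_def by (simp add: case_prod_beta)
  then show ?thesis
    using assms by (simp add: holomorphic_fun_def case_prod_beta)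
qed

end

section \<open>Partial derivatives of holomorphic functions\<close>

text \<open>The error consists of the Taylor terms of order at least 2. With Cauchy's estimate at
  radius \<rho> and \<open>cmod s \<le> \<rho> / 2\<close> they are dominated by a geometric series
  of ratio 1/2. The bound is explicit in \<open>s\<close> and \<open>C\<close>, hence uniform in
  further parameters.\<close>

lemma difference_quotient_error:
  assumes g: "g holomorphic_on ball a (2 * \<rho>)" and C: "\<And>z. z \<in> ball a (2 * \<rho>) \<Longrightarrow> cmod (g z) \<le> C"
    and "0 < \<rho>" and s: "s \<noteq> 0" "cmod s \<le> \<rho> / 2"
  shows "cmod ((g (a + s) - g a) / s - deriv g a) \<le> 2 * C / \<rho>\<^sup>2 * cmod s"
proof -
  define b where "b k = (deriv ^^ k) g a / fact k" for k
  have b: "cmod (b k) \<le> C / \<rho> ^ k" for k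
  proof -
    have "cmod ((deriv ^^ k) g a) \<le> fact k * C / \<rho> ^ k"
    proof (rule Cauchy_inequality)
      show "g holomorphic_on ball a \<rho>" "continuous_on (cball a \<rho>) g"
        using \<open>0 < \<rho>\<close> by (auto intro!: holomorphic_on_imp_continuous_on holomorphic_on_subset[OF g])
      show "cmod (g x) \<le> C" if "cmod (a - x) = \<rho>" for x
        using that \<open>0 < \<rho>\<close> by (intro C) (simp add: dist_norm)
    qed (use \<open>0 < \<rho>\<close> in auto)
    then show ?thesis
      by (simp add: b_def norm_divide field_simps)
  qed
  have "0 \<le> C"
    using order_trans[OF norm_ge_zero b[of 0]] by simp
  have g_sums: "(\<lambda>k. b k * s ^ k) sums g (a + s)"
    using holomorphic_power_series[OF g, of "a + s"] s \<open>0 < \<rho>\<close> by (simp add: b_def dist_norm)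
  have "(\<Sum>k<2. b k * s ^ k) = g a + deriv g a * s"
    by (simp add: b_def lessThan_Suc numeral_2_eq_2)
  then have "(\<lambda>k. b (k + 2) * s ^ (k + 2)) sums (g (a + s) - g a - deriv g a * s)"
    using sums_iff_shift[of "\<lambda>k. b k * s ^ k" 2 "g (a + s) - g a - deriv g a * s"] g_sums by simp
  moreover have "(\<lambda>k. C * (cmod s / \<rho>)\<^sup>2 * (1 / 2) ^ k) sums (C * (cmod s / \<rho>)\<^sup>2 * 2)"
    using geometric_sums[of "1 / 2 :: real"] by (intro sums_mult) simp
  moreover have "cmod (b (k + 2) * s ^ (k + 2)) \<le> C * (cmod s / \<rho>)\<^sup>2 * (1 / 2) ^ k" for k
  proof -
    have "cmod (b (k + 2) * s ^ (k + 2)) \<le> C / \<rho> ^ (k + 2) * cmod s ^ (k + 2)"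
      unfolding norm_mult norm_power by (intro mult_right_mono b) simp
    also have "\<dots> = C * (cmod s / \<rho>)\<^sup>2 * (cmod s / \<rho>) ^ k"
      by (simp add: power_divide power_add power2_eq_square)
    also have "\<dots> \<le> C * (cmod s / \<rho>)\<^sup>2 * (1 / 2) ^ k"
      using s \<open>0 < \<rho>\<close> \<open>0 \<le> C\<close> by (intro mult_left_mono power_mono) (auto simp: divide_le_eq)
    finally show ?thesis .
  qed
  ultimately have le: "cmod (g (a + s) - g a - deriv g a * s) \<le> C * (cmod s / \<rho>)\<^sup>2 * 2"
    using norm_suminf_le[of "\<lambda>k. b (k + 2) * s ^ (k + 2)" "\<lambda>k. C * (cmod s / \<rho>)\<^sup>2 * (1 / 2) ^ k"] by (simp add: sums_iff)
  have "cmod ((g (a + s) - g a) / s - deriv g a) = cmod (g (a + s) - g a - deriv g a * s) / cmod s"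
    using s by (simp add: diff_divide_distrib flip: norm_divide)
  also have "\<dots> \<le> C * (cmod s / \<rho>)\<^sup>2 * 2 / cmod s"
    using le by (rule divide_right_mono) simp
  also have "\<dots> = 2 * C / \<rho>\<^sup>2 * cmod s"
    using s by (simp add: power2_eq_square power_divide)
  finally show ?thesis .
qed

lemma open_norm_coord_less: "open {z :: nat \<Rightarrow> complex. cmod (z i - a) < \<rho>}"
proof -
  have "continuous_on UNIV (\<lambda>z :: nat \<Rightarrow> complex. z i)"
    by (rule continuous_on_product_coordinates)
  then have "continuous_on UNIV (\<lambda>z :: nat \<Rightarrow> complex. cmod (z i - a))"
    by (intro continuous_intros)
  then show ?thesis
    by (intro open_Collect_less continuous_on_const)
qed

lemma openin_polydisc: "openin (top_of_set (Cn n)) (polydisc n z0 \<rho>)"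
proof -
  have "polydisc n z0 \<rho> = Cn n \<inter> (\<Inter>i\<in>{..<n}. {z. cmod (z i - z0 i) < \<rho>})"
    by (auto simp: polydisc_def Cn_def)
  moreover have "open (\<Inter>i\<in>{..<n}. {z. cmod (z i - z0 i) < \<rho>})"
    by (intro open_INT ballI open_norm_coord_less finite_lessThan)
  ultimately show ?thesis
    by (auto simp: openin_open)
qed

lemma polydisc_self: "z0 \<in> Cn n \<Longrightarrow> 0 < \<rho> \<Longrightarrow> z0 \<in> polydisc n z0 \<rho>"
  by (simp add: polydisc_def Cn_def)

text \<open>A box in the product topology restricts coordinates separately. Those from
  \<open>n\<close> on vanish on both sides, so a minimum of finitely many radii is enough; the
  inserted 1 covers \<open>n = 0\<close>.\<close>

lemma polydisc_nhd:
  assumes S: "openin (top_of_set (Cn n)) S" and z0: "z0 \<in> S"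
  obtains \<rho> where "0 < \<rho>" "polydisc n z0 \<rho> \<subseteq> S"
proof -
  obtain T where T: "open T" "S = Cn n \<inter> T"
    using S by (auto simp: openin_open)
  have "openin (product_topology (\<lambda>i. euclidean) UNIV) T"
    using T by (simp add: open_fun_def)
  then obtain X where X: "z0 \<in> (\<Pi>\<^sub>E i\<in>UNIV. X i)" "\<And>i. open (X i)" "(\<Pi>\<^sub>E i\<in>UNIV. X i) \<subseteq> T"
    using product_topology_open_contains_basis[of "\<lambda>i. euclidean" UNIV T z0] T(2) z0 by auto
  have "\<exists>\<rho>>0. ball (z0 i) \<rho> \<subseteq> X i" for i
    using X by (intro open_contains_ball[THEN iffD1, rule_format]) (auto simp: PiE_iff)
  then obtain \<rho> where \<rho>: "\<And>i. 0 < \<rho> i" "\<And>i. ball (z0 i) (\<rho> i) \<subseteq> X i"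
    by metis
  define r where "r = Min (insert 1 (\<rho> ` {..<n}))"
  have r: "0 < r" "\<And>i. i < n \<Longrightarrow> r \<le> \<rho> i"
    using \<rho> by (auto simp: r_def)
  have "z \<in> S" if z: "z \<in> polydisc n z0 r" for z
  proof -
    have "z i \<in> X i" for i
    proof (cases "i < n")
      case True
      then have "z i \<in> ball (z0 i) (\<rho> i)"
        using z r(2)[OF True] by (force simp: polydisc_def dist_norm norm_minus_commute)
      then show ?thesis using \<rho> by blast
    next
      case False
      then have "z i = z0 i"
        using z z0 T by (auto simp: polydisc_def Cn_def)
      then show ?thesis using X by (auto simp: PiE_iff)
    qed
    then show ?thesis
      using X(3) T(2) z by (auto simp: PiE_iff polydisc_def Cn_def)
  qed
  then show ?thesis
    using r that by blast
qed

text \<open>Tychonoff: the set is a product of closed discs and, from index \<open>n\<close> on,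
  singletons \<open>{0}\<close>.\<close>

lemma compact_closed_polydisc: "compact {z :: nat \<Rightarrow> complex. (\<forall>i<n. cmod (z i - z0 i) \<le> \<rho>) \<and> (\<forall>i\<ge>n. z i = 0)}"
proof -
  have "compactin (product_topology (\<lambda>i. euclidean) UNIV) (\<Pi>\<^sub>E i\<in>UNIV. if i < n then cball (z0 i) \<rho> else {0})"
    unfolding compactin_PiE by (intro disjI2 ballI) simp
  moreover have "(\<Pi>\<^sub>E i\<in>UNIV. if i < n then cball (z0 i) \<rho> else {0}) = {z. (\<forall>i<n. cmod (z i - z0 i) \<le> \<rho>) \<and> (\<forall>i\<ge>n. z i = 0)}"
  proof (rule Set.set_eqI)
    fix z
    have "z \<in> (\<Pi>\<^sub>E i\<in>UNIV. if i < n then cball (z0 i) \<rho> else {0}) \<longleftrightarrow> (\<forall>i. z i \<in> (if i < n then cball (z0 i) \<rho> else {0}))"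
      by (simp add: PiE_iff)
    also have "\<dots> \<longleftrightarrow> (\<forall>i. if i < n then cmod (z i - z0 i) \<le> \<rho> else z i = 0)"
      by (intro all_cong1) (simp add: dist_norm norm_minus_commute)
    also have "\<dots> \<longleftrightarrow> z \<in> {z. (\<forall>i<n. cmod (z i - z0 i) \<le> \<rho>) \<and> (\<forall>i\<ge>n. z i = 0)}"
      by (simp only: if_bool_eq_conj all_conj_distrib linorder_not_less mem_Collect_eq)
    finally show "z \<in> (\<Pi>\<^sub>E i\<in>UNIV. if i < n then cball (z0 i) \<rho> else {0}) \<longleftrightarrow>
        z \<in> {z. (\<forall>i<n. cmod (z i - z0 i) \<le> \<rho>) \<and> (\<forall>i\<ge>n. z i = 0)}" .
  qed
  ultimately have "compactin euclidean {z. (\<forall>i<n. cmod (z i - z0 i) \<le> \<rho>) \<and> (\<forall>i\<ge>n. z i = 0)}"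
    unfolding euclidean_product_topology by (rule subst[rotated])
  then show ?thesis
    unfolding compactin_euclidean_iff .
qed

lemma continuous_on_coord_upd:
  fixes f :: "(nat \<Rightarrow> complex) \<Rightarrow> complex"
  assumes "continuous_on A f"
  shows "continuous_on A (\<lambda>z. z(i := f z))"
proof (rule continuous_on_coordinatewise_then_product)
  fix j
  show "continuous_on A (\<lambda>z. (z(i := f z)) j)"
    using assms continuous_on_subset[OF continuous_on_product_coordinates[of j] subset_UNIV]
    by (cases "j = i") auto
qed

text \<open>Locally, the partial derivative is a uniform limit of difference quotients.\<close>

lemma holomorphic_Cn_deriv:
  assumes S: "openin (top_of_set (Cn n)) S" and h: "holomorphic_Cn n S h" and i: "i < n"
  shows "holomorphic_Cn n S (\<lambda>z. deriv (\<lambda>t. h (z(i := t))) (z i))"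
proof -
  define D where "D z = deriv (\<lambda>t. h (z(i := t))) (z i)" for z
  have hc: "continuous_on S h" and hd: "\<And>z j. z \<in> S \<Longrightarrow> j < n \<Longrightarrow> (\<lambda>t. h (z(j := t))) field_differentiable at (z j)"
    using h by (auto simp: holomorphic_Cn_def)
  have SC: "S \<subseteq> Cn n"
    using S by (rule openin_imp_subset)
  have loc: "\<exists>r>0. polydisc n z0 r \<subseteq> S \<and> continuous_on (polydisc n z0 r) D \<and>
      (\<forall>j<n. (\<lambda>t. D (z0(j := t))) field_differentiable at (z0 j))" if z0: "z0 \<in> S" for z0
  proof -
    have z0C: "z0 \<in> Cn n"
      using SC z0 by blast
    \<comment> \<open>Continuity makes \<open>h\<close> bounded near \<open>z0\<close>, so that the
      error of the difference quotients is uniform there.\<close>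
    have "openin (top_of_set S) (S \<inter> h -` ball (h z0) 1)"
      using hc by (intro continuous_openin_preimage_gen) auto
    then have "openin (top_of_set (Cn n)) (S \<inter> h -` ball (h z0) 1)"
      using S openin_trans by blast
    then obtain R where R: "0 < R" "polydisc n z0 R \<subseteq> S \<inter> h -` ball (h z0) 1"
      using polydisc_nhd[of n "S \<inter> h -` ball (h z0) 1" z0] z0 by auto
    \<comment> \<open>A point of \<open>P\<close>, at distance below \<open>2 * \<rho>\<close> from
      \<open>z0\<close> in each coordinate, may be moved by less than another
      \<open>2 * \<rho>\<close> without leaving the polydisc of radius \<open>R\<close>.\<close>
    define \<rho> where "\<rho> = R / 4"
    define P where "P = polydisc n z0 (2 * \<rho>)"
    define C where "C = cmod (h z0) + 1"
    have "0 < \<rho>" using R by (simp add: \<rho>_def)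
    have bd: "cmod (h z) \<le> C" if "z \<in> polydisc n z0 R" for z
    proof -
      have "dist (h z0) (h z) < 1"
        using R(2) that by auto
      then show ?thesis
        using norm_triangle_ineq2[of "h z" "h z0"] by (simp add: C_def dist_norm norm_minus_commute)
    qed
    have upd: "z(j := t) \<in> polydisc n z0 R" if "z \<in> P" "j < n" "cmod (t - z j) < 2 * \<rho>" for z j t
    proof -
      have "cmod (t - z0 j) < R"
        using that norm_triangle_ineq[of "t - z j" "z j - z0 j"] by (auto simp: P_def polydisc_def \<rho>_def)
      then show ?thesis
        using that R(1) by (auto simp: P_def polydisc_def \<rho>_def)
    qed
    have PR: "z \<in> polydisc n z0 R" if "z \<in> P" for z
      using that R(1) by (force simp: P_def polydisc_def \<rho>_def)
    have hol: "(\<lambda>t. h (z(j := t))) holomorphic_on ball (z j) (2 * \<rho>)" if "z \<in> P" "j < n" for z j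
      unfolding holomorphic_on_def
    proof
      fix t assume "t \<in> ball (z j) (2 * \<rho>)"
      then have "z(j := t) \<in> S"
        using upd[OF that, of t] R(2) by (auto simp: dist_norm norm_minus_commute)
      then show "(\<lambda>t. h (z(j := t))) field_differentiable at t within ball (z j) (2 * \<rho>)"
        using hd[of "z(j := t)" j] that by (simp add: field_differentiable_at_within)
    qed
    \<comment> \<open>Nonzero increments tending to 0, none larger than \<open>\<rho> / 2\<close>,
      as \<open>difference_quotient_error\<close> demands.\<close>
    define s where "s k = complex_of_real (\<rho> / (2 * real (Suc k)))" for k :: nat
    have s: "s k \<noteq> 0" "cmod (s k) = \<rho> / (2 * real (Suc k))" "cmod (s k) \<le> \<rho> / 2" for k
      using \<open>0 < \<rho>\<close> by (simp_all only: s_def norm_of_real of_real_eq_0_iff) (simp_all add: field_simps)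
    define q where "q k z = (h (z(i := z i + s k)) - h z) / s k" for k z
    have sP: "z(i := z i + s k) \<in> polydisc n z0 R" if "z \<in> P" for z k
      using upd[OF that i, of "z i + s k"] s(3)[of k] \<open>0 < \<rho>\<close> by auto
    have err: "cmod (q k z - D z) \<le> 2 * C / \<rho>\<^sup>2 * (\<rho> / (2 * real (Suc k)))" if "z \<in> P" for k z
    proof -
      have "cmod ((h (z(i := z i + s k)) - h (z(i := z i))) / s k - deriv (\<lambda>t. h (z(i := t))) (z i)) \<le> 2 * C / \<rho>\<^sup>2 * cmod (s k)"
        using upd[OF that i] bd s(1,3)[of k] \<open>0 < \<rho>\<close>
        by (intro difference_quotient_error hol that i) (auto simp: dist_norm norm_minus_commute)
      then show ?thesis
        by (simp add: q_def D_def s(2))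
    qed
    have lim: "uniform_limit P q D sequentially"
    proof (rule uniform_limitI)
      fix e :: real assume "0 < e"
      have "(\<lambda>k. 2 * C / \<rho>\<^sup>2 * (\<rho> / 2) * inverse (real (Suc k))) \<longlonglongrightarrow> 2 * C / \<rho>\<^sup>2 * (\<rho> / 2) * 0"
        by (intro tendsto_intros LIMSEQ_inverse_real_of_nat)
      then have "\<forall>\<^sub>F k in sequentially. 2 * C / \<rho>\<^sup>2 * (\<rho> / 2) * inverse (real (Suc k)) < e"
        using \<open>0 < e\<close> by (intro order_tendstoD) auto
      then show "\<forall>\<^sub>F k in sequentially. \<forall>z\<in>P. dist (q k z) (D z) < e"
      proof eventually_elim
        case (elim k)
        show ?case
        proof
          fix z assume "z \<in> P"
          have "2 * C / \<rho>\<^sup>2 * (\<rho> / (2 * real (Suc k))) = 2 * C / \<rho>\<^sup>2 * (\<rho> / 2) * inverse (real (Suc k))"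
            by (simp only: divide_inverse inverse_mult_distrib mult.assoc)
          then show "dist (q k z) (D z) < e"
            using err[OF \<open>z \<in> P\<close>, of k] elim unfolding dist_norm by linarith
        qed
      qed
    qed
    have "continuous_on P (q k)" for k
    proof -
      have "continuous_on P (\<lambda>z. z i)"
        by (rule continuous_on_subset[OF continuous_on_product_coordinates subset_UNIV])
      then have "continuous_on P (\<lambda>z. z(i := z i + s k))"
        by (intro continuous_on_coord_upd continuous_intros)
      then have "continuous_on P (\<lambda>z. h (z(i := z i + s k)))"
        by (rule continuous_on_compose2[OF hc]) (use sP R in blast)
      moreover have "continuous_on P h"
        using PR R by (intro continuous_on_subset[OF hc]) blast
      ultimately show ?thesis
        unfolding q_def using s by (intro continuous_intros) auto
    qed
    then have "continuous_on P D"
      by (intro uniform_limit_theorem[OF _ lim]) auto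
    moreover have "(\<lambda>t. D (z0(j := t))) field_differentiable at (z0 j)" if j: "j < n" for j
    proof -
      let ?B = "ball (z0 j) \<rho>"
      have inP: "z0(j := t) \<in> P" if "t \<in> ?B" for t
        using that j z0C \<open>0 < \<rho>\<close> by (auto simp: P_def polydisc_def Cn_def dist_norm norm_minus_commute)
      have "(\<lambda>t. D (z0(j := t))) holomorphic_on ?B"
      proof (rule holomorphic_uniform_sequence)
        show "(\<lambda>t. q k (z0(j := t))) holomorphic_on ?B" for k
        proof -
          \<comment> \<open>Holomorphy in coordinate \<open>j\<close> of the shifted function: for
            \<open>j = i\<close> the shift is a translation of the variable itself, and for
            \<open>j \<noteq> i\<close> it merely replaces the base point \<open>z0\<close> by
            another point of \<open>P\<close>.\<close>
          have "(\<lambda>t. h (z0(j := t, i := (z0(j := t)) i + s k))) holomorphic_on ?B"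
          proof (cases "j = i")
            case True
            have "((\<lambda>t. h (z0(i := t))) \<circ> (\<lambda>t. t + s k)) holomorphic_on ?B"
            proof (rule holomorphic_on_compose_gen)
              show "(\<lambda>t. h (z0(i := t))) holomorphic_on ball (z0 i) (2 * \<rho>)"
                using z0C \<open>0 < \<rho>\<close> by (intro hol i) (simp add: P_def polydisc_self)
              show "(\<lambda>t. t + s k) ` ball (z0 j) \<rho> \<subseteq> ball (z0 i) (2 * \<rho>)"
              proof clarify
                fix t assume "t \<in> ball (z0 j) \<rho>"
                then show "t + s k \<in> ball (z0 i) (2 * \<rho>)"
                  using True s(3)[of k] \<open>0 < \<rho>\<close> norm_triangle_ineq4[of "z0 i - t" "s k"]
                  by (simp add: dist_norm diff_diff_eq)
              qed
            qed (auto intro: holomorphic_on_add)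
            then show ?thesis
              using True by (simp add: o_def)
          next
            case False
            define y where "y = z0(i := z0 i + s k)"
            have "y \<in> P"
              using z0C s(3)[of k] i \<open>0 < \<rho>\<close> by (auto simp: y_def P_def polydisc_def Cn_def)
            then have "(\<lambda>t. h (y(j := t))) holomorphic_on ball (y j) (2 * \<rho>)"
              by (rule hol) fact
            then have "(\<lambda>t. h (y(j := t))) holomorphic_on ?B"
              by (rule holomorphic_on_subset) (use False \<open>0 < \<rho>\<close> in \<open>auto simp: y_def\<close>)
            then show ?thesis
              using False by (simp add: y_def fun_upd_twist)
          qed
          moreover have "(\<lambda>t. h (z0(j := t))) holomorphic_on ?B"
            using z0C \<open>0 < \<rho>\<close> j
            by (intro holomorphic_on_subset[OF hol[of z0 j]]) (auto simp: P_def polydisc_self)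
          ultimately show ?thesis
            unfolding q_def using s by (intro holomorphic_intros) auto
        qed
        show "\<exists>d>0. cball t d \<subseteq> ?B \<and> uniform_limit (cball t d) (\<lambda>k t. q k (z0(j := t))) (\<lambda>t. D (z0(j := t))) sequentially"
          if t: "t \<in> ?B" for t
        proof -
          obtain d where d: "0 < d" "cball t d \<subseteq> ?B"
            using t open_ball[of "z0 j" \<rho>] unfolding open_contains_cball by blast
          then have "uniform_limit (cball t d) (\<lambda>k t. q k (z0(j := t))) (\<lambda>t. D (z0(j := t))) sequentially"
            using inP by (intro uniform_limit_compose'[OF lim]) auto
          then show ?thesis using d by blast
        qed
      qed simp
      then show ?thesis
        by (rule holomorphic_on_imp_differentiable_at) (use \<open>0 < \<rho>\<close> in auto)
    qed
    ultimately show ?thesis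
      using \<open>0 < \<rho>\<close> PR R(2) by (intro exI[of _ "2 * \<rho>"]) (auto simp: P_def)
  qed
  have "continuous_map (top_of_set S) euclidean D"
  proof (rule continuous_map_locally)
    fix z0 assume "z0 \<in> topspace (top_of_set S)"
    then have "z0 \<in> S" by simp
    from loc[OF this] obtain r where r: "0 < r" "polydisc n z0 r \<subseteq> S" "continuous_on (polydisc n z0 r) D"
      by (elim exE conjE) (rule that)
    have "z0 \<in> polydisc n z0 r"
      using r(1) SC \<open>z0 \<in> S\<close> by (intro polydisc_self) auto
    moreover have "openin (top_of_set S) (polydisc n z0 r)"
      by (rule openin_subset_trans[OF openin_polydisc r(2) SC])
    ultimately show "\<exists>T. openin (top_of_set S) T \<and> z0 \<in> T \<and> continuous_map (subtopology (top_of_set S) T) euclidean D"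
      using r by (intro exI[of _ "polydisc n z0 r"]) (simp add: subtopology_subtopology Int_absorb1)
  qed
  then have "holomorphic_Cn n S D"
    using loc unfolding holomorphic_Cn_def continuous_map_iff_continuous by blast
  then show ?thesis
    unfolding D_def .
qed

section \<open>Cross approximation on products of manifolds\<close>

lemma power_over_exponential: "(\<lambda>m. real m ^ k / 2 ^ m) \<longlonglongrightarrow> 0"
  by real_asymp

context
  fixes M :: "'a cmfd" and c :: "'a chart"
  assumes M: "complex_manifold M" and c: "c \<in> cm_atlas M"
begin

lemma chart_inv_image:
  assumes "z \<in> snd c ` S" "S \<subseteq> fst c"
  shows "inv_into (fst c) (snd c) z \<in> S" "snd c (inv_into (fst c) (snd c) z) = z"
  using assms chart_inv[OF M c] by auto

lemma openin_chart_preimage: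
  assumes "openin (top_of_set (Cn (cm_dim M))) T" "T \<subseteq> snd c ` fst c"
  shows "openin (cm_top M) {x \<in> fst c. snd c x \<in> T}"
proof -
  have "continuous_map (subtopology (cm_top M) (fst c)) (top_of_set (snd c ` fst c)) (snd c)"
    using chart_homeomorphic[OF M c] by (simp add: homeomorphic_map_maps homeomorphic_maps_def)
  moreover have "openin (top_of_set (snd c ` fst c)) T"
    using assms openin_subset_trans openin_imp_subset[OF chart_image_open[OF M c]] by blast
  ultimately have "openin (subtopology (cm_top M) (fst c)) {x \<in> topspace (subtopology (cm_top M) (fst c)). snd c x \<in> T}"
    by (rule openin_continuous_map_preimage)
  moreover have "{x \<in> topspace (subtopology (cm_top M) (fst c)). snd c x \<in> T} = {x \<in> fst c. snd c x \<in> T}"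
    using chart_subset[OF M c] by auto
  ultimately show ?thesis
    using chart_open[OF M c] by (simp add: openin_open_subtopology)
qed

lemma compactin_chart_inverse:
  assumes "compact K" "K \<subseteq> snd c ` fst c"
  shows "compactin (cm_top M) (inv_into (fst c) (snd c) ` K)"
proof -
  have "continuous_map (top_of_set (snd c ` fst c)) (subtopology (cm_top M) (fst c)) (inv_into (fst c) (snd c))"
    using chart_homeomorphic_subset[OF M c order.refl] by (simp add: homeomorphic_maps_def)
  moreover have "compactin (top_of_set (snd c ` fst c)) K"
    using assms by (simp add: compactin_subtopology)
  ultimately have "compactin (subtopology (cm_top M) (fst c)) (inv_into (fst c) (snd c) ` K)"
    using image_compactin by blast
  then show ?thesis
    by (simp add: compactin_subtopology)
qed

end

lemma manifold_polydisc:
  assumes N: "complex_manifold N" and y: "y \<in> cm_space N"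
  obtains e r where "e \<in> cm_atlas N" "y \<in> fst e" "0 < r" "polydisc (cm_dim N) (snd e y) (4 * r) \<subseteq> snd e ` fst e"
proof -
  obtain e where e: "e \<in> cm_atlas N" "y \<in> fst e"
    using chart_around[OF N y] by blast
  obtain \<rho> where "0 < \<rho>" "polydisc (cm_dim N) (snd e y) \<rho> \<subseteq> snd e ` fst e"
    using polydisc_nhd[OF chart_image_open[OF N e(1)], of "snd e y"] e by blast
  then show ?thesis
    using e that[of e "\<rho> / 4"] by simp
qed

text \<open>Interpolation in the finitely many polydiscs of a cover of \<open>L\<close> provides the
  low rank approximants. They are put together by choosing one polydisc for each \<open>y\<close>,
  without any continuity. The functions of \<open>y\<close> in the conclusion are nevertheless
  combinations of the \<open>f (xs i)\<close>, hence holomorphic on all of \<open>N\<close>.\<close>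

lemma manifold_cross_approximation:
  fixes f :: "'x \<Rightarrow> 'b \<Rightarrow> complex"
  assumes N: "complex_manifold N" and L: "compactin (cm_top N) L"
    and hol: "\<And>x. x \<in> X \<Longrightarrow> holomorphic_fun N (cm_space N) (f x)"
    and bdd: "\<And>Q. compactin (cm_top N) Q \<Longrightarrow> \<exists>C. \<forall>x\<in>X. \<forall>y\<in>Q. cmod (f x y) \<le> C"
    and "0 < \<epsilon>"
  shows "\<exists>(p::nat) xs ys a. (\<forall>i<p. xs i \<in> X) \<and> (\<forall>j<p. ys j \<in> L) \<and>
    (\<forall>x\<in>X. \<forall>y\<in>L. cmod (f x y - (\<Sum>j<p. f x (ys j) * (\<Sum>i<p. a i j * f (xs i) y))) \<le> \<epsilon>)"
proof (cases "L = {}")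
  case True
  then show ?thesis
    by (intro exI[of _ 0]) simp
next
  case False
  define n where "n = cm_dim N"
  have LN: "L \<subseteq> cm_space N"
    using L by (rule compactin_subset_topspace)
  have "\<forall>y\<in>L. \<exists>e r. e \<in> cm_atlas N \<and> y \<in> fst e \<and> 0 < r \<and> polydisc n (snd e y) (4 * r) \<subseteq> snd e ` fst e"
    unfolding n_def using LN by (metis manifold_polydisc[OF N] subsetD)
  then obtain e r where er: "\<And>y. y \<in> L \<Longrightarrow> e y \<in> cm_atlas N" "\<And>y. y \<in> L \<Longrightarrow> y \<in> fst (e y)" "\<And>y. y \<in> L \<Longrightarrow> 0 < r y"
      "\<And>y. y \<in> L \<Longrightarrow> polydisc n (snd (e y) y) (4 * r y) \<subseteq> snd (e y) ` fst (e y)"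
    by metis
  \<comment> \<open>Four concentric sizes: the sets \<open>U\<close> of radius \<open>r / 2\<close>,
    where interpolation is accurate, cover \<open>L\<close>; the nodes lie within
    \<open>3 * r\<close>; the closed polydisc \<open>CP\<close> of that radius is compact, so
    \<open>f\<close> is bounded on it; radius \<open>4 * r\<close> still fits into the
    chart.\<close>
  define U where "U y = {x \<in> fst (e y). snd (e y) x \<in> polydisc n (snd (e y) y) (r y / 2)}" for y
  define ci where "ci y = inv_into (fst (e y)) (snd (e y))" for y
  define CP where "CP y = {z. (\<forall>i<n. cmod (z i - snd (e y) y i) \<le> 3 * r y) \<and> (\<forall>i\<ge>n. z i = 0)}" for y
  have sub: "polydisc n (snd (e y) y) (3 * r y) \<subseteq> CP y" "CP y \<subseteq> polydisc n (snd (e y) y) (4 * r y)"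
      "polydisc n (snd (e y) y) (r y / 2) \<subseteq> polydisc n (snd (e y) y) (4 * r y)" if "y \<in> L" for y
    using er(3)[OF that] by (fastforce simp: CP_def polydisc_def)+
  have "\<exists>\<F>. finite \<F> \<and> \<F> \<subseteq> U ` L \<and> L \<subseteq> \<Union>\<F>"
  proof (rule compactinD[OF L])
    show "openin (cm_top N) u" if "u \<in> U ` L" for u
      using that er sub(3) openin_polydisc[of n] unfolding n_def U_def
      by (force intro!: openin_chart_preimage[OF N])
    show "L \<subseteq> \<Union> (U ` L)"
    proof
      fix y assume y: "y \<in> L"
      have "snd (e y) y \<in> polydisc n (snd (e y) y) (r y / 2)"
        using er[OF y] chart_Cn[OF N] y by (intro polydisc_self) (auto simp: n_def)
      then show "y \<in> \<Union> (U ` L)"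
        using y er(2)[OF y] by (auto simp: U_def)
    qed
  qed
  then obtain \<F> where "finite \<F>" "\<F> \<subseteq> U ` L" "L \<subseteq> \<Union>\<F>"
    by blast
  moreover from this(1,2) obtain Y where "Y \<subseteq> L" "finite Y" "\<F> = U ` Y"
    by (rule finite_subset_image[elim_format]) blast
  ultimately have Y: "finite Y" "Y \<subseteq> L" "L \<subseteq> \<Union> (U ` Y)"
    by auto
  obtain h where h: "bij_betw h {..<card Y} Y"
    using ex_bij_betw_nat_finite[OF Y(1)] by (auto simp: atLeast0LessThan)
  define A where "A = card Y"
  have hL: "h b \<in> L" if "b < A" for b
    using h Y(2) that by (auto simp: A_def bij_betw_def)
  have "\<forall>y\<in>L. \<exists>b<A. y \<in> U (h b)"
  proof
    fix y assume "y \<in> L"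
    then obtain y' where "y' \<in> h ` {..<A}" "y \<in> U y'"
      using Y(3) h by (auto simp: A_def bij_betw_def)
    then show "\<exists>b<A. y \<in> U (h b)"
      by blast
  qed
  \<comment> \<open>A choice of one polydisc of the finite cover for each point of \<open>L\<close>;
    it need not be continuous.\<close>
  then obtain idx where idx: "\<And>y. y \<in> L \<Longrightarrow> idx y < A" "\<And>y. y \<in> L \<Longrightarrow> y \<in> U (h (idx y))"
    by metis
  have "0 < A"
    using idx(1) False by fastforce
  have ci: "ci y z \<in> fst (e y)" "snd (e y) (ci y z) = z" if "y \<in> L" "z \<in> polydisc n (snd (e y) y) (4 * r y)" for y z
    using chart_inv_image[OF N er(1)[OF that(1)], of z "fst (e y)"] er(4)[OF that(1)] that(2) by (auto simp: ci_def)
  have "compactin (cm_top N) (\<Union>b<A. ci (h b) ` CP (h b))"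
  proof (rule compactin_Union)
    show "finite ((\<lambda>b. ci (h b) ` CP (h b)) ` {..<A})" by simp
    fix Q assume "Q \<in> (\<lambda>b. ci (h b) ` CP (h b)) ` {..<A}"
    then obtain b where b: "b < A" "Q = ci (h b) ` CP (h b)"
      by blast
    have "compact (CP (h b))"
      unfolding CP_def by (rule compact_closed_polydisc)
    then show "compactin (cm_top N) Q"
      unfolding b(2) ci_def
      using sub(2)[OF hL[OF b(1)]] er(4)[OF hL[OF b(1)]] by (intro compactin_chart_inverse[OF N er(1)[OF hL[OF b(1)]]]) auto
  qed
  then obtain C where C0: "\<And>x y. x \<in> X \<Longrightarrow> y \<in> (\<Union>b<A. ci (h b) ` CP (h b)) \<Longrightarrow> cmod (f x y) \<le> C"
    using bdd by blast
  \<comment> \<open>For empty \<open>X\<close> the constant \<open>C\<close> may be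
    negative.\<close>
  define C' where "C' = max C 0"
  have C: "cmod (f x (ci (h b) z)) \<le> C'" if "x \<in> X" "b < A" "z \<in> CP (h b)" for x b z
    using C0[OF that(1), of "ci (h b) z"] that(2,3) by (force simp: C'_def)
  define B where "B = max 1 (max C' (2 ^ n))"
  have B: "1 \<le> B" "C' \<le> B" "2 ^ n \<le> B"
    by (auto simp: B_def)
  show ?thesis
  proof (rule cross_approximation[where B = B, OF _ B(1) \<open>0 < \<epsilon>\<close>])
    fix \<eta> :: real assume "0 < \<eta>"
    define \<delta> where "\<delta> m = 2 ^ n * (4 * C' / 2 ^ m)" for m :: nat
    have d0: "0 \<le> \<delta> m" for m
      by (simp add: \<delta>_def C'_def)
    have "(\<lambda>m. (2 ^ n * (4 * C')) * (real m ^ 0 / 2 ^ m)) \<longlonglongrightarrow> (2 ^ n * (4 * C')) * 0"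
      by (intro tendsto_mult_left power_over_exponential)
    then have "\<forall>\<^sub>F m in sequentially. \<delta> m < 1"
      by (intro order_tendstoD(2)[where a = 1]) (auto simp: \<delta>_def)
    \<comment> \<open>\<open>A\<close> polydiscs with \<open>m ^ n\<close> nodes each give rank
      \<open>A * m ^ n\<close>. Its cube is polynomial in \<open>m\<close> and loses against
      \<open>2 ^ m\<close>.\<close>
    moreover have "(\<lambda>m. ((3 * real A * B) ^ 3 * (2 ^ n * (4 * C'))) * (real m ^ (3 * n) / 2 ^ m))
        \<longlonglongrightarrow> ((3 * real A * B) ^ 3 * (2 ^ n * (4 * C'))) * 0"
      by (intro tendsto_mult_left power_over_exponential)
    then have "\<forall>\<^sub>F m in sequentially. ((3 * real A * B) ^ 3 * (2 ^ n * (4 * C'))) * (real m ^ (3 * n) / 2 ^ m) < \<eta>"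
      using \<open>0 < \<eta>\<close> by (intro order_tendstoD(2)) auto
    ultimately have "\<forall>\<^sub>F m in sequentially. 0 < m \<and> \<delta> m < 1 \<and>
        ((3 * real A * B) ^ 3 * (2 ^ n * (4 * C'))) * (real m ^ (3 * n) / 2 ^ m) < \<eta>"
      using eventually_gt_at_top[of "0::nat"] by eventually_elim auto
    then obtain m where m: "0 < m" "\<delta> m < 1"
        "((3 * real A * B) ^ 3 * (2 ^ n * (4 * C'))) * (real m ^ (3 * n) / 2 ^ m) < \<eta>"
      using eventually_happens[of _ sequentially] by auto
    have m3: "(real (3 * (A * m ^ n)) * B) ^ 3 * \<delta> m < \<eta>"
    proof -
      have "(real (3 * (A * m ^ n)) * B) ^ 3 * \<delta> m = ((3 * real A * B) ^ 3 * (2 ^ n * (4 * C'))) * (real m ^ (3 * n) / 2 ^ m)"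
        unfolding \<delta>_def by (simp add: power_mult_distrib mult.commute[of 3 n] power_mult)
      then show ?thesis using m(3) by simp
    qed
    have "\<forall>b\<in>{..<A}. \<exists>\<nu> w. (\<forall>t<m ^ n. \<nu> t \<in> polydisc n (snd (e (h b)) (h b)) (3 * r (h b))) \<and>
      (\<forall>z. (\<forall>i<n. cmod (z i - snd (e (h b)) (h b) i) \<le> r (h b) / 2) \<longrightarrow> (\<forall>t<m ^ n. cmod (w t z) \<le> 2 ^ n)) \<and>
      (\<forall>G C z. (\<forall>z\<in>polydisc n (snd (e (h b)) (h b)) (3 * r (h b)). cmod (G z) \<le> C \<and> (\<forall>i<n. (\<lambda>t. G (z(i := t))) field_differentiable at (z i))) \<and>
         (\<forall>i<n. cmod (z i - snd (e (h b)) (h b) i) \<le> r (h b) / 2) \<and> (\<forall>i\<ge>n. z i = 0) \<longrightarrow>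
         cmod (G z - (\<Sum>t<m ^ n. G (\<nu> t) * w t z)) \<le> 2 ^ n * (4 * C / 2 ^ m))"
      by (intro ballI, rule polydisc_interpolation[OF er(3)[OF hL] m(1)]) simp
    from bchoice[OF this] obtain \<nu> where "\<forall>b\<in>{..<A}. \<exists>w. (\<forall>t<m ^ n. \<nu> b t \<in> polydisc n (snd (e (h b)) (h b)) (3 * r (h b))) \<and>
      (\<forall>z. (\<forall>i<n. cmod (z i - snd (e (h b)) (h b) i) \<le> r (h b) / 2) \<longrightarrow> (\<forall>t<m ^ n. cmod (w t z) \<le> 2 ^ n)) \<and>
      (\<forall>G C z. (\<forall>z\<in>polydisc n (snd (e (h b)) (h b)) (3 * r (h b)). cmod (G z) \<le> C \<and> (\<forall>i<n. (\<lambda>t. G (z(i := t))) field_differentiable at (z i))) \<and>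
         (\<forall>i<n. cmod (z i - snd (e (h b)) (h b) i) \<le> r (h b) / 2) \<and> (\<forall>i\<ge>n. z i = 0) \<longrightarrow>
         cmod (G z - (\<Sum>t<m ^ n. G (\<nu> b t) * w t z)) \<le> 2 ^ n * (4 * C / 2 ^ m))" ..
    from bchoice[OF this] obtain w where \<nu>w: "\<forall>b\<in>{..<A}. (\<forall>t<m ^ n. \<nu> b t \<in> polydisc n (snd (e (h b)) (h b)) (3 * r (h b))) \<and>
      (\<forall>z. (\<forall>i<n. cmod (z i - snd (e (h b)) (h b) i) \<le> r (h b) / 2) \<longrightarrow> (\<forall>t<m ^ n. cmod (w b t z) \<le> 2 ^ n)) \<and>
      (\<forall>G C z. (\<forall>z\<in>polydisc n (snd (e (h b)) (h b)) (3 * r (h b)). cmod (G z) \<le> C \<and> (\<forall>i<n. (\<lambda>t. G (z(i := t))) field_differentiable at (z i))) \<and>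
         (\<forall>i<n. cmod (z i - snd (e (h b)) (h b) i) \<le> r (h b) / 2) \<and> (\<forall>i\<ge>n. z i = 0) \<longrightarrow>
         cmod (G z - (\<Sum>t<m ^ n. G (\<nu> b t) * w b t z)) \<le> 2 ^ n * (4 * C / 2 ^ m))" ..
    have \<nu>: "\<nu> b t \<in> polydisc n (snd (e (h b)) (h b)) (3 * r (h b))" if "b < A" "t < m ^ n" for b t
      by (rule \<nu>w[THEN bspec, THEN conjunct1, rule_format]) (use that in simp_all)
    define q where "q = m ^ n"
    have "0 < q" using m by (simp add: q_def)
    \<comment> \<open>The index \<open>t\<close> encodes the polydisc \<open>t div q\<close> and the
      node \<open>t mod q\<close>. The weight \<open>v\<close> vanishes unless this polydisc is the
      one chosen for \<open>y\<close>, so the long sum collapses to the interpolation sum of a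
      single polydisc.\<close>
    define u where "u x t = f x (ci (h (t div q)) (\<nu> (t div q) (t mod q)))" for x t
    define v where "v t y = (if t div q = idx y then w (idx y) (t mod q) (snd (e (h (idx y))) y) else 0)" for t y
    have div: "t div q < A" "t mod q < m ^ n" if "t < A * q" for t
      using that \<open>0 < q\<close> by (auto simp: less_mult_imp_div_less simp flip: q_def)
    have pos: "\<forall>i<n. cmod (snd (e (h (idx y))) y i - snd (e (h (idx y))) (h (idx y)) i) \<le> r (h (idx y)) / 2"
        "\<forall>i\<ge>n. snd (e (h (idx y))) y i = 0" "ci (h (idx y)) (snd (e (h (idx y))) y) = y" if "y \<in> L" for y
      using idx(2)[OF that] chart_inv[OF N er(1)[OF hL[OF idx(1)[OF that]]]]
      by (auto simp: U_def polydisc_def ci_def less_imp_le)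
    show "\<exists>q \<delta> u w. 1 \<le> q \<and> 0 \<le> \<delta> \<and> \<delta> \<le> 1 \<and> (real (3 * q) * B) ^ 3 * \<delta> < \<eta> \<and>
      (\<forall>x\<in>X. \<forall>t<q. cmod (u x t) \<le> B) \<and> (\<forall>y\<in>L. \<forall>t<q. cmod (w t y) \<le> B) \<and>
      (\<forall>x\<in>X. \<forall>y\<in>L. cmod (f x y - (\<Sum>t<q. u x t * w t y)) \<le> \<delta>)"
    proof (intro exI[of _ "A * q"] exI[of _ "\<delta> m"] exI[of _ u] exI[of _ v] conjI ballI allI impI)
      show "1 \<le> A * q"
        using \<open>0 < A\<close> \<open>0 < q\<close> by (simp add: Suc_le_eq)
      show "0 \<le> \<delta> m" "\<delta> m \<le> 1"
        using d0 m(2) by auto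
      show "(real (3 * (A * q)) * B) ^ 3 * \<delta> m < \<eta>"
        using m3 by (simp add: q_def)
      show "cmod (u x t) \<le> B" if "x \<in> X" "t < A * q" for x t
        unfolding u_def using that div[OF that(2)] sub(1)[OF hL] \<nu> B(2)
        by (intro order_trans[OF C]) blast+
      show "cmod (v t y) \<le> B" if "y \<in> L" "t < A * q" for t y
      proof -
        have "cmod (w (idx y) (t mod q) (snd (e (h (idx y))) y)) \<le> 2 ^ n"
          by (rule \<nu>w[THEN bspec, THEN conjunct2, THEN conjunct1, rule_format])
            (use idx(1)[OF that(1)] pos(1)[OF that(1)] div(2)[OF that(2)] in simp_all)
        then show ?thesis
          using B by (auto simp: v_def)
      qed
      fix x y assume x: "x \<in> X" and y: "y \<in> L"
      define b where "b = idx y"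
      have b: "b < A" "h b \<in> L"
        using idx(1)[OF y] hL by (auto simp: b_def)
      define G where "G z = f x (ci (h b) z)" for z
      have "(\<Sum>t<A * q. u x t * v t y) = (\<Sum>c<A. \<Sum>j<q. f x (ci (h c) (\<nu> c j)) * (if c = b then w b j (snd (e (h b)) y) else 0))"
        unfolding u_def v_def b_def[symmetric] by (rule sum_div_mod[OF \<open>0 < q\<close>])
      also have "\<dots> = (\<Sum>c<A. if c = b then (\<Sum>j<q. G (\<nu> b j) * w b j (snd (e (h b)) y)) else 0)"
        by (intro sum.cong) (auto simp: G_def)
      also have "\<dots> = (\<Sum>j<q. G (\<nu> b j) * w b j (snd (e (h b)) y))"
        using b by simp
      finally have S: "(\<Sum>t<A * q. u x t * v t y) = (\<Sum>j<m ^ n. G (\<nu> b j) * w b j (snd (e (h b)) y))"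
        by (simp add: q_def)
      have "holomorphic_Cn n (snd (e (h b)) ` (fst (e (h b)) \<inter> cm_space N)) G"
        using hol[OF x] er(1)[OF b(2)] by (auto simp: holomorphic_fun_def n_def G_def[abs_def] ci_def case_prod_beta)
      moreover have "fst (e (h b)) \<inter> cm_space N = fst (e (h b))"
        using chart_subset[OF N er(1)[OF b(2)]] by (rule Int_absorb2)
      ultimately have diff: "\<forall>z\<in>snd (e (h b)) ` fst (e (h b)). \<forall>i<n. (\<lambda>t. G (z(i := t))) field_differentiable at (z i)"
        by (simp add: holomorphic_Cn_def)
      have G: "\<forall>z\<in>polydisc n (snd (e (h b)) (h b)) (3 * r (h b)). cmod (G z) \<le> C' \<and>
          (\<forall>i<n. (\<lambda>t. G (z(i := t))) field_differentiable at (z i))"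
      proof
        fix z assume z: "z \<in> polydisc n (snd (e (h b)) (h b)) (3 * r (h b))"
        then have "z \<in> CP (h b)" "z \<in> snd (e (h b)) ` fst (e (h b))"
          using sub(1,2)[OF b(2)] er(4)[OF b(2)] by blast+
        then show "cmod (G z) \<le> C' \<and> (\<forall>i<n. (\<lambda>t. G (z(i := t))) field_differentiable at (z i))"
          unfolding G_def[of z] by (intro conjI C x b diff[THEN bspec])
      qed
      have "cmod (G (snd (e (h b)) y) - (\<Sum>j<m ^ n. G (\<nu> b j) * w b j (snd (e (h b)) y))) \<le> 2 ^ n * (4 * C' / 2 ^ m)"
        by (rule \<nu>w[THEN bspec, THEN conjunct2, THEN conjunct2, THEN spec[where x = G], THEN spec[where x = C'],
            THEN spec, THEN mp]) (use b(1) G pos(1,2)[OF y] in \<open>simp_all add: b_def\<close>)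
      moreover have "G (snd (e (h b)) y) = f x y"
        using pos(3)[OF y] by (simp add: G_def b_def)
      ultimately show "cmod (f x y - (\<Sum>t<A * q. u x t * v t y)) \<le> \<delta> m"
        by (simp add: S \<delta>_def)
    qed
  qed
qed

section \<open>Lifting vector fields from a factor\<close>

text \<open>A manifold \<open>P\<close> that is a product of \<open>M\<close> and \<open>N\<close>, presented so that the roles of the two factors can
  be exchanged: the coordinates of \<open>M\<close> occupy the indices from \<open>oM\<close> on, those of \<open>N\<close> the indices
  from \<open>oN\<close> on.\<close>

locale factor =
  fixes M :: "'a cmfd" and N :: "'b cmfd" and P :: "'c cmfd"
    and mk :: "'a \<Rightarrow> 'b \<Rightarrow> 'c" and pr :: "'c \<Rightarrow> 'a" and qr :: "'c \<Rightarrow> 'b"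
    and cmb :: "'a chart \<Rightarrow> 'b chart \<Rightarrow> 'c chart" and oM oN :: nat
  assumes M: "complex_manifold M" and N: "complex_manifold N" and P: "complex_manifold P"
    and dim: "cm_dim P = cm_dim M + cm_dim N"
    and offsets: "oM = 0 \<and> oN = cm_dim M \<or> oN = 0 \<and> oM = cm_dim N"
    and pr_mk [simp]: "\<And>x y. pr (mk x y) = x" and qr_mk [simp]: "\<And>x y. qr (mk x y) = y"
    and mk_pr_qr [simp]: "\<And>p. mk (pr p) (qr p) = p"
    and cont_pr: "continuous_map (cm_top P) (cm_top M) pr" and cont_qr: "continuous_map (cm_top P) (cm_top N) qr"
    and cont_mk: "continuous_map (prod_topology (cm_top M) (cm_top N)) (cm_top P) (\<lambda>(x, y). mk x y)"
    and atlas: "cm_atlas P = {cmb d e | d e. d \<in> cm_atlas M \<and> e \<in> cm_atlas N}"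
    and dom: "\<And>d e. fst (cmb d e) = {p. pr p \<in> fst d \<and> qr p \<in> fst e}"
    and coordM: "\<And>d e p i. i < cm_dim M \<Longrightarrow> snd (cmb d e) p (oM + i) = snd d (pr p) i"
    and coordN: "\<And>d e p i. i < cm_dim N \<Longrightarrow> snd (cmb d e) p (oN + i) = snd e (qr p) i"
begin

text \<open>With this symmetry every result on \<open>M\<close> is available for \<open>N\<close>
  through the interpretation \<open>sw\<close>; the offsets \<open>oM\<close> and \<open>oN\<close>
  in the locale exist for this purpose.\<close>

lemma swap: "factor N M P (\<lambda>y x. mk x y) qr pr (\<lambda>e d. cmb d e) oN oM"
proof
  have "continuous_map (prod_topology (cm_top N) (cm_top M)) (prod_topology (cm_top M) (cm_top N)) (\<lambda>(y, x). (x, y))"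
    unfolding case_prod_beta by (intro continuous_map_pairedI continuous_map_fst continuous_map_snd)
  then have "continuous_map (prod_topology (cm_top N) (cm_top M)) (cm_top P) ((\<lambda>(x, y). mk x y) \<circ> (\<lambda>(y, x). (x, y)))"
    using cont_mk by (rule continuous_map_compose)
  then show "continuous_map (prod_topology (cm_top N) (cm_top M)) (cm_top P) (\<lambda>(y, x). mk x y)"
    by (rule continuous_map_eq) auto
  show "cm_atlas P = {cmb e d | d e. d \<in> cm_atlas N \<and> e \<in> cm_atlas M}"
    using atlas by auto
qed (use M N P dim offsets cont_pr cont_qr dom coordM coordN in auto)

lemma index_cases:
  assumes "k < cm_dim P"
  obtains i where "i < cm_dim M" "k = oM + i" | i where "i < cm_dim N" "k = oN + i"
proof (cases "oM \<le> k \<and> k < oM + cm_dim M")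
  case True
  then show ?thesis using that(1)[of "k - oM"] by auto
next
  case False
  then show ?thesis using that(2)[of "k - oN"] assms dim offsets by auto
qed

lemma indexM: "i < cm_dim M \<Longrightarrow> oM + i < cm_dim P"
  using dim offsets by auto

lemma indexN: "i < cm_dim N \<Longrightarrow> oN + i < cm_dim P"
  using dim offsets by auto

lemma indexN_not_M: "i < cm_dim N \<Longrightarrow> \<not> (oM \<le> oN + i \<and> oN + i < oM + cm_dim M)"
  using offsets by auto

lemma sum_index:
  fixes F :: "nat \<Rightarrow> complex"
  shows "(\<Sum>k<cm_dim P. F k) = (\<Sum>i<cm_dim M. F (oM + i)) + (\<Sum>i<cm_dim N. F (oN + i))"
proof -
  have *: "(\<Sum>k<a + b. F k) = (\<Sum>i<a. F i) + (\<Sum>i<b. F (a + i))" for a b :: nat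
    by (induction b) simp_all
  from offsets show ?thesis
  proof
    assume "oM = 0 \<and> oN = cm_dim M"
    then show ?thesis using *[of "cm_dim M" "cm_dim N"] dim by simp
  next
    assume "oN = 0 \<and> oM = cm_dim N"
    then show ?thesis using *[of "cm_dim N" "cm_dim M"] dim by (simp add: add.commute)
  qed
qed

lemma pr_space: "p \<in> cm_space P \<Longrightarrow> pr p \<in> cm_space M"
  using cont_pr by (auto simp: continuous_map_def)

lemma qr_space: "p \<in> cm_space P \<Longrightarrow> qr p \<in> cm_space N"
  using cont_qr by (auto simp: continuous_map_def)

lemma mk_space: "x \<in> cm_space M \<Longrightarrow> y \<in> cm_space N \<Longrightarrow> mk x y \<in> cm_space P"
  using funcset_mem[OF continuous_map_funspace[OF cont_mk], of "(x, y)"] by simp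

lemma cmb_atlas: "d \<in> cm_atlas M \<Longrightarrow> e \<in> cm_atlas N \<Longrightarrow> cmb d e \<in> cm_atlas P"
  using atlas by blast

lemma openin_pr: "openin (cm_top M) S \<Longrightarrow> openin (cm_top P) {p \<in> cm_space P. pr p \<in> S}"
  by (rule openin_continuous_map_preimage[OF cont_pr])

lemma continuous_slice: "y \<in> cm_space N \<Longrightarrow> continuous_map (cm_top M) (cm_top P) (\<lambda>x. mk x y)"
proof -
  assume "y \<in> cm_space N"
  then have "continuous_map (cm_top M) (prod_topology (cm_top M) (cm_top N)) (\<lambda>x. (x, y))"
    by (intro continuous_map_pairedI) auto
  from continuous_map_compose[OF this cont_mk] show ?thesis
    by (simp add: o_def)
qed

lemma openin_slice: "openin (cm_top P) S \<Longrightarrow> y \<in> cm_space N \<Longrightarrow> openin (cm_top M) {x \<in> cm_space M. mk x y \<in> S}"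
  by (rule openin_continuous_map_preimage[OF continuous_slice])

section \<open>Partial derivatives of functions on the product along one factor\<close>

context
  fixes d e p i
  assumes d: "d \<in> cm_atlas M" and e: "e \<in> cm_atlas N" and p: "p \<in> fst (cmb d e)" and i: "i < cm_dim M"
begin

text \<open>Changing a coordinate of \<open>M\<close> keeps all coordinates of \<open>N\<close>.
  Since charts are injective, the coordinate line of the product is that of \<open>M\<close> at the
  fixed point \<open>qr p\<close>, as long as \<open>t\<close> stays in the chart.\<close>

lemma eventually_chart_line_factor:
  "\<forall>\<^sub>F t in nhds (snd (cmb d e) p (oM + i)). chart_line (cmb d e) (oM + i) p t = mk (chart_line d i (pr p) t) (qr p)"
proof -
  have pd: "pr p \<in> fst d" and qe: "qr p \<in> fst e"
    using p dom by auto
  show ?thesis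
    unfolding coordM[OF i] using eventually_chart_line[OF M d pd pd chart_open[OF M d] i]
  proof eventually_elim
    case (elim t)
    define q where "q = mk (chart_line d i (pr p) t) (qr p)"
    have q: "q \<in> fst (cmb d e)"
      using elim qe by (simp add: q_def dom)
    have "snd (cmb d e) q = (snd (cmb d e) p)(oM + i := t)"
    proof
      fix k
      show "snd (cmb d e) q k = ((snd (cmb d e) p)(oM + i := t)) k"
      proof (cases "k < cm_dim P")
        case True
        then show ?thesis
        proof (cases rule: index_cases)
          case (1 j)
          then show ?thesis using elim by (simp add: coordM q_def)
        next
          case (2 j)
          then show ?thesis using indexN_not_M[of j] i by (auto simp: coordN q_def)
        qed
      next
        case False
        then show ?thesis
          using chart_zero[OF P cmb_atlas[OF d e]] q p indexM[OF i] by auto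
      qed
    qed
    then show ?case
      using chart_inv[OF P cmb_atlas[OF d e] q] by (simp add: chart_line_def q_def)
  qed
qed

lemma chart_deriv_factor: "chart_deriv (cmb d e) (oM + i) f p = chart_deriv d i (\<lambda>x. f (mk x (qr p))) (pr p)"
proof -
  have "\<forall>\<^sub>F t in nhds (snd (cmb d e) p (oM + i)). f (chart_line (cmb d e) (oM + i) p t) = f (mk (chart_line d i (pr p) t) (qr p))"
    using eventually_chart_line_factor by eventually_elim simp
  from deriv_cong_ev[OF this refl] show ?thesis
    by (simp add: chart_deriv_line coordM[OF i])
qed

lemma chart_diff_factor: "chart_diff (cmb d e) (oM + i) f p \<longleftrightarrow> chart_diff d i (\<lambda>x. f (mk x (qr p))) (pr p)"
proof -
  have "\<forall>\<^sub>F t in nhds (snd (cmb d e) p (oM + i)). f (chart_line (cmb d e) (oM + i) p t) = f (mk (chart_line d i (pr p) t) (qr p))"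
    using eventually_chart_line_factor by eventually_elim simp
  from DERIV_cong_ev[OF refl this refl] show ?thesis
    by (simp add: chart_diff_def field_differentiable_def coordM[OF i])
qed

end

lemma chart_deriv_other:
  assumes "d \<in> cm_atlas M" "e \<in> cm_atlas N" "p \<in> fst (cmb d e)" "i < cm_dim N"
  shows "chart_deriv (cmb d e) (oN + i) f p = chart_deriv e i (\<lambda>y. f (mk (pr p) y)) (qr p)"
proof -
  interpret sw: factor N M P "\<lambda>y x. mk x y" qr pr "\<lambda>e d. cmb d e" oN oM
    by (rule swap)
  show ?thesis
    by (rule sw.chart_deriv_factor[OF assms(2,1,3,4)])
qed

lemma chart_diff_other:
  assumes "d \<in> cm_atlas M" "e \<in> cm_atlas N" "p \<in> fst (cmb d e)" "i < cm_dim N"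
  shows "chart_diff (cmb d e) (oN + i) f p \<longleftrightarrow> chart_diff e i (\<lambda>y. f (mk (pr p) y)) (qr p)"
proof -
  interpret sw: factor N M P "\<lambda>y x. mk x y" qr pr "\<lambda>e d. cmb d e" oN oM
    by (rule swap)
  show ?thesis
    by (rule sw.chart_diff_factor[OF assms(2,1,3,4)])
qed

lemma holomorphic_fun_pullback:
  assumes S: "openin (cm_top M) S" and f: "holomorphic_fun M S f"
  shows "holomorphic_fun P {p \<in> cm_space P. pr p \<in> S} (\<lambda>p. f (pr p))"
  unfolding holomorphic_fun_iff[OF P openin_pr[OF S]]
proof (intro conjI ballI allI impI)
  let ?S = "{p \<in> cm_space P. pr p \<in> S}"
  have "continuous_map (subtopology (cm_top P) ?S) (subtopology (cm_top M) S) pr"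
    using continuous_map_from_subtopology[OF cont_pr] by (auto simp: continuous_map_in_subtopology)
  from continuous_map_compose[OF this holomorphic_fun_continuous[OF M S f]]
  show "continuous_map (subtopology (cm_top P) ?S) euclidean (\<lambda>p. f (pr p))"
    by (simp add: o_def)
  fix c p k assume "c \<in> cm_atlas P" and p: "p \<in> fst c \<inter> ?S" and k: "k < cm_dim P"
  then obtain d e where c: "c = cmb d e" "d \<in> cm_atlas M" "e \<in> cm_atlas N"
    using atlas by auto
  from k show "chart_diff c k (\<lambda>p. f (pr p)) p"
  proof (cases rule: index_cases)
    case (1 i)
    have "chart_diff d i f (pr p)"
      by (rule holomorphic_fun_chart_diff[OF M S f c(2)]) (use p c 1 in \<open>auto simp: dom\<close>)
    then show ?thesis
      using chart_diff_factor[OF c(2,3), of p i "\<lambda>p. f (pr p)"] p c 1 by simp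
  next
    case (2 i)
    then show ?thesis
      using chart_diff_other[OF c(2,3), of p i "\<lambda>p. f (pr p)"] p c by (simp add: chart_diff_def)
  qed
qed

lemma holomorphic_fun_slice:
  assumes S: "openin (cm_top P) S" and f: "holomorphic_fun P S f" and y: "y \<in> cm_space N"
  shows "holomorphic_fun M {x \<in> cm_space M. mk x y \<in> S} (\<lambda>x. f (mk x y))"
  unfolding holomorphic_fun_iff[OF M openin_slice[OF S y]]
proof (intro conjI ballI allI impI)
  let ?S = "{x \<in> cm_space M. mk x y \<in> S}"
  have "continuous_map (subtopology (cm_top M) ?S) (subtopology (cm_top P) S) (\<lambda>x. mk x y)"
    using continuous_map_from_subtopology[OF continuous_slice[OF y]] by (auto simp: continuous_map_in_subtopology)
  from continuous_map_compose[OF this holomorphic_fun_continuous[OF P S f]]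
  show "continuous_map (subtopology (cm_top M) ?S) euclidean (\<lambda>x. f (mk x y))"
    by (simp add: o_def)
  fix d x i assume d: "d \<in> cm_atlas M" and x: "x \<in> fst d \<inter> ?S" and i: "i < cm_dim M"
  obtain e where e: "e \<in> cm_atlas N" "y \<in> fst e"
    using chart_around[OF N y] by blast
  have "chart_diff (cmb d e) (oM + i) f (mk x y)"
    by (rule holomorphic_fun_chart_diff[OF P S f cmb_atlas[OF d e(1)]]) (use x e i indexM in \<open>auto simp: dom\<close>)
  then show "chart_diff d i (\<lambda>x. f (mk x y)) x"
    using chart_diff_factor[OF d e(1), of "mk x y" i f] x e i by (simp add: dom)
qed

text \<open>Components of a field are indexed by charts, so the components of a lifted field in
  \<open>c\<close> require a chart of \<open>M\<close> to be recovered from \<open>c\<close>. As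
  \<open>cmb\<close> is not assumed injective, a pair is chosen.\<close>

definition chart_parts :: "'c chart \<Rightarrow> 'a chart \<times> 'b chart"
  where "chart_parts c = (SOME (d, e). d \<in> cm_atlas M \<and> e \<in> cm_atlas N \<and> c = cmb d e)"

lemma chart_parts:
  assumes "c \<in> cm_atlas P"
  shows "fst (chart_parts c) \<in> cm_atlas M" "snd (chart_parts c) \<in> cm_atlas N"
    "cmb (fst (chart_parts c)) (snd (chart_parts c)) = c"
proof -
  have "\<exists>de. case de of (d, e) \<Rightarrow> d \<in> cm_atlas M \<and> e \<in> cm_atlas N \<and> c = cmb d e"
    using assms atlas by auto
  from someI_ex[OF this] show "fst (chart_parts c) \<in> cm_atlas M" "snd (chart_parts c) \<in> cm_atlas N"
      "cmb (fst (chart_parts c)) (snd (chart_parts c)) = c"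
    unfolding chart_parts_def[symmetric] by (auto simp: case_prod_beta)
qed

text \<open>The field \<open>g(y) W(x)\<close>, tangent to the copies of \<open>M\<close>.\<close>

definition lift :: "('b \<Rightarrow> complex) \<Rightarrow> 'a vfield \<Rightarrow> 'c vfield"
  where "lift g W = (\<lambda>p c k. if oM \<le> k \<and> k < oM + cm_dim M
    then g (qr p) * W (pr p) (fst (chart_parts c)) (k - oM) else 0)"

lemma liftM: "i < cm_dim M \<Longrightarrow> lift g W p c (oM + i) = g (qr p) * W (pr p) (fst (chart_parts c)) i"
  by (simp add: lift_def)

lemma liftN: "i < cm_dim N \<Longrightarrow> lift g W p c (oN + i) = 0"
  using indexN_not_M[of i] by (simp only: lift_def if_False)

lemma chart_parts_dom:
  assumes "c \<in> cm_atlas P" "p \<in> fst c"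
  shows "pr p \<in> fst (fst (chart_parts c))" "qr p \<in> fst (snd (chart_parts c))"
  using chart_parts(3)[OF assms(1)] assms(2) dom[of "fst (chart_parts c)" "snd (chart_parts c)"] by auto

lemma coord_parts:
  assumes "c \<in> cm_atlas P"
  shows "i < cm_dim M \<Longrightarrow> snd c p (oM + i) = snd (fst (chart_parts c)) (pr p) i"
    "i < cm_dim N \<Longrightarrow> snd c p (oN + i) = snd (snd (chart_parts c)) (qr p) i"
  using coordM[of i "fst (chart_parts c)" "snd (chart_parts c)" p]
    coordN[of i "fst (chart_parts c)" "snd (chart_parts c)" p] chart_parts(3)[OF assms] by simp_all

text \<open>The transformation law reduces to that of \<open>W\<close>: coordinates of
  \<open>N\<close> are constant along \<open>M\<close>, and the components of the lift in the
  directions of \<open>N\<close> vanish.\<close>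

lemma lift_holomorphic:
  assumes W: "holomorphic_vfield M W" and g: "holomorphic_fun N (cm_space N) g"
  shows "holomorphic_vfield P (lift g W)"
  unfolding holomorphic_vfield_def
proof (intro conjI ballI allI impI)
  interpret sw: factor N M P "\<lambda>y x. mk x y" qr pr "\<lambda>e d. cmb d e" oN oM
    by (rule swap)
  fix c assume c: "c \<in> cm_atlas P"
  define d e where "d = fst (chart_parts c)" and "e = snd (chart_parts c)"
  have de: "d \<in> cm_atlas M" "e \<in> cm_atlas N" "c = cmb d e"
    using chart_parts[OF c] by (auto simp: d_def e_def)
  {
    fix c' p k assume c': "c' \<in> cm_atlas P" and p: "p \<in> fst c \<inter> fst c'" and k: "k < cm_dim P"
    define d' where "d' = fst (chart_parts c')"
    have d': "d' \<in> cm_atlas M" "pr p \<in> fst d'" "pr p \<in> fst d"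
      using chart_parts[OF c'] chart_parts_dom[OF c'] chart_parts_dom[OF c] p by (auto simp: d'_def d_def)
    have "(\<Sum>l<cm_dim P. chart_deriv c l (\<lambda>q. snd c' q k) p * lift g W p c l)
        = (\<Sum>i<cm_dim M. chart_deriv d i (\<lambda>x. snd c' (mk x (qr p)) k) (pr p) * (g (qr p) * W (pr p) d i))"
      using p chart_deriv_factor[OF de(1,2)] by (simp add: sum_index liftM liftN flip: d_def de(3))
    also have "\<dots> = lift g W p c' k"
      using k
    proof (cases rule: index_cases)
      case (1 j)
      have "W (pr p) d' j = (\<Sum>i<cm_dim M. chart_deriv d i (\<lambda>x. snd d' x j) (pr p) * W (pr p) d i)"
        using W de(1) d' 1 unfolding holomorphic_vfield_def by blast
      then show ?thesis
        using 1 by (simp add: coord_parts[OF c'] liftM sum_distrib_left mult.left_commute flip: d'_def)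
    next
      case (2 j)
      then show ?thesis
        by (simp add: coord_parts[OF c'] liftN chart_deriv_line)
    qed
    finally show "lift g W p c' k = (\<Sum>l<cm_dim P. chart_deriv c l (\<lambda>q. snd c' q k) p * lift g W p c l)"
      by simp
  }
  fix k assume k: "k < cm_dim P"
  have oc: "openin (cm_top P) (fst c)"
    by (rule chart_open[OF P c])
  from k show "holomorphic_fun P (fst c) (\<lambda>p. lift g W p c k)"
  proof (cases rule: index_cases)
    case (1 i)
    have "holomorphic_fun M (fst d) (\<lambda>x. W x d i)"
      using W de(1) 1 unfolding holomorphic_vfield_def by blast
    then have "holomorphic_fun P {p \<in> cm_space P. pr p \<in> fst d} (\<lambda>p. W (pr p) d i)"
      by (rule holomorphic_fun_pullback[OF chart_open[OF M de(1)]])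
    then have "holomorphic_fun P (fst c) (\<lambda>p. W (pr p) d i)"
      by (rule holomorphic_fun_subset[OF P _ openin_pr[OF chart_open[OF M de(1)]] oc])
        (use chart_subset[OF P c] chart_parts_dom(1)[OF c] in \<open>auto simp: d_def\<close>)
    moreover have "holomorphic_fun P {p \<in> cm_space P. qr p \<in> cm_space N} (\<lambda>p. g (qr p))"
      using g by (rule sw.holomorphic_fun_pullback[OF openin_topspace])
    then have "holomorphic_fun P (fst c) (\<lambda>p. g (qr p))"
      by (rule holomorphic_fun_subset[OF P _ sw.openin_pr[OF openin_topspace] oc])
        (use chart_subset[OF P c] qr_space in auto)
    ultimately show ?thesis
      using 1 by (simp add: liftM holomorphic_fun_mult[OF P oc] flip: d_def)
  next
    case (2 i)
    then show ?thesis
      by (simp add: liftN holomorphic_fun_const[OF P oc])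
  qed
qed

text \<open>The integral curves stay in one copy of \<open>M\<close>, where \<open>g\<close> has the
  constant value \<open>a\<close>. They are the curves of \<open>W\<close> with time multiplied by
  \<open>a\<close>, and such a change of time preserves completeness.\<close>

lemma lift_complete:
  assumes W: "complete_vfield M W" and g: "holomorphic_fun N (cm_space N) g"
  shows "complete_vfield P (lift g W)"
  unfolding complete_vfield_def
proof (intro conjI ballI)
  show "holomorphic_vfield P (lift g W)"
    using W g by (intro lift_holomorphic) (auto simp: complete_vfield_def)
  fix p assume p: "p \<in> cm_space P"
  then obtain \<gamma> where \<gamma>: "\<gamma> 0 = pr p" "complex_integral_curve M W \<gamma>"
    using W pr_space by (auto simp: complete_vfield_def)
  define a where "a = g (qr p)"
  define \<delta> where "\<delta> s = mk (\<gamma> (a * s)) (qr p)" for s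
  have "continuous_map euclidean euclidean (\<lambda>s. a * s)"
    by (auto intro!: continuous_intros)
  then have "continuous_map euclidean (cm_top P) ((\<lambda>x. mk x (qr p)) \<circ> (\<gamma> \<circ> (\<lambda>s. a * s)))"
    using \<gamma>(2) continuous_slice[OF qr_space[OF p]]
    by (intro continuous_map_compose) (auto simp: complex_integral_curve_def)
  then have "continuous_map euclidean (cm_top P) \<delta>"
    by (simp add: o_def \<delta>_def[abs_def])
  moreover have "((\<lambda>s. snd c (\<delta> s) k) has_field_derivative lift g W (\<delta> t) c k) (at t)"
    if c: "c \<in> cm_atlas P" "\<delta> t \<in> fst c" and k: "k < cm_dim P" for t c k
    using k
  proof (cases rule: index_cases)
    case (1 i)
    define d where "d = fst (chart_parts c)"
    have d: "d \<in> cm_atlas M" "\<gamma> (a * t) \<in> fst d"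
      using chart_parts[OF c(1)] chart_parts_dom(1)[OF c] by (auto simp: d_def \<delta>_def)
    then have "((\<lambda>s. snd d (\<gamma> s) i) has_field_derivative W (\<gamma> (a * t)) d i) (at (a * t))"
      using \<gamma>(2) 1 by (auto simp: complex_integral_curve_def)
    then have "((\<lambda>s. snd d (\<gamma> (a * s)) i) has_field_derivative W (\<gamma> (a * t)) d i * a) (at t)"
      by (rule DERIV_chain2) (auto intro!: derivative_eq_intros)
    then show ?thesis
      using 1 by (simp add: coord_parts[OF c(1)] liftM \<delta>_def mult.commute flip: d_def a_def)
  next
    case (2 i)
    then show ?thesis
      by (simp add: coord_parts[OF c(1)] liftN \<delta>_def)
  qed
  ultimately show "\<exists>\<gamma>. \<gamma> 0 = p \<and> complex_integral_curve P (lift g W) \<gamma>"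
    using \<gamma>(1) by (intro exI[of _ \<delta>]) (auto simp: complex_integral_curve_def \<delta>_def)
qed

end

section \<open>Components of generated fields in a fixed chart\<close>

definition chart_holomorphic :: "'a cmfd \<Rightarrow> 'a chart \<Rightarrow> ('a \<Rightarrow> complex) \<Rightarrow> bool"
  where "chart_holomorphic M c f \<longleftrightarrow> continuous_map (subtopology (cm_top M) (fst c)) euclidean f \<and>
    (\<forall>x\<in>fst c. \<forall>i<cm_dim M. chart_diff c i f x)"

lemma chart_holomorphic_const: "chart_holomorphic M c (\<lambda>x. k)"
  by (simp add: chart_holomorphic_def chart_diff_def)

lemma chart_holomorphic_add:
  "chart_holomorphic M c f \<Longrightarrow> chart_holomorphic M c g \<Longrightarrow> chart_holomorphic M c (\<lambda>x. f x + g x)"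
  by (auto simp: chart_holomorphic_def chart_diff_def intro!: continuous_map_add field_differentiable_add)

lemma chart_holomorphic_diff:
  "chart_holomorphic M c f \<Longrightarrow> chart_holomorphic M c g \<Longrightarrow> chart_holomorphic M c (\<lambda>x. f x - g x)"
  by (auto simp: chart_holomorphic_def chart_diff_def intro!: continuous_map_diff field_differentiable_diff)

lemma chart_holomorphic_mult:
  "chart_holomorphic M c f \<Longrightarrow> chart_holomorphic M c g \<Longrightarrow> chart_holomorphic M c (\<lambda>x. f x * g x)"
  by (auto simp: chart_holomorphic_def chart_diff_def intro!: continuous_map_mult_complex field_differentiable_mult)

lemma chart_holomorphic_sum:
  "(\<And>k. k \<in> K \<Longrightarrow> chart_holomorphic M c (f k)) \<Longrightarrow> chart_holomorphic M c (\<lambda>x. \<Sum>k\<in>K. f k x)"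
  by (induction K rule: infinite_finite_induct) (simp_all add: chart_holomorphic_const chart_holomorphic_add)

text \<open>Differentiability in the chart \<open>c\<close> alone is stable under
  \<open>chart_deriv c i\<close> by \<open>holomorphic_Cn_deriv\<close>. Holomorphy on the manifold
  would also involve the other charts, which is why commutators are followed in one chart.\<close>

lemma chart_holomorphic_deriv:
  assumes M: "complex_manifold M" and c: "c \<in> cm_atlas M" and f: "chart_holomorphic M c f" and i: "i < cm_dim M"
  shows "chart_holomorphic M c (chart_deriv c i f)"
proof -
  define h where "h z = f (inv_into (fst c) (snd c) z)" for z
  define D where "D z = deriv (\<lambda>t. h (z(i := t))) (z i)" for z
  have [simp]: "fst c \<inter> cm_space M = fst c"
    using chart_subset[OF M c] by auto
  have "holomorphic_Cn (cm_dim M) (snd c ` fst c) h"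
    using holomorphic_chart_iff[OF M c openin_topspace, of f] f by (simp add: chart_holomorphic_def h_def[abs_def])
  then have D: "holomorphic_Cn (cm_dim M) (snd c ` fst c) D"
    unfolding D_def using i by (intro holomorphic_Cn_deriv chart_image_open[OF M c])
  have eq: "chart_deriv c i f = (\<lambda>x. D (snd c x))"
    by (simp add: fun_eq_iff chart_deriv_def D_def h_def)
  show ?thesis
    unfolding chart_holomorphic_def eq
  proof (intro conjI ballI allI impI)
    have "continuous_map (subtopology (cm_top M) (fst c)) (top_of_set (snd c ` fst c)) (snd c)"
      using chart_homeomorphic_subset[OF M c order.refl] by (simp add: homeomorphic_maps_def)
    moreover have "continuous_map (top_of_set (snd c ` fst c)) euclidean D"
      using D by (simp add: holomorphic_Cn_def)
    ultimately have "continuous_map (subtopology (cm_top M) (fst c)) euclidean (D \<circ> snd c)"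
      by (rule continuous_map_compose)
    then show "continuous_map (subtopology (cm_top M) (fst c)) euclidean (\<lambda>x. D (snd c x))"
      by (simp add: o_def)
    fix x j assume x: "x \<in> fst c" and j: "j < cm_dim M"
    have "\<forall>\<^sub>F t in nhds (snd c x j). D (snd c (chart_line c j x t)) = D ((snd c x)(j := t))"
      using eventually_chart_line[OF M c x x chart_open[OF M c] j] by eventually_elim simp
    from DERIV_cong_ev[OF refl this refl] D x j show "chart_diff c j (\<lambda>x. D (snd c x)) x"
      by (simp add: chart_diff_def field_differentiable_def holomorphic_Cn_def)
  qed
qed

text \<open>Commutators contain \<open>deriv\<close>, whose value is informative only where the
  derivative exists. This differentiability permits pulling a factor \<open>g\<close> out of the
  derivatives in \<open>lift_generated\<close>.\<close>

lemma complete_generated_components: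
  assumes M: "complex_manifold M" and W: "complete_generated M W" and c: "c \<in> cm_atlas M" and i: "i < cm_dim M"
  shows "chart_holomorphic M c (\<lambda>x. W x c i)"
  using W i
proof (induction arbitrary: i)
  case (complete V)
  then have "holomorphic_fun M (fst c) (\<lambda>x. V x c i)"
    using c by (auto simp: complete_vfield_def holomorphic_vfield_def)
  then show ?case
    using c by (simp add: holomorphic_fun_iff[OF M chart_open[OF M c]] chart_holomorphic_def)
next
  case (sum V W)
  then show ?case
    by (simp add: vfield_add_def chart_holomorphic_add)
next
  case (commutator V W)
  then show ?case
    unfolding vfield_commutator_def
    by (intro chart_holomorphic_sum chart_holomorphic_diff chart_holomorphic_mult chart_holomorphic_deriv[OF M c]) auto
qed

lemma zero_complete:
  assumes M: "complex_manifold M"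
  shows "complete_vfield M (\<lambda>x c i. 0)"
  unfolding complete_vfield_def
proof (intro conjI ballI)
  show "holomorphic_vfield M (\<lambda>x c i. 0)"
    using chart_open[OF M] by (auto simp: holomorphic_vfield_def intro: holomorphic_fun_const[OF M])
  show "\<exists>\<gamma>. \<gamma> 0 = x \<and> complex_integral_curve M (\<lambda>x c i. 0) \<gamma>" if "x \<in> cm_space M" for x
    using that by (intro exI[of _ "\<lambda>_. x"]) (simp add: complex_integral_curve_def)
qed

lemma complete_generated_sum:
  fixes p :: nat
  assumes M: "complex_manifold M" and W: "\<And>j. j < p \<Longrightarrow> complete_generated M (W j)"
  shows "complete_generated M (\<lambda>x c i. \<Sum>j<p. W j x c i)"
  using W
proof (induction p)
  case 0
  then show ?case
    using zero_complete[OF M] by (simp add: complete_generated.complete)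
next
  case (Suc p)
  then have "complete_generated M (vfield_add (\<lambda>x c i. \<Sum>j<p. W j x c i) (W p))"
    by (intro complete_generated.sum) auto
  then show ?case
    by (simp add: vfield_add_def)
qed

lemma compactin_bounded:
  fixes f :: "'a \<Rightarrow> complex"
  assumes "compactin X K" "continuous_map (subtopology X S) euclidean f" "K \<subseteq> S"
  shows "\<exists>C. \<forall>x\<in>K. cmod (f x) \<le> C"
proof -
  have "compactin (subtopology X S) K"
    using assms by (simp add: compactin_subtopology)
  then have "compact (f ` K)"
    using image_compactin[OF _ assms(2)] by simp
  then have "bounded (f ` K)"
    by (rule compact_imp_bounded)
  then show ?thesis
    by (auto simp: bounded_iff)
qed

context factor
begin

text \<open>Multiplication by a function of the other factor passes through commutators:
  \<open>g [V, W] = [g V, W]\<close>.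
  The equations hold on the charts only, because vector fields carry arbitrary values elsewhere.\<close>

lemma lift_generated:
  assumes W: "complete_generated M W" and g: "holomorphic_fun N (cm_space N) g"
  shows "\<exists>W'. complete_generated P W' \<and> (\<forall>c\<in>cm_atlas P. \<forall>p\<in>fst c. \<forall>k<cm_dim P. W' p c k = lift g W p c k)"
  using W g
proof (induction arbitrary: g)
  case (complete V)
  then show ?case
    by (intro exI[of _ "lift g V"]) (simp add: complete_generated.complete lift_complete)
next
  case (sum V W)
  obtain V' W' where "complete_generated P V'" "complete_generated P W'"
    and *: "\<forall>c\<in>cm_atlas P. \<forall>p\<in>fst c. \<forall>k<cm_dim P. V' p c k = lift g V p c k"
      "\<forall>c\<in>cm_atlas P. \<forall>p\<in>fst c. \<forall>k<cm_dim P. W' p c k = lift g W p c k"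
    using sum.IH(1)[OF sum.prems] sum.IH(2)[OF sum.prems] by blast
  moreover from this have "complete_generated P (vfield_add V' W')"
    by (intro complete_generated.sum)
  ultimately show ?case
    by (intro exI[of _ "vfield_add V' W'"] conjI) (simp_all add: vfield_add_def lift_def ring_distribs)
next
  case (commutator V W)
  \<comment> \<open>One argument receives the factor \<open>g\<close>, the other the constant 1;
    with \<open>g\<close> on both sides the commutator would carry the square of
    \<open>g\<close>.\<close>
  obtain V' W' where gen: "complete_generated P V'" "complete_generated P W'"
    and V': "\<And>c p k. c \<in> cm_atlas P \<Longrightarrow> p \<in> fst c \<Longrightarrow> k < cm_dim P \<Longrightarrow> V' p c k = lift g V p c k"
    and W': "\<And>c p k. c \<in> cm_atlas P \<Longrightarrow> p \<in> fst c \<Longrightarrow> k < cm_dim P \<Longrightarrow> W' p c k = lift (\<lambda>_. 1) W p c k"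
    using commutator.IH(1)[OF commutator.prems] commutator.IH(2)[OF holomorphic_fun_const[OF N openin_topspace], of 1] by blast
  show ?case
  proof (intro exI[of _ "vfield_commutator P V' W'"] conjI ballI allI impI)
    show "complete_generated P (vfield_commutator P V' W')"
      using gen by (rule complete_generated.commutator)
    fix c p k assume c: "c \<in> cm_atlas P" and p: "p \<in> fst c" and k: "k < cm_dim P"
    define d where "d = fst (chart_parts c)"
    have d: "d \<in> cm_atlas M" "snd (chart_parts c) \<in> cm_atlas N" "cmb d (snd (chart_parts c)) = c"
      using chart_parts[OF c] by (auto simp: d_def)
    have pd: "pr p \<in> fst d"
      using chart_parts_dom[OF c p] by (simp add: d_def)
    \<comment> \<open>The induction hypotheses give equality on the domain of \<open>c\<close> only.
      That domain is open, so the derivatives at its points agree too.\<close>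
    have cong: "chart_deriv c l (\<lambda>q. V' q c k) p = chart_deriv c l (\<lambda>q. lift g V q c k) p"
        "chart_deriv c l (\<lambda>q. W' q c k) p = chart_deriv c l (\<lambda>q. lift (\<lambda>_. 1) W q c k) p" if "l < cm_dim P" for l
      using V'[OF c _ k] W'[OF c _ k] that
      by (auto intro!: chart_deriv_cong[OF P c p p chart_open[OF P c]])
    have line: "chart_deriv c (oM + i) f p = chart_deriv d i (\<lambda>x. f (mk x (qr p))) (pr p)" if "i < cm_dim M" for i f
      using chart_deriv_factor[OF d(1,2), of p i f] d(3) p that by simp
    have "vfield_commutator P V' W' p c k = (\<Sum>l<cm_dim P. lift g V p c l * chart_deriv c l (\<lambda>q. lift (\<lambda>_. 1) W q c k) p
                - lift (\<lambda>_. 1) W p c l * chart_deriv c l (\<lambda>q. lift g V q c k) p)"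
      using V'[OF c p] W'[OF c p] cong by (simp add: vfield_commutator_def)
    also have "\<dots> = (\<Sum>i<cm_dim M. g (qr p) * V (pr p) d i * chart_deriv d i (\<lambda>x. lift (\<lambda>_. 1) W (mk x (qr p)) c k) (pr p)
                - W (pr p) d i * chart_deriv d i (\<lambda>x. lift g V (mk x (qr p)) c k) (pr p))"
      by (simp add: sum_index liftM liftN line flip: d_def)
    also have "\<dots> = lift g (vfield_commutator M V W) p c k"
      using k
    proof (cases rule: index_cases)
      case (1 j)
      have "chart_diff d i (\<lambda>x. V x d j) (pr p)" if "i < cm_dim M" for i
        using complete_generated_components[OF M commutator.hyps(1) d(1) 1(1)] pd that by (simp add: chart_holomorphic_def)
      then show ?thesis
        using 1 by (simp add: liftM vfield_commutator_def chart_deriv_cmult[OF M d(1)] sum_distrib_left right_diff_distrib mult_ac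
          flip: d_def)
    next
      case (2 j)
      then show ?thesis
        by (simp add: liftN chart_deriv_line)
    qed
    finally show "vfield_commutator P V' W' p c k = lift g (vfield_commutator M V W) p c k" .
  qed
qed

section \<open>Slices of a field on the product, and the approximation of its part tangent to one
  factor\<close>

definition slice :: "'c vfield \<Rightarrow> 'b \<Rightarrow> 'a vfield"
  where "slice V y = (\<lambda>x d i. V (mk x y) (cmb d (SOME e. e \<in> cm_atlas N \<and> y \<in> fst e)) (oM + i))"

lemma chart_choice:
  assumes "y \<in> cm_space N"
  shows "(SOME e. e \<in> cm_atlas N \<and> y \<in> fst e) \<in> cm_atlas N" "y \<in> fst (SOME e. e \<in> cm_atlas N \<and> y \<in> fst e)"
proof -
  have "\<exists>e. e \<in> cm_atlas N \<and> y \<in> fst e"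
    using chart_around[OF N assms] by blast
  from someI_ex[OF this] show "(SOME e. e \<in> cm_atlas N \<and> y \<in> fst e) \<in> cm_atlas N" "y \<in> fst (SOME e. e \<in> cm_atlas N \<and> y \<in> fst e)"
    by auto
qed

text \<open>The Jacobian of a change of product charts is block diagonal, and its \<open>M\<close>
  block involves only the charts \<open>d\<close> and \<open>d'\<close>.\<close>

lemma vfield_transform:
  assumes V: "holomorphic_vfield P V" and d: "d \<in> cm_atlas M" "d' \<in> cm_atlas M" and e: "e \<in> cm_atlas N" "e' \<in> cm_atlas N"
    and p: "p \<in> fst (cmb d e)" "p \<in> fst (cmb d' e')" and j: "j < cm_dim M"
  shows "V p (cmb d' e') (oM + j) = (\<Sum>i<cm_dim M. chart_deriv d i (\<lambda>x. snd d' x j) (pr p) * V p (cmb d e) (oM + i))"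
proof -
  have "V p (cmb d' e') (oM + j) =
      (\<Sum>k<cm_dim P. chart_deriv (cmb d e) k (\<lambda>q. snd (cmb d' e') q (oM + j)) p * V p (cmb d e) k)"
    using V cmb_atlas[OF d(1) e(1)] cmb_atlas[OF d(2) e(2)] p indexM[OF j] unfolding holomorphic_vfield_def by blast
  also have "\<dots> = (\<Sum>i<cm_dim M. chart_deriv d i (\<lambda>x. snd d' x j) (pr p) * V p (cmb d e) (oM + i))"
    using chart_deriv_factor[OF d(1) e(1) p(1)] chart_deriv_other[OF d(1) e(1) p(1)] j
    by (simp add: sum_index coordM) (simp add: chart_deriv_line)
  finally show ?thesis .
qed

text \<open>For equal charts of \<open>M\<close> the \<open>M\<close> block of the Jacobian is the
  identity. Hence the arbitrary choice of a chart of \<open>N\<close> in \<open>slice\<close> has no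
  influence.\<close>

lemma vfield_chart_indep:
  assumes V: "holomorphic_vfield P V" and d: "d \<in> cm_atlas M" and e: "e \<in> cm_atlas N" "e' \<in> cm_atlas N"
    and p: "p \<in> fst (cmb d e)" "p \<in> fst (cmb d e')" and j: "j < cm_dim M"
  shows "V p (cmb d e') (oM + j) = V p (cmb d e) (oM + j)"
proof -
  have "pr p \<in> fst d"
    using p dom by auto
  then show ?thesis
    using vfield_transform[OF V d d e p j] j by (simp add: chart_deriv_coord[OF M d] if_distrib[where f = "\<lambda>x. x * _"] cong: if_cong)
qed

lemma slice_eq:
  assumes V: "holomorphic_vfield P V" and c: "c \<in> cm_atlas P" "p \<in> fst c" and i: "i < cm_dim M"
  shows "slice V (qr p) (pr p) (fst (chart_parts c)) i = V p c (oM + i)"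
proof -
  have "qr p \<in> cm_space N"
    using c chart_subset[OF P] qr_space by blast
  from chart_choice[OF this] show ?thesis
    using vfield_chart_indep[OF V chart_parts(1,2)[OF c(1)], of "SOME e. e \<in> cm_atlas N \<and> qr p \<in> fst e" p i]
      chart_parts(3)[OF c(1)] c chart_parts_dom[OF c] i
    by (simp add: slice_def dom)
qed

text \<open>The chart of \<open>N\<close> chosen in \<open>slice\<close> may vary wildly with the
  point; locally it can be replaced by a fixed one around \<open>qr p\<close> without changing the
  value.\<close>

lemma slice_holomorphic_fun:
  assumes V: "holomorphic_vfield P V" and d: "d \<in> cm_atlas M" and i: "i < cm_dim M"
  shows "holomorphic_fun P {p \<in> cm_space P. pr p \<in> fst d} (\<lambda>p. slice V (qr p) (pr p) d i)"
proof (rule holomorphic_fun_locally[OF P openin_pr[OF chart_open[OF M d]]])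
  fix p assume p: "p \<in> {p \<in> cm_space P. pr p \<in> fst d}"
  then have "qr p \<in> cm_space N"
    using qr_space by auto
  then obtain e where e: "e \<in> cm_atlas N" "qr p \<in> fst e"
    using chart_around[OF N] by blast
  have c: "cmb d e \<in> cm_atlas P"
    using d e cmb_atlas by auto
  have "slice V (qr q) (pr q) d i = V q (cmb d e) (oM + i)" if "q \<in> fst (cmb d e)" for q
  proof -
    have "qr q \<in> cm_space N"
      using that chart_subset[OF P c] qr_space by blast
    from chart_choice[OF this] show ?thesis
      using vfield_chart_indep[OF V d e(1), of "SOME e. e \<in> cm_atlas N \<and> qr q \<in> fst e" q i] that i
      by (simp add: slice_def dom)
  qed
  then show "\<exists>T g. openin (cm_top P) T \<and> p \<in> T \<and> holomorphic_fun P T g \<and>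
      (\<forall>q\<in>T \<inter> {p \<in> cm_space P. pr p \<in> fst d}. slice V (qr q) (pr q) d i = g q)"
    using V c chart_open[OF P c] p e indexM[OF i] unfolding holomorphic_vfield_def
    by (intro exI[of _ "fst (cmb d e)"] exI[of _ "\<lambda>q. V q (cmb d e) (oM + i)"]) (auto simp: dom)
qed

lemma slice_holomorphic_vfield:
  assumes V: "holomorphic_vfield P V" and y: "y \<in> cm_space N"
  shows "holomorphic_vfield M (slice V y)"
  unfolding holomorphic_vfield_def
proof (intro conjI ballI allI impI)
  note e = chart_choice[OF y]
  show "slice V y x d' j = (\<Sum>i<cm_dim M. chart_deriv d i (\<lambda>y. snd d' y j) x * slice V y x d i)"
    if "d \<in> cm_atlas M" "d' \<in> cm_atlas M" "x \<in> fst d \<inter> fst d'" "j < cm_dim M" for d d' x j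
    using vfield_transform[OF V that(1,2) e(1) e(1), of "mk x y" j] that e(2) by (simp add: slice_def dom)
  fix d i assume d: "d \<in> cm_atlas M" and i: "i < cm_dim M"
  have "holomorphic_fun M {x \<in> cm_space M. mk x y \<in> {p \<in> cm_space P. pr p \<in> fst d}}
      (\<lambda>x. slice V (qr (mk x y)) (pr (mk x y)) d i)"
    by (rule holomorphic_fun_slice[OF openin_pr[OF chart_open[OF M d]] slice_holomorphic_fun[OF V d i] y])
  moreover have "{x \<in> cm_space M. mk x y \<in> {p \<in> cm_space P. pr p \<in> fst d}} = fst d"
    using chart_subset[OF M d] mk_space[OF _ y] by auto
  ultimately show "holomorphic_fun M (fst d) (\<lambda>x. slice V y x d i)"
    by simp
qed

definition partM :: "'c vfield \<Rightarrow> 'c vfield"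
  where "partM V = (\<lambda>p c k. if oM \<le> k \<and> k < oM + cm_dim M then V p c k else 0)"

text \<open>Cross approximation splits the kernel into slices of \<open>V\<close> at nodes
  \<open>ys j\<close> and functions \<open>g j\<close> holomorphic on \<open>N\<close>. Each slice
  is a field on \<open>M\<close>, so the density property of \<open>M\<close> applies to it, and
  \<open>lift_generated\<close> multiplies the result by \<open>g j\<close>.\<close>

lemma partM_approximable:
  assumes dp: "density_property M" and V: "holomorphic_vfield P V"
  shows "approximable_on_compacts P (complete_generated P) (partM V)"
  unfolding approximable_on_compacts_def
proof (intro allI impI)
  interpret sw: factor N M P "\<lambda>y x. mk x y" qr pr "\<lambda>e d. cmb d e" oN oM
    by (rule swap)
  fix F :: "('c chart \<times> 'c set) set" and \<epsilon> :: real
  assume "finite F \<and> (\<forall>(c, K)\<in>F. c \<in> cm_atlas P \<and> compactin (cm_top P) K \<and> K \<subseteq> fst c) \<and> \<epsilon> > 0"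
  then have F: "finite F" and cK: "\<And>c K. (c, K) \<in> F \<Longrightarrow> c \<in> cm_atlas P" "\<And>c K. (c, K) \<in> F \<Longrightarrow> compactin (cm_top P) K"
      "\<And>c K. (c, K) \<in> F \<Longrightarrow> K \<subseteq> fst c" and "\<epsilon> > 0"
    by auto
  define D where "D c = fst (chart_parts c)" for c
  have D: "D c \<in> cm_atlas M" "\<And>p. p \<in> K \<Longrightarrow> pr p \<in> fst (D c)" if "(c, K) \<in> F" for c K
    using cK(3)[OF that] chart_parts(1)[OF cK(1)[OF that]] chart_parts_dom(1)[OF cK(1)[OF that]]
    unfolding D_def by blast+
  \<comment> \<open>The first argument of the kernel is a point together with a chart and a
    component. A single application of cross approximation then gives nodes and functions
    \<open>g j\<close> common to all components and to all members of \<open>F\<close>.\<close>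
  define X where "X = {(x, d, i). i < cm_dim M \<and> (\<exists>c K. (c, K) \<in> F \<and> d = D c \<and> x \<in> pr ` K)}"
  define L where "L = (\<Union>(c, K)\<in>F. qr ` K)"
  define f where "f = (\<lambda>(x, d, i) y. slice V y x d i)"
  have L: "compactin (cm_top N) L"
    unfolding L_def using F cK(2) by (intro compactin_Union) (auto intro: image_compactin[OF _ cont_qr])
  have hol: "holomorphic_fun N (cm_space N) (f \<xi>)" if "\<xi> \<in> X" for \<xi>
  proof -
    obtain x d i where "\<xi> = (x, d, i)"
      by (rule prod_cases3)
    moreover from this that obtain c K where "(c, K) \<in> F" "d = D c" "x \<in> pr ` K" "i < cm_dim M"
      unfolding X_def by blast
    ultimately have \<xi>: "\<xi> = (x, d, i)" "i < cm_dim M" "d \<in> cm_atlas M" "x \<in> fst d"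
      using D[of c K] by blast+
    then have x: "x \<in> cm_space M"
      using chart_subset[OF M] by blast
    have "holomorphic_fun N {y \<in> cm_space N. mk x y \<in> {p \<in> cm_space P. pr p \<in> fst d}}
        (\<lambda>y. slice V (qr (mk x y)) (pr (mk x y)) d i)"
      by (rule sw.holomorphic_fun_slice[OF openin_pr[OF chart_open[OF M \<xi>(3)]] slice_holomorphic_fun[OF V \<xi>(3,2)] x])
    moreover have "{y \<in> cm_space N. mk x y \<in> {p \<in> cm_space P. pr p \<in> fst d}} = cm_space N"
      using mk_space[OF x] \<xi> by auto
    ultimately show ?thesis
      by (simp add: f_def \<xi>)
  qed
  have bdd: "\<exists>C. \<forall>\<xi>\<in>X. \<forall>y\<in>Q. cmod (f \<xi> y) \<le> C" if Q: "compactin (cm_top N) Q" for Q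
  proof -
    have "\<exists>C. \<forall>x\<in>pr ` K. \<forall>y\<in>Q. cmod (slice V y x (D c) i) \<le> C" if c: "(c, K) \<in> F" and i: "i < cm_dim M" for c K i
    proof -
      have "compactin (prod_topology (cm_top M) (cm_top N)) (pr ` K \<times> Q)"
        using Q image_compactin[OF cK(2)[OF c] cont_pr] by (simp add: compactin_Times)
      then have K: "compactin (cm_top P) ((\<lambda>(x, y). mk x y) ` (pr ` K \<times> Q))"
        using cont_mk by (rule image_compactin)
      have "(\<lambda>(x, y). mk x y) ` (pr ` K \<times> Q) \<subseteq> {p \<in> cm_space P. pr p \<in> fst (D c)}"
        using compactin_subset_topspace[OF K] D(2)[OF c] by auto
      from compactin_bounded[OF K holomorphic_fun_continuous[OF P openin_pr[OF chart_open[OF M D(1)[OF c]]]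
          slice_holomorphic_fun[OF V D(1)[OF c] i]] this]
      show ?thesis by auto
    qed
    then obtain C where C: "\<And>c K i. (c, K) \<in> F \<Longrightarrow> i < cm_dim M \<Longrightarrow> \<forall>x\<in>pr ` K. \<forall>y\<in>Q. cmod (slice V y x (D c) i) \<le> C c K i"
      by metis
    \<comment> \<open>A sum of absolute values dominates each of the finitely many bounds and is
      meaningful for empty \<open>F\<close> as well.\<close>
    define C' where "C' = (\<Sum>(c, K)\<in>F. \<Sum>i<cm_dim M. \<bar>C c K i\<bar>)"
    have "C c K i \<le> C'" if "(c, K) \<in> F" "i < cm_dim M" for c K i
    proof -
      have "C c K i \<le> \<bar>C c K i\<bar>" by simp
      also have "\<dots> \<le> (\<Sum>i<cm_dim M. \<bar>C c K i\<bar>)"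
        using that by (intro member_le_sum) auto
      also have "\<dots> = (case (c, K) of (c, K) \<Rightarrow> \<Sum>i<cm_dim M. \<bar>C c K i\<bar>)"
        by simp
      also have "\<dots> \<le> C'"
        unfolding C'_def using that F by (intro member_le_sum) (auto intro: sum_nonneg)
      finally show ?thesis .
    qed
    then have "\<forall>\<xi>\<in>X. \<forall>y\<in>Q. cmod (f \<xi> y) \<le> C'"
      using C by (fastforce simp: X_def f_def)
    then show ?thesis ..
  qed
  have "0 < \<epsilon> / 3"
    using \<open>\<epsilon> > 0\<close> by simp
  then have "\<exists>(p::nat) xs ys a. (\<forall>i<p. xs i \<in> X) \<and> (\<forall>j<p. ys j \<in> L) \<and>
      (\<forall>\<xi>\<in>X. \<forall>y\<in>L. cmod (f \<xi> y - (\<Sum>j<p. f \<xi> (ys j) * (\<Sum>i<p. a i j * f (xs i) y))) \<le> \<epsilon> / 3)"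
    by (intro manifold_cross_approximation[OF N L] hol bdd)
  then obtain p :: nat and xs ys a where xs: "\<forall>i<p. xs i \<in> X" and ys: "\<forall>j<p. ys j \<in> L"
    and cross: "\<forall>\<xi>\<in>X. \<forall>y\<in>L. cmod (f \<xi> y - (\<Sum>j<p. f \<xi> (ys j) * (\<Sum>i<p. a i j * f (xs i) y))) \<le> \<epsilon> / 3"
    by (elim exE conjE) (rule that)
  define g where "g j y = (\<Sum>i<p. a i j * f (xs i) y)" for j y
  have LN: "L \<subseteq> cm_space N"
    using L by (rule compactin_subset_topspace)
  have g: "holomorphic_fun N (cm_space N) (g j)" for j
    unfolding g_def using hol xs
    by (intro holomorphic_fun_sum[OF N] holomorphic_fun_mult[OF N] holomorphic_fun_const[OF N] openin_topspace) auto
  have "\<exists>C. \<forall>y\<in>L. cmod (g j y) \<le> C" for j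
    using compactin_bounded[OF L _ LN] holomorphic_fun_continuous[OF N openin_topspace g] by blast
  then obtain C where C: "\<And>j y. y \<in> L \<Longrightarrow> cmod (g j y) \<le> C j"
    by metis
  \<comment> \<open>The summand 1 makes the constant positive, since the tolerance for the fields on
    \<open>M\<close> is divided by it.\<close>
  define C' where "C' = 1 + (\<Sum>j<p. \<bar>C j\<bar>)"
  have "0 < C'"
    by (simp add: C'_def add_pos_nonneg sum_nonneg)
  have C': "(\<Sum>j<p. cmod (g j y)) \<le> C'" if "y \<in> L" for y
  proof -
    have "(\<Sum>j<p. cmod (g j y)) \<le> (\<Sum>j<p. \<bar>C j\<bar>)"
      using C[OF that] by (intro sum_mono) (meson abs_ge_self order_trans)
    then show ?thesis by (simp add: C'_def)
  qed
  \<comment> \<open>The compact sets are projected to \<open>M\<close>: an approximation of a slice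
    there holds over all of \<open>N\<close>, and only the size of \<open>g j\<close> on
    \<open>L\<close> has to be taken into account.\<close>
  define F' where "F' = (\<lambda>(c, K). (D c, pr ` K)) ` F"
  have "\<exists>W. complete_generated M W \<and> (\<forall>(d, K)\<in>F'. \<forall>x\<in>K. \<forall>i<cm_dim M. cmod (slice V (ys j) x d i - W x d i) < \<epsilon> / (3 * C'))"
    if "j < p" for j
  proof -
    have "holomorphic_vfield M (slice V (ys j))"
      using ys that LN by (intro slice_holomorphic_vfield V) auto
    then have approx: "approximable_on_compacts M (complete_generated M) (slice V (ys j))"
      using dp by (simp add: density_property_def)
    have F': "finite F' \<and> (\<forall>(d, K)\<in>F'. d \<in> cm_atlas M \<and> compactin (cm_top M) K \<and> K \<subseteq> fst d) \<and> 0 < \<epsilon> / (3 * C')"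
      using F D cK(2) image_compactin[OF _ cont_pr] \<open>0 < C'\<close> \<open>\<epsilon> > 0\<close> by (auto simp: F'_def)
    show ?thesis
      by (rule approx[unfolded approximable_on_compacts_def, THEN spec, THEN spec, THEN mp, OF F'])
  qed
  then have "\<forall>j\<in>{..<p}. \<exists>W. complete_generated M W \<and>
      (\<forall>(d, K)\<in>F'. \<forall>x\<in>K. \<forall>i<cm_dim M. cmod (slice V (ys j) x d i - W x d i) < \<epsilon> / (3 * C'))"
    by (intro ballI) simp
  from bchoice[OF this] obtain W where *: "\<forall>j\<in>{..<p}. complete_generated M (W j) \<and>
      (\<forall>(d, K)\<in>F'. \<forall>x\<in>K. \<forall>i<cm_dim M. cmod (slice V (ys j) x d i - W j x d i) < \<epsilon> / (3 * C'))" ..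
  have W: "complete_generated M (W j)" if "j < p" for j
    by (rule conjunct1[OF bspec[OF *]]) (use that in simp)
  have approx: "\<forall>(d, K)\<in>F'. \<forall>x\<in>K. \<forall>i<cm_dim M. cmod (slice V (ys j) x d i - W j x d i) < \<epsilon> / (3 * C')" if "j < p" for j
    by (rule conjunct2[OF bspec[OF *]]) (use that in simp)
  have "\<forall>j\<in>{..<p}. \<exists>W'. complete_generated P W' \<and>
      (\<forall>c\<in>cm_atlas P. \<forall>q\<in>fst c. \<forall>k<cm_dim P. W' q c k = lift (g j) (W j) q c k)"
    using lift_generated[OF W g] by (intro ballI) simp
  from bchoice[OF this] obtain W' where *: "\<forall>j\<in>{..<p}. complete_generated P (W' j) \<and>
      (\<forall>c\<in>cm_atlas P. \<forall>q\<in>fst c. \<forall>k<cm_dim P. W' j q c k = lift (g j) (W j) q c k)" ..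
  have W': "complete_generated P (W' j)" if "j < p" for j
    by (rule conjunct1[OF bspec[OF *]]) (use that in simp)
  have W'_eq: "\<forall>c\<in>cm_atlas P. \<forall>q\<in>fst c. \<forall>k<cm_dim P. W' j q c k = lift (g j) (W j) q c k" if "j < p" for j
    by (rule conjunct2[OF bspec[OF *]]) (use that in simp)
  show "\<exists>W. complete_generated P W \<and> (\<forall>(c, K)\<in>F. \<forall>q\<in>K. \<forall>k<cm_dim P. cmod (partM V q c k - W q c k) < \<epsilon>)"
  proof (intro exI[of _ "\<lambda>q c k. \<Sum>j<p. W' j q c k"] conjI ballI allI impI, goal_cases)
    case 1
    show ?case
      using W' by (rule complete_generated_sum[OF P])
  next
    case (2 cK)
    obtain c K where [simp]: "cK = (c, K)" by (cases cK)
    have c: "(c, K) \<in> F" using 2 by simp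
    have "cmod (partM V q c k - (\<Sum>j<p. W' j q c k)) < \<epsilon>" if q: "q \<in> K" and k: "k < cm_dim P" for q k
    proof -
      have qc: "q \<in> fst c"
        using cK(3)[OF c] q by blast
      have "W' j q c k = lift (g j) (W j) q c k" if "j < p" for j
        using W'_eq[OF that] cK(1)[OF c] qc k by blast
      then have sum: "(\<Sum>j<p. W' j q c k) = (\<Sum>j<p. lift (g j) (W j) q c k)"
        by simp
      from k show ?thesis
      proof (cases rule: index_cases)
        case (2 i)
        then have "partM V q c k = 0" "(\<Sum>j<p. lift (g j) (W j) q c k) = 0"
          using indexN_not_M[of i] by (simp_all only: partM_def if_False liftN sum.neutral_const)
        then show ?thesis
          using \<open>\<epsilon> > 0\<close> by (simp add: sum)
      next
        case (1 i)
        define x y where "x = pr q" and "y = qr q"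
        have y: "y \<in> L"
          unfolding L_def y_def by (rule UN_I[OF c]) (use q in simp)
        have \<xi>: "(x, D c, i) \<in> X"
          using c q 1(1) unfolding X_def x_def by blast
        have fW: "cmod (f (x, D c, i) (ys j) - W j x (D c) i) \<le> \<epsilon> / (3 * C')" if "j < p" for j
        proof -
          have "(D c, pr ` K) \<in> F'"
            using c by (force simp: F'_def)
          from bspec[OF approx[OF that] this] show ?thesis
            using q 1 by (simp add: f_def x_def less_imp_le)
        qed
        have "partM V q c k = f (x, D c, i) y"
          using slice_eq[OF V cK(1)[OF c] qc 1(1)] 1 by (simp add: partM_def f_def x_def y_def D_def)
        moreover have "(\<Sum>j<p. lift (g j) (W j) q c k) = (\<Sum>j<p. g j y * W j x (D c) i)"
          using 1 by (simp add: liftM x_def y_def D_def)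
        \<comment> \<open>First the error of cross approximation, then the errors of the
          approximated slices weighted by the \<open>g j\<close>. Each is at most
          \<open>\<epsilon> / 3\<close>, which leaves room for the strict inequality.\<close>
        ultimately have "partM V q c k - (\<Sum>j<p. W' j q c k)
            = (f (x, D c, i) y - (\<Sum>j<p. f (x, D c, i) (ys j) * g j y))
              + (\<Sum>j<p. g j y * (f (x, D c, i) (ys j) - W j x (D c) i))"
          by (simp add: sum right_diff_distrib sum_subtractf mult.commute)
        also have "cmod \<dots> \<le> \<epsilon> / 3 + (\<Sum>j<p. cmod (g j y) * (\<epsilon> / (3 * C')))"
        proof (rule norm_triangle_mono)
          show "cmod (f (x, D c, i) y - (\<Sum>j<p. f (x, D c, i) (ys j) * g j y)) \<le> \<epsilon> / 3"
            using cross \<xi> y unfolding g_def by blast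
          show "cmod (\<Sum>j<p. g j y * (f (x, D c, i) (ys j) - W j x (D c) i)) \<le> (\<Sum>j<p. cmod (g j y) * (\<epsilon> / (3 * C')))"
          proof (rule sum_norm_le)
            fix j assume "j \<in> {..<p}"
            then show "cmod (g j y * (f (x, D c, i) (ys j) - W j x (D c) i)) \<le> cmod (g j y) * (\<epsilon> / (3 * C'))"
              unfolding norm_mult by (intro mult_left_mono fW) auto
          qed
        qed
        also have "(\<Sum>j<p. cmod (g j y) * (\<epsilon> / (3 * C'))) \<le> C' * (\<epsilon> / (3 * C'))"
          unfolding sum_distrib_right[symmetric] using C'[OF y] \<open>0 < C'\<close> \<open>\<epsilon> > 0\<close> by (intro mult_right_mono) auto
        also have "\<dots> = \<epsilon> / 3"
          using \<open>0 < C'\<close> by simp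
        finally show ?thesis
          using \<open>\<epsilon> > 0\<close> by linarith
      qed
    qed
    then show ?case by simp
  qed
qed

text \<open>Every field is the sum of its parts tangent to \<open>M\<close> and to \<open>N\<close>.
  The second part is handled by the same lemma under \<open>swap\<close>.\<close>

lemma density_property_factor:
  assumes dp: "density_property M" "density_property N"
  shows "density_property P"
  unfolding density_property_def
proof (intro conjI allI impI P)
  interpret sw: factor N M P "\<lambda>y x. mk x y" qr pr "\<lambda>e d. cmb d e" oN oM
    by (rule swap)
  fix V assume V: "holomorphic_vfield P V"
  show "approximable_on_compacts P (complete_generated P) V"
    unfolding approximable_on_compacts_def
  proof (intro allI impI)
    fix F :: "('c chart \<times> 'c set) set" and \<epsilon> :: real
    assume F: "finite F \<and> (\<forall>(c, K)\<in>F. c \<in> cm_atlas P \<and> compactin (cm_top P) K \<and> K \<subseteq> fst c) \<and> \<epsilon> > 0"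
    then have F2: "finite F \<and> (\<forall>(c, K)\<in>F. c \<in> cm_atlas P \<and> compactin (cm_top P) K \<and> K \<subseteq> fst c) \<and> \<epsilon> / 2 > 0"
      by auto
    from partM_approximable[OF dp(1) V, unfolded approximable_on_compacts_def, THEN spec, THEN spec, THEN mp, OF F2]
    obtain W1 where W1: "complete_generated P W1"
        "\<forall>(c, K)\<in>F. \<forall>q\<in>K. \<forall>k<cm_dim P. cmod (partM V q c k - W1 q c k) < \<epsilon> / 2"
      by (elim exE conjE) (rule that)
    from sw.partM_approximable[OF dp(2) V, unfolded approximable_on_compacts_def, THEN spec, THEN spec, THEN mp, OF F2]
    obtain W2 where W2: "complete_generated P W2"
        "\<forall>(c, K)\<in>F. \<forall>q\<in>K. \<forall>k<cm_dim P. cmod (sw.partM V q c k - W2 q c k) < \<epsilon> / 2"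
      by (elim exE conjE) (rule that)
    have "cmod (V q c k - vfield_add W1 W2 q c k) < \<epsilon>" if "(c, K) \<in> F" "q \<in> K" "k < cm_dim P" for c K q k
    proof -
      have "V q c k = partM V q c k + sw.partM V q c k"
        using that(3) dim offsets by (auto simp: partM_def sw.partM_def)
      then have "V q c k - vfield_add W1 W2 q c k = (partM V q c k - W1 q c k) + (sw.partM V q c k - W2 q c k)"
        by (simp add: vfield_add_def)
      then have "cmod (V q c k - vfield_add W1 W2 q c k) \<le> cmod (partM V q c k - W1 q c k) + cmod (sw.partM V q c k - W2 q c k)"
        by (simp only: norm_triangle_ineq)
      moreover have "cmod (partM V q c k - W1 q c k) < \<epsilon> / 2" "cmod (sw.partM V q c k - W2 q c k) < \<epsilon> / 2"
        using bspec[OF W1(2) that(1)] bspec[OF W2(2) that(1)] that(2,3) by simp_all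
      ultimately show ?thesis
        by linarith
    qed
    then show "\<exists>W. complete_generated P W \<and> (\<forall>(c, K)\<in>F. \<forall>q\<in>K. \<forall>k<cm_dim P. cmod (V q c k - W q c k) < \<epsilon>)"
      by (intro exI[of _ "vfield_add W1 W2"] conjI complete_generated.sum[OF W1(1) W2(1)]) blast
  qed
qed

end

section \<open>Products and open submanifolds\<close>

lemma second_countable_prod_topology:
  assumes "second_countable X" "second_countable Y"
  shows "second_countable (prod_topology X Y)"
proof -
  obtain \<A> where A: "countable \<A>" "\<And>V. V \<in> \<A> \<Longrightarrow> openin X V"
      "\<And>U x. openin X U \<Longrightarrow> x \<in> U \<Longrightarrow> \<exists>V\<in>\<A>. x \<in> V \<and> V \<subseteq> U"
    using assms(1) unfolding second_countable_def by meson
  obtain \<B> where B: "countable \<B>" "\<And>V. V \<in> \<B> \<Longrightarrow> openin Y V"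
      "\<And>U x. openin Y U \<Longrightarrow> x \<in> U \<Longrightarrow> \<exists>V\<in>\<B>. x \<in> V \<and> V \<subseteq> U"
    using assms(2) unfolding second_countable_def by meson
  let ?C = "(\<lambda>(S, T). S \<times> T) ` (\<A> \<times> \<B>)"
  have "\<exists>V\<in>?C. p \<in> V \<and> V \<subseteq> U" if U: "openin (prod_topology X Y) U" "p \<in> U" for U p
  proof -
    obtain S T where "openin X S" "openin Y T" "fst p \<in> S" "snd p \<in> T" "S \<times> T \<subseteq> U"
      using U unfolding openin_prod_topology_alt by (metis prod.collapse)
    then obtain S' T' where "S' \<in> \<A>" "T' \<in> \<B>" "fst p \<in> S'" "snd p \<in> T'" "S' \<subseteq> S" "T' \<subseteq> T"
      using A(3) B(3) by meson
    then have "S' \<times> T' \<in> ?C" "p \<in> S' \<times> T'" "S' \<times> T' \<subseteq> U"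
      using \<open>S \<times> T \<subseteq> U\<close> by (auto simp: mem_Times_iff)
    then show ?thesis by blast
  qed
  moreover have "countable ?C" "\<forall>V\<in>?C. openin (prod_topology X Y) V"
    using A(1,2) B(1,2) by (auto simp: openin_prod_Times_iff)
  ultimately show ?thesis
    unfolding second_countable_def by blast
qed

section \<open>Splitting the coordinates of a product\<close>

definition init_coords :: "nat \<Rightarrow> (nat \<Rightarrow> complex) \<Rightarrow> nat \<Rightarrow> complex"
  where "init_coords m z = (\<lambda>i. if i < m then z i else 0)"

definition tail_coords :: "nat \<Rightarrow> (nat \<Rightarrow> complex) \<Rightarrow> nat \<Rightarrow> complex"
  where "tail_coords m z = (\<lambda>i. z (m + i))"

definition join_coords :: "nat \<Rightarrow> (nat \<Rightarrow> complex) \<Rightarrow> (nat \<Rightarrow> complex) \<Rightarrow> nat \<Rightarrow> complex"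
  where "join_coords m a b = (\<lambda>i. if i < m then a i else b (i - m))"

lemma init_join: "a \<in> Cn m \<Longrightarrow> init_coords m (join_coords m a b) = a"
  by (auto simp: init_coords_def join_coords_def Cn_def)

lemma tail_join: "tail_coords m (join_coords m a b) = b"
  by (auto simp: tail_coords_def join_coords_def)

lemma join_init_tail: "join_coords m (init_coords m z) (tail_coords m z) = z"
  by (auto simp: init_coords_def tail_coords_def join_coords_def)

lemma join_Cn: "b \<in> Cn n \<Longrightarrow> join_coords m a b \<in> Cn (m + n)"
  by (auto simp: join_coords_def Cn_def)

lemma init_Cn: "init_coords m z \<in> Cn m"
  by (auto simp: init_coords_def Cn_def)

lemma tail_Cn: "z \<in> Cn (m + n) \<Longrightarrow> tail_coords m z \<in> Cn n"
  by (auto simp: tail_coords_def Cn_def)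

lemma continuous_on_init: "continuous_on A (init_coords m)"
  unfolding init_coords_def
proof (rule continuous_on_coordinatewise_then_product)
  show "continuous_on A (\<lambda>z. if i < m then z i else 0)" for i
    by (cases "i < m") (auto intro: continuous_on_subset[OF continuous_on_product_coordinates])
qed

lemma continuous_on_tail: "continuous_on A (tail_coords m)"
  unfolding tail_coords_def
  by (rule continuous_on_coordinatewise_then_product) (auto intro: continuous_on_subset[OF continuous_on_product_coordinates])

lemma openin_init_tail:
  assumes "openin (top_of_set (Cn m)) S" "openin (top_of_set (Cn n)) T"
  shows "openin (top_of_set (Cn (m + n))) {z \<in> Cn (m + n). init_coords m z \<in> S \<and> tail_coords m z \<in> T}"
proof -
  have "openin (top_of_set (Cn (m + n))) {z \<in> topspace (top_of_set (Cn (m + n))). init_coords m z \<in> S}"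
    using assms(1) init_Cn by (intro openin_continuous_map_preimage[where Y = "top_of_set (Cn m)"])
      (auto simp: continuous_map_in_subtopology continuous_on_init)
  moreover have "openin (top_of_set (Cn (m + n))) {z \<in> topspace (top_of_set (Cn (m + n))). tail_coords m z \<in> T}"
    using assms(2) tail_Cn by (intro openin_continuous_map_preimage[where Y = "top_of_set (Cn n)"])
      (auto simp: continuous_map_in_subtopology continuous_on_tail)
  ultimately have "openin (top_of_set (Cn (m + n))) ({z \<in> topspace (top_of_set (Cn (m + n))). init_coords m z \<in> S} \<inter>
      {z \<in> topspace (top_of_set (Cn (m + n))). tail_coords m z \<in> T})"
    by blast
  then show ?thesis
    by (rule back_subst) auto
qed

text \<open>Openness of \<open>S\<close> is essential: the derivative at \<open>z\<close> compares
  the functions at nearby points, which must lie in \<open>S\<close>.\<close>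

lemma holomorphic_Cn_cong:
  assumes S: "openin (top_of_set (Cn n)) S" and eq: "\<And>z. z \<in> S \<Longrightarrow> f z = g z" and g: "holomorphic_Cn n S g"
  shows "holomorphic_Cn n S f"
  unfolding holomorphic_Cn_def
proof (intro conjI ballI allI impI)
  show "continuous_on S f"
    using g eq by (simp add: holomorphic_Cn_def cong: continuous_on_cong)
  fix z i assume z: "z \<in> S" and i: "i < n"
  have "z \<in> Cn n"
    using openin_imp_subset[OF S] z by blast
  obtain \<rho> where \<rho>: "0 < \<rho>" "polydisc n z \<rho> \<subseteq> S"
    using polydisc_nhd[OF S z] .
  have "\<forall>\<^sub>F t in nhds (z i). t \<in> ball (z i) \<rho>"
    using \<rho> by (intro eventually_nhds_in_open) auto
  then have "\<forall>\<^sub>F t in nhds (z i). f (z(i := t)) = g (z(i := t))"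
  proof eventually_elim
    case (elim t)
    then have "z(i := t) \<in> polydisc n z \<rho>"
      using \<rho>(1) \<open>z \<in> Cn n\<close> i by (auto simp: polydisc_def Cn_def dist_norm norm_minus_commute)
    then show ?case
      using \<rho> eq by blast
  qed
  from DERIV_cong_ev[OF refl this refl] show "(\<lambda>t. f (z(i := t))) field_differentiable at (z i)"
    using g z i by (simp add: holomorphic_Cn_def field_differentiable_def)
qed

lemma holomorphic_Cn_init:
  assumes "holomorphic_Cn m S h" "\<And>z. z \<in> T \<Longrightarrow> init_coords m z \<in> S"
  shows "holomorphic_Cn (m + n) T (\<lambda>z. h (init_coords m z))"
  unfolding holomorphic_Cn_def
proof (intro conjI ballI allI impI)
  show "continuous_on T (\<lambda>z. h (init_coords m z))"
    using assms by (intro continuous_on_compose2[OF _ continuous_on_init]) (auto simp: holomorphic_Cn_def)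
  fix z i assume z: "z \<in> T"
  show "(\<lambda>t. h (init_coords m (z(i := t)))) field_differentiable at (z i)"
  proof (cases "i < m")
    case True
    then have "init_coords m (z(i := t)) = (init_coords m z)(i := t)" for t
      by (auto simp: init_coords_def)
    moreover have "init_coords m z i = z i"
      using True by (simp add: init_coords_def)
    moreover have "(\<lambda>t. h ((init_coords m z)(i := t))) field_differentiable at (init_coords m z i)"
      using assms(1) assms(2)[OF z] True by (simp add: holomorphic_Cn_def)
    ultimately show ?thesis
      by (simp only:)
  next
    case False
    then have "init_coords m (z(i := t)) = init_coords m z" for t
      by (auto simp: init_coords_def)
    then show ?thesis by simp
  qed
qed

lemma holomorphic_Cn_tail:
  assumes "holomorphic_Cn n S h" "\<And>z. z \<in> T \<Longrightarrow> tail_coords m z \<in> S"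
  shows "holomorphic_Cn (m + n) T (\<lambda>z. h (tail_coords m z))"
  unfolding holomorphic_Cn_def
proof (intro conjI ballI allI impI)
  show "continuous_on T (\<lambda>z. h (tail_coords m z))"
    using assms by (intro continuous_on_compose2[OF _ continuous_on_tail]) (auto simp: holomorphic_Cn_def)
  fix z i assume z: "z \<in> T" and i: "i < m + n"
  show "(\<lambda>t. h (tail_coords m (z(i := t)))) field_differentiable at (z i)"
  proof (cases "i < m")
    case True
    then have "tail_coords m (z(i := t)) = tail_coords m z" for t
      by (auto simp: tail_coords_def)
    then show ?thesis by simp
  next
    case False
    then have "tail_coords m (z(i := t)) = (tail_coords m z)(i - m := t)" for t
      by (intro ext) (auto simp: tail_coords_def)
    moreover have "tail_coords m z (i - m) = z i" "i - m < n"
      using False i by (auto simp: tail_coords_def)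
    moreover from this(2) have "(\<lambda>t. h ((tail_coords m z)(i - m := t))) field_differentiable at (tail_coords m z (i - m))"
      using assms(1) assms(2)[OF z] by (simp add: holomorphic_Cn_def)
    ultimately show ?thesis
      by (simp only:)
  qed
qed

text \<open>Presents the product atlas as the image of pairs of charts, in the shape that the locale
  \<open>factor\<close> requires of \<open>cmb\<close>.\<close>

definition join_chart :: "nat \<Rightarrow> 'a chart \<Rightarrow> 'b chart \<Rightarrow> ('a \<times> 'b) chart"
  where "join_chart m d e = (fst d \<times> fst e, \<lambda>(x, y). join_coords m (snd d x) (snd e y))"

lemma fst_join_chart: "fst (join_chart m d e) = fst d \<times> fst e"
  by (simp add: join_chart_def)

lemma snd_join_chart: "snd (join_chart m d e) p = join_coords m (snd d (fst p)) (snd e (snd p))"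
  by (simp add: join_chart_def case_prod_beta)

lemma product_manifold_simps:
  "cm_top (product_manifold M N) = prod_topology (cm_top M) (cm_top N)"
  "cm_dim (product_manifold M N) = cm_dim M + cm_dim N"
  "cm_atlas (product_manifold M N) = {join_chart (cm_dim M) d e | d e. d \<in> cm_atlas M \<and> e \<in> cm_atlas N}"
proof -
  have "cm_atlas (product_manifold M N) = {(U \<times> V, \<lambda>(x, y) i. if i < cm_dim M then \<phi> x i else \<psi> y (i - cm_dim M)) | U \<phi> V \<psi>.
       (U, \<phi>) \<in> cm_atlas M \<and> (V, \<psi>) \<in> cm_atlas N}"
    by (simp add: product_manifold_def)
  also have "\<dots> = {join_chart (cm_dim M) (U, \<phi>) (V, \<psi>) | U \<phi> V \<psi>. (U, \<phi>) \<in> cm_atlas M \<and> (V, \<psi>) \<in> cm_atlas N}"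
    by (simp add: join_chart_def join_coords_def)
  also have "\<dots> = {join_chart (cm_dim M) d e | d e. d \<in> cm_atlas M \<and> e \<in> cm_atlas N}"
    by (simp only: split_paired_Ex)
  finally show "cm_atlas (product_manifold M N) = {join_chart (cm_dim M) d e | d e. d \<in> cm_atlas M \<and> e \<in> cm_atlas N}" .
qed (simp_all add: product_manifold_def)

context
  fixes M :: "'a cmfd" and N :: "'b cmfd"
  assumes M: "complex_manifold M" and N: "complex_manifold N"
begin

lemma join_chart_image:
  assumes d: "d \<in> cm_atlas M" and e: "e \<in> cm_atlas N" and "S \<subseteq> fst d" "T \<subseteq> fst e"
  shows "snd (join_chart (cm_dim M) d e) ` (S \<times> T) = {z \<in> Cn (cm_dim M + cm_dim N). init_coords (cm_dim M) z \<in> snd d ` S \<and> tail_coords (cm_dim M) z \<in> snd e ` T}"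
    (is "?L = ?R")
proof
  have "init_coords (cm_dim M) (snd (join_chart (cm_dim M) d e) p) = snd d (fst p)" "tail_coords (cm_dim M) (snd (join_chart (cm_dim M) d e) p) = snd e (snd p)"
    "snd (join_chart (cm_dim M) d e) p \<in> Cn (cm_dim M + cm_dim N)" if "p \<in> S \<times> T" for p
    using that assms(3,4) chart_Cn[OF M d] chart_Cn[OF N e] by (auto simp: snd_join_chart init_join tail_join join_Cn)
  then show "?L \<subseteq> ?R"
    by fastforce
  show "?R \<subseteq> ?L"
  proof
    fix z assume "z \<in> ?R"
    then obtain x y where xy: "x \<in> S" "y \<in> T" "init_coords (cm_dim M) z = snd d x" "tail_coords (cm_dim M) z = snd e y"
      by auto
    then have "z = snd (join_chart (cm_dim M) d e) (x, y)"
      using join_init_tail[of "cm_dim M" z] by (simp add: snd_join_chart)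
    then show "z \<in> ?L"
      using xy by blast
  qed
qed

lemma join_chart_image_open:
  assumes d: "d \<in> cm_atlas M" and e: "e \<in> cm_atlas N" and S: "openin (cm_top M) S" "S \<subseteq> fst d"
    and T: "openin (cm_top N) T" "T \<subseteq> fst e"
  shows "openin (top_of_set (Cn (cm_dim M + cm_dim N))) (snd (join_chart (cm_dim M) d e) ` (S \<times> T))"
  unfolding join_chart_image[OF d e S(2) T(2)]
  by (intro openin_init_tail chart_image_openin[OF M d] chart_image_openin[OF N e] S T)

lemma join_chart_inv:
  assumes d: "d \<in> cm_atlas M" and e: "e \<in> cm_atlas N" and p: "p \<in> fst d \<times> fst e"
  shows "inv_into (fst d) (snd d) (init_coords (cm_dim M) (snd (join_chart (cm_dim M) d e) p)) = fst p"
    "inv_into (fst e) (snd e) (tail_coords (cm_dim M) (snd (join_chart (cm_dim M) d e) p)) = snd p"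
  using p chart_inv[OF M d] chart_inv[OF N e] chart_Cn[OF M d] by (auto simp: snd_join_chart init_join tail_join)

text \<open>Continuity into the sequence space is checked coordinatewise; the inverse splits a
  vector by \<open>init_coords\<close> and \<open>tail_coords\<close> and inverts the two
  charts.\<close>

lemma join_chart_homeomorphic:
  assumes d: "d \<in> cm_atlas M" and e: "e \<in> cm_atlas N"
  shows "homeomorphic_map (subtopology (prod_topology (cm_top M) (cm_top N)) (fst d \<times> fst e))
    (top_of_set (snd (join_chart (cm_dim M) d e) ` (fst d \<times> fst e))) (snd (join_chart (cm_dim M) d e))"
proof -
  let ?X = "subtopology (prod_topology (cm_top M) (cm_top N)) (fst d \<times> fst e)"
  let ?A = "snd (join_chart (cm_dim M) d e) ` (fst d \<times> fst e)"
  define g where "g z = (inv_into (fst d) (snd d) (init_coords (cm_dim M) z), inv_into (fst e) (snd e) (tail_coords (cm_dim M) z))" for z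
  have X: "?X = prod_topology (subtopology (cm_top M) (fst d)) (subtopology (cm_top N) (fst e))"
    by (simp add: subtopology_Times)
  have cd: "continuous_map (subtopology (cm_top M) (fst d)) euclidean (\<lambda>x. snd d x i)" if "i < cm_dim M" for i
    using holomorphic_fun_continuous[OF M chart_open[OF M d] holomorphic_fun_coord[OF M d that]] .
  \<comment> \<open>Coordinates beyond the dimension of \<open>N\<close> are included, because
    continuity into the sequence space concerns all indices; on the chart they vanish
    identically.\<close>
  have ce: "continuous_map (subtopology (cm_top N) (fst e)) euclidean (\<lambda>x. snd e x i)" for i
  proof (cases "i < cm_dim N")
    case True
    then show ?thesis
      using holomorphic_fun_continuous[OF N chart_open[OF N e] holomorphic_fun_coord[OF N e]] by blast
  next
    case False
    show ?thesis
      by (rule continuous_map_eq[where f = "\<lambda>x. 0"]) (use False chart_zero[OF N e] in auto)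
  qed
  have "continuous_map ?X euclidean (\<lambda>p. snd (join_chart (cm_dim M) d e) p i)" for i
  proof (cases "i < cm_dim M")
    case True
    then show ?thesis
      using continuous_map_compose[OF continuous_map_fst cd[OF True], of "subtopology (cm_top N) (fst e)"]
      by (simp add: X snd_join_chart join_coords_def o_def)
  next
    case False
    then show ?thesis
      using continuous_map_compose[OF continuous_map_snd ce, of "subtopology (cm_top M) (fst d)" "i - cm_dim M"]
      by (simp add: X snd_join_chart join_coords_def o_def)
  qed
  then have "continuous_map ?X (product_topology (\<lambda>i. euclidean) UNIV) (snd (join_chart (cm_dim M) d e))"
    by (simp add: continuous_map_componentwise_UNIV)
  then have f: "continuous_map ?X (top_of_set ?A) (snd (join_chart (cm_dim M) d e))"
    by (auto simp: continuous_map_in_subtopology euclidean_product_topology)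
  have A: "?A = {z \<in> Cn (cm_dim M + cm_dim N). init_coords (cm_dim M) z \<in> snd d ` fst d \<and> tail_coords (cm_dim M) z \<in> snd e ` fst e}"
    by (rule join_chart_image[OF d e order.refl order.refl])
  have "continuous_map (top_of_set ?A) (top_of_set (snd d ` fst d)) (init_coords (cm_dim M))"
    "continuous_map (top_of_set ?A) (top_of_set (snd e ` fst e)) (tail_coords (cm_dim M))"
    unfolding A by (auto simp: continuous_map_in_subtopology continuous_on_init continuous_on_tail)
  moreover have "continuous_map (top_of_set (snd d ` fst d)) (subtopology (cm_top M) (fst d)) (inv_into (fst d) (snd d))"
    "continuous_map (top_of_set (snd e ` fst e)) (subtopology (cm_top N) (fst e)) (inv_into (fst e) (snd e))"
    using chart_homeomorphic_subset[OF M d order.refl] chart_homeomorphic_subset[OF N e order.refl]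
    by (auto simp: homeomorphic_maps_def)
  ultimately have "continuous_map (top_of_set ?A) (subtopology (cm_top M) (fst d)) (inv_into (fst d) (snd d) \<circ> init_coords (cm_dim M))"
    "continuous_map (top_of_set ?A) (subtopology (cm_top N) (fst e)) (inv_into (fst e) (snd e) \<circ> tail_coords (cm_dim M))"
    by (blast intro: continuous_map_compose)+
  then have g: "continuous_map (top_of_set ?A) ?X g"
    unfolding X g_def by (intro continuous_map_pairedI) (auto simp: o_def)
  have gf: "g (snd (join_chart (cm_dim M) d e) p) = p" if "p \<in> fst d \<times> fst e" for p
    using join_chart_inv[OF d e that] by (simp add: g_def)
  have "homeomorphic_maps ?X (top_of_set ?A) (snd (join_chart (cm_dim M) d e)) g"
    unfolding homeomorphic_maps_def using f g gf by (auto simp: image_iff)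
  then show ?thesis
    by (auto simp: homeomorphic_map_maps)
qed

lemma join_chart_inv_into:
  assumes d: "d \<in> cm_atlas M" and e: "e \<in> cm_atlas N" and z: "z \<in> snd (join_chart (cm_dim M) d e) ` (fst d \<times> fst e)"
  shows "inv_into (fst d \<times> fst e) (snd (join_chart (cm_dim M) d e)) z =
    (inv_into (fst d) (snd d) (init_coords (cm_dim M) z), inv_into (fst e) (snd e) (tail_coords (cm_dim M) z))"
proof -
  obtain p where p: "p \<in> fst d \<times> fst e" "z = snd (join_chart (cm_dim M) d e) p"
    using z by auto
  have "inj_on (snd (join_chart (cm_dim M) d e)) (fst d \<times> fst e)"
    by (rule inj_on_inverseI[where g = "\<lambda>z. (inv_into (fst d) (snd d) (init_coords (cm_dim M) z), inv_into (fst e) (snd e) (tail_coords (cm_dim M) z))"])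
      (use join_chart_inv[OF d e] in simp)
  then show ?thesis
    using join_chart_inv[OF d e p(1)] p by (simp add: inv_into_f_f)
qed

lemma join_chart_transition:
  assumes d: "d \<in> cm_atlas M" "d' \<in> cm_atlas M" and e: "e \<in> cm_atlas N" "e' \<in> cm_atlas N" and j: "j < cm_dim M + cm_dim N"
  shows "holomorphic_Cn (cm_dim M + cm_dim N) (snd (join_chart (cm_dim M) d e) ` ((fst d \<times> fst e) \<inter> (fst d' \<times> fst e')))
    (\<lambda>z. snd (join_chart (cm_dim M) d' e') (inv_into (fst d \<times> fst e) (snd (join_chart (cm_dim M) d e)) z) j)"
proof -
  let ?S = "snd (join_chart (cm_dim M) d e) ` ((fst d \<inter> fst d') \<times> (fst e \<inter> fst e'))"
  have S: "openin (top_of_set (Cn (cm_dim M + cm_dim N))) ?S"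
    by (intro join_chart_image_open d(1) e(1) openin_Int chart_open[OF M] chart_open[OF N] d e Int_lower1)
  have mem: "init_coords (cm_dim M) z \<in> snd d ` (fst d \<inter> fst d')" "tail_coords (cm_dim M) z \<in> snd e ` (fst e \<inter> fst e')" if "z \<in> ?S" for z
    using that unfolding join_chart_image[OF d(1) e(1) Int_lower1 Int_lower1] by auto
  have inv: "inv_into (fst d \<times> fst e) (snd (join_chart (cm_dim M) d e)) z =
      (inv_into (fst d) (snd d) (init_coords (cm_dim M) z), inv_into (fst e) (snd e) (tail_coords (cm_dim M) z))" if "z \<in> ?S" for z
    by (rule join_chart_inv_into[OF d(1) e(1)]) (use that in auto)
  have "holomorphic_Cn (cm_dim M + cm_dim N) ?S (\<lambda>z. snd (join_chart (cm_dim M) d' e') (inv_into (fst d \<times> fst e) (snd (join_chart (cm_dim M) d e)) z) j)"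
  proof (cases "j < cm_dim M")
    case True
    have "holomorphic_Cn (cm_dim M) (snd d ` (fst d \<inter> fst d')) (\<lambda>z. snd d' (inv_into (fst d) (snd d) z) j)"
      using holomorphic_fun_coord[OF M d(2) True] d(1) by (auto simp: holomorphic_fun_def)
    from holomorphic_Cn_init[OF this mem(1)] show ?thesis
      by (rule holomorphic_Cn_cong[OF S, rotated]) (simp_all add: inv snd_join_chart join_coords_def True)
  next
    case False
    then have "j - cm_dim M < cm_dim N"
      using j by simp
    then have "holomorphic_Cn (cm_dim N) (snd e ` (fst e \<inter> fst e')) (\<lambda>z. snd e' (inv_into (fst e) (snd e) z) (j - cm_dim M))"
      using holomorphic_fun_coord[OF N e(2), of "j - cm_dim M"] e(1) by (auto simp: holomorphic_fun_def)
    from holomorphic_Cn_tail[OF this mem(2)] show ?thesis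
      by (rule holomorphic_Cn_cong[OF S, rotated]) (simp_all add: inv snd_join_chart join_coords_def False)
  qed
  then show ?thesis
    by (simp add: Times_Int_Times)
qed

lemma complex_manifold_product: "complex_manifold (product_manifold M N)"
  unfolding complex_manifold_def case_prod_beta product_manifold_simps
proof (intro conjI ballI allI impI)
  show "Hausdorff_space (prod_topology (cm_top M) (cm_top N))"
    using M N by (simp add: complex_manifold_def Hausdorff_space_prod_topology)
  show "second_countable (prod_topology (cm_top M) (cm_top N))"
    using M N by (simp add: complex_manifold_def second_countable_prod_topology)
  show "(\<Union>c\<in>{join_chart (cm_dim M) d e |d e. d \<in> cm_atlas M \<and> e \<in> cm_atlas N}. fst c) = topspace (prod_topology (cm_top M) (cm_top N))"
  proof (intro equalityI subsetI)
    fix p assume "p \<in> (\<Union>c\<in>{join_chart (cm_dim M) d e |d e. d \<in> cm_atlas M \<and> e \<in> cm_atlas N}. fst c)"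
    then obtain d e where "d \<in> cm_atlas M" "e \<in> cm_atlas N" "p \<in> fst (join_chart (cm_dim M) d e)"
      by blast
    then show "p \<in> topspace (prod_topology (cm_top M) (cm_top N))"
      using chart_subset[OF M, of d] chart_subset[OF N, of e] by (auto simp: fst_join_chart)
  next
    fix p assume p: "p \<in> topspace (prod_topology (cm_top M) (cm_top N))"
    have "fst p \<in> cm_space M" "snd p \<in> cm_space N"
      using p by auto
    obtain d where "d \<in> cm_atlas M" "fst p \<in> fst d"
      by (rule chart_around[OF M \<open>fst p \<in> cm_space M\<close>])
    moreover obtain e where "e \<in> cm_atlas N" "snd p \<in> fst e"
      by (rule chart_around[OF N \<open>snd p \<in> cm_space N\<close>])
    ultimately have "join_chart (cm_dim M) d e \<in> {join_chart (cm_dim M) d e |d e. d \<in> cm_atlas M \<and> e \<in> cm_atlas N}"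
        "p \<in> fst (join_chart (cm_dim M) d e)"
      by (blast, simp add: fst_join_chart mem_Times_iff)
    then show "p \<in> (\<Union>c\<in>{join_chart (cm_dim M) d e |d e. d \<in> cm_atlas M \<and> e \<in> cm_atlas N}. fst c)"
      by (rule UN_I)
  qed
next
  fix c assume "c \<in> {join_chart (cm_dim M) d e |d e. d \<in> cm_atlas M \<and> e \<in> cm_atlas N}"
  then obtain d e where c: "d \<in> cm_atlas M" "e \<in> cm_atlas N" "c = join_chart (cm_dim M) d e"
    by blast
  show "openin (prod_topology (cm_top M) (cm_top N)) (fst c)"
    using chart_open[OF M c(1)] chart_open[OF N c(2)] by (simp add: c(3) fst_join_chart openin_prod_Times_iff)
  show "openin (top_of_set (Cn (cm_dim M + cm_dim N))) (snd c ` fst c)"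
    unfolding c(3) fst_join_chart using chart_open[OF M c(1)] chart_open[OF N c(2)]
    by (intro join_chart_image_open c(1,2)) auto
  show "homeomorphic_map (subtopology (prod_topology (cm_top M) (cm_top N)) (fst c)) (top_of_set (snd c ` fst c)) (snd c)"
    unfolding c(3) fst_join_chart by (rule join_chart_homeomorphic[OF c(1,2)])
  fix c' j assume "c' \<in> {join_chart (cm_dim M) d e |d e. d \<in> cm_atlas M \<and> e \<in> cm_atlas N}" and j: "j < cm_dim M + cm_dim N"
  then obtain d' e' where c': "d' \<in> cm_atlas M" "e' \<in> cm_atlas N" "c' = join_chart (cm_dim M) d' e'"
    by blast
  show "holomorphic_Cn (cm_dim M + cm_dim N) (snd c ` (fst c \<inter> fst c')) (\<lambda>z. snd c' (inv_into (fst c) (snd c) z) j)"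
    unfolding c(3) c'(3) fst_join_chart by (rule join_chart_transition[OF c(1) c'(1) c(2) c'(2) j])
qed

lemma factor_product: "factor M N (product_manifold M N) Pair fst snd (join_chart (cm_dim M)) 0 (cm_dim M)"
  by unfold_locales
    (auto simp: M N complex_manifold_product product_manifold_simps continuous_map_fst continuous_map_snd case_prod_beta
      fst_join_chart snd_join_chart join_coords_def simp del: split_paired_Ex split_paired_All)

end

text \<open>An equality of records rather than an isomorphism, by \<open>(U \<times> V) \<inter> (S
  \<times> T) = (U \<inter> S) \<times> (V \<inter> T)\<close>. Properties of the complement of a
  divisor can thus be transferred by rewriting.\<close>

lemma open_submanifold_product:
  "open_submanifold (product_manifold M N) (S \<times> T) = product_manifold (open_submanifold M S) (open_submanifold N T)"
proof -
  have img: "{g d e |d e. d \<in> A \<and> e \<in> B} = (\<lambda>p. g (fst p) (snd p)) ` (A \<times> B)" for g :: "'x \<Rightarrow> 'y \<Rightarrow> 'z" and A B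
    by force
  have "cm_atlas (open_submanifold (product_manifold M N) (S \<times> T))
      = (\<lambda>c. (fst c \<inter> S \<times> T, snd c)) ` (\<lambda>p. join_chart (cm_dim M) (fst p) (snd p)) ` (cm_atlas M \<times> cm_atlas N)"
    by (simp add: open_submanifold_def product_manifold_simps case_prod_beta img del: split_paired_Ex)
  also have "\<dots> = (\<lambda>p. join_chart (cm_dim M) (fst p) (snd p)) ` ((\<lambda>p. ((fst (fst p) \<inter> S, snd (fst p)), (fst (snd p) \<inter> T, snd (snd p)))) ` (cm_atlas M \<times> cm_atlas N))"
    unfolding image_image by (intro image_cong refl) (auto simp: join_chart_def)
  also have "(\<lambda>p. ((fst (fst p) \<inter> S, snd (fst p)), (fst (snd p) \<inter> T, snd (snd p)))) ` (cm_atlas M \<times> cm_atlas N)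
      = (\<lambda>d. (fst d \<inter> S, snd d)) ` cm_atlas M \<times> (\<lambda>e. (fst e \<inter> T, snd e)) ` cm_atlas N"
    by force
  also have "(\<lambda>p. join_chart (cm_dim M) (fst p) (snd p)) ` \<dots> = cm_atlas (product_manifold (open_submanifold M S) (open_submanifold N T))"
    by (simp add: open_submanifold_def product_manifold_simps case_prod_beta img del: split_paired_Ex)
  finally have "cm_atlas (open_submanifold (product_manifold M N) (S \<times> T))
      = cm_atlas (product_manifold (open_submanifold M S) (open_submanifold N T))" .
  moreover have "cm_top (open_submanifold (product_manifold M N) (S \<times> T)) = cm_top (product_manifold (open_submanifold M S) (open_submanifold N T))"
    by (simp add: open_submanifold_def product_manifold_simps subtopology_Times)
  moreover have "cm_dim (open_submanifold (product_manifold M N) (S \<times> T)) = cm_dim (product_manifold (open_submanifold M S) (open_submanifold N T))"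
    by (simp add: open_submanifold_def product_manifold_simps)
  ultimately show ?thesis
    by (intro cmfd.equality) auto
qed

section \<open>Products of Stein manifolds\<close>

text \<open>Each test function contributes the closed preimage of a closed disc. The disc is empty
  for a negative bound, in agreement with the convention for \<open>K = {}\<close>.\<close>

lemma closedin_holomorphic_hull:
  assumes M: "complex_manifold M"
  shows "closedin (cm_top M) (holomorphic_hull M K)"
proof -
  define A where "A = {(f, b). holomorphic_fun M (cm_space M) f \<and> (\<forall>y\<in>K. cmod (f y) \<le> b)}"
  have eq: "holomorphic_hull M K = \<Inter> (insert (cm_space M) ((\<lambda>(f, b). {x \<in> cm_space M. f x \<in> cball 0 b}) ` A))"
    by (auto simp: holomorphic_hull_def A_def)
  have "closedin (cm_top M) {x \<in> cm_space M. f x \<in> cball 0 b}" if "(f, b) \<in> A" for f b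
    using holomorphic_fun_continuous[OF M openin_topspace, of f] that
    by (intro closedin_continuous_map_preimage[where Y = euclidean]) (auto simp: A_def)
  then show ?thesis
    unfolding eq by (intro closedin_Inter) (auto simp del: mem_cball)
qed

context factor
begin

lemma holomorphic_fun_pullback_space:
  assumes "holomorphic_fun M (cm_space M) f"
  shows "holomorphic_fun P (cm_space P) (\<lambda>p. f (pr p))"
proof -
  have "{p \<in> cm_space P. pr p \<in> cm_space M} = cm_space P"
    using pr_space by auto
  then show ?thesis
    using holomorphic_fun_pullback[OF openin_topspace assms] by simp
qed

text \<open>Functions pulled back from \<open>M\<close> are among the test functions on
  \<open>P\<close>.\<close>

lemma holomorphic_hull_pr: "p \<in> holomorphic_hull P K \<Longrightarrow> pr p \<in> holomorphic_hull M (pr ` K)"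
  using holomorphic_fun_pullback_space pr_space by (fastforce simp: holomorphic_hull_def)

text \<open>The hull of \<open>K\<close> is a closed subset of the product of the compact hulls of
  its projections. Distinct points differ in one factor and are separated there. For local
  coordinates the functions of both factors are combined, and their differentials form a block
  diagonal matrix.\<close>

lemma stein_factor:
  assumes SM: "stein_manifold M" and SN: "stein_manifold N"
  shows "stein_manifold P"
  unfolding stein_manifold_def
proof (intro conjI allI ballI impI P)
  interpret sw: factor N M P "\<lambda>y x. mk x y" qr pr "\<lambda>e d. cmb d e" oN oM
    by (rule swap)
  fix K assume K: "compactin (cm_top P) K"
  have "compactin (cm_top M) (holomorphic_hull M (pr ` K))" "compactin (cm_top N) (holomorphic_hull N (qr ` K))"
    using SM SN image_compactin[OF K cont_pr] image_compactin[OF K cont_qr] by (auto simp: stein_manifold_def)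
  then have "compactin (prod_topology (cm_top M) (cm_top N)) (holomorphic_hull M (pr ` K) \<times> holomorphic_hull N (qr ` K))"
    by (simp add: compactin_Times)
  then have "compactin (cm_top P) ((\<lambda>(x, y). mk x y) ` (holomorphic_hull M (pr ` K) \<times> holomorphic_hull N (qr ` K)))"
    using cont_mk by (rule image_compactin)
  moreover have "holomorphic_hull P K \<subseteq> (\<lambda>(x, y). mk x y) ` (holomorphic_hull M (pr ` K) \<times> holomorphic_hull N (qr ` K))"
  proof
    fix p assume "p \<in> holomorphic_hull P K"
    then have "(pr p, qr p) \<in> holomorphic_hull M (pr ` K) \<times> holomorphic_hull N (qr ` K)"
      using holomorphic_hull_pr sw.holomorphic_hull_pr by auto
    then show "p \<in> (\<lambda>(x, y). mk x y) ` (holomorphic_hull M (pr ` K) \<times> holomorphic_hull N (qr ` K))"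
      by (rule rev_image_eqI) simp
  qed
  ultimately show "compactin (cm_top P) (holomorphic_hull P K)"
    using closedin_holomorphic_hull[OF P] by (rule closed_compactin)
next
  interpret sw: factor N M P "\<lambda>y x. mk x y" qr pr "\<lambda>e d. cmb d e" oN oM
    by (rule swap)
  fix p q assume p: "p \<in> cm_space P" and q: "q \<in> cm_space P" and "p \<noteq> q"
  then have "pr p \<noteq> pr q \<or> qr p \<noteq> qr q"
    using mk_pr_qr by metis
  then show "\<exists>f. holomorphic_fun P (cm_space P) f \<and> f p \<noteq> f q"
  proof
    assume "pr p \<noteq> pr q"
    then obtain f where "holomorphic_fun M (cm_space M) f" "f (pr p) \<noteq> f (pr q)"
      using SM pr_space[OF p] pr_space[OF q] unfolding stein_manifold_def by blast
    then show ?thesis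
      using holomorphic_fun_pullback_space by blast
  next
    assume "qr p \<noteq> qr q"
    then obtain f where "holomorphic_fun N (cm_space N) f" "f (qr p) \<noteq> f (qr q)"
      using SN qr_space[OF p] qr_space[OF q] unfolding stein_manifold_def by blast
    then show ?thesis
      using sw.holomorphic_fun_pullback_space by blast
  qed
next
  interpret sw: factor N M P "\<lambda>y x. mk x y" qr pr "\<lambda>e d. cmb d e" oN oM
    by (rule swap)
  fix p assume p: "p \<in> cm_space P"
  have "\<exists>f :: nat \<Rightarrow> 'a \<Rightarrow> complex. (\<forall>j<cm_dim M. holomorphic_fun M (cm_space M) (f j)) \<and>
      (\<forall>d\<in>cm_atlas M. pr p \<in> fst d \<longrightarrow> (\<forall>a. (\<forall>i<cm_dim M. (\<Sum>j<cm_dim M. a j * chart_deriv d i (f j) (pr p)) = 0)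
        \<longrightarrow> (\<forall>j<cm_dim M. a j = 0)))"
    using SM pr_space[OF p] unfolding stein_manifold_def by blast
  then obtain f :: "nat \<Rightarrow> 'a \<Rightarrow> complex" where f: "\<forall>j<cm_dim M. holomorphic_fun M (cm_space M) (f j)"
    and f_ind: "\<forall>d\<in>cm_atlas M. pr p \<in> fst d \<longrightarrow> (\<forall>a. (\<forall>i<cm_dim M. (\<Sum>j<cm_dim M. a j * chart_deriv d i (f j) (pr p)) = 0)
        \<longrightarrow> (\<forall>j<cm_dim M. a j = 0))"
    by (elim exE conjE) (rule that)
  have "\<exists>g :: nat \<Rightarrow> 'b \<Rightarrow> complex. (\<forall>j<cm_dim N. holomorphic_fun N (cm_space N) (g j)) \<and>
      (\<forall>e\<in>cm_atlas N. qr p \<in> fst e \<longrightarrow> (\<forall>a. (\<forall>i<cm_dim N. (\<Sum>j<cm_dim N. a j * chart_deriv e i (g j) (qr p)) = 0)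
        \<longrightarrow> (\<forall>j<cm_dim N. a j = 0)))"
    using SN qr_space[OF p] unfolding stein_manifold_def by blast
  then obtain g :: "nat \<Rightarrow> 'b \<Rightarrow> complex" where g: "\<forall>j<cm_dim N. holomorphic_fun N (cm_space N) (g j)"
    and g_ind: "\<forall>e\<in>cm_atlas N. qr p \<in> fst e \<longrightarrow> (\<forall>a. (\<forall>i<cm_dim N. (\<Sum>j<cm_dim N. a j * chart_deriv e i (g j) (qr p)) = 0)
        \<longrightarrow> (\<forall>j<cm_dim N. a j = 0))"
    by (elim exE conjE) (rule that)
  define F where "F k = (if oM \<le> k \<and> k < oM + cm_dim M then (\<lambda>q. f (k - oM) (pr q)) else (\<lambda>q. g (k - oN) (qr q)))" for k
  have FM: "F (oM + i) = (\<lambda>q. f i (pr q))" if "i < cm_dim M" for i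
    using that by (simp add: F_def)
  have FN: "F (oN + i) = (\<lambda>q. g i (qr q))" if "i < cm_dim N" for i
    using indexN_not_M[OF that] unfolding F_def by (simp only: if_False diff_add_inverse)
  show "\<exists>F :: nat \<Rightarrow> 'c \<Rightarrow> complex. (\<forall>k<cm_dim P. holomorphic_fun P (cm_space P) (F k)) \<and>
      (\<forall>c\<in>cm_atlas P. p \<in> fst c \<longrightarrow> (\<forall>a. (\<forall>i<cm_dim P. (\<Sum>j<cm_dim P. a j * chart_deriv c i (F j) p) = 0)
        \<longrightarrow> (\<forall>j<cm_dim P. a j = 0)))"
  proof (intro exI[of _ F] conjI ballI allI impI)
    fix k assume "k < cm_dim P"
    then show "holomorphic_fun P (cm_space P) (F k)"
      using f g holomorphic_fun_pullback_space sw.holomorphic_fun_pullback_space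
      by (cases rule: index_cases) (simp_all add: FM FN)
  next
    fix c a k assume "c \<in> cm_atlas P" and pc: "p \<in> fst c"
      and a: "\<forall>i<cm_dim P. (\<Sum>j<cm_dim P. a j * chart_deriv c i (F j) p) = 0" and k: "k < cm_dim P"
    then obtain d e where c: "d \<in> cm_atlas M" "e \<in> cm_atlas N" "c = cmb d e"
      using atlas by auto
    have pd: "pr p \<in> fst d" "qr p \<in> fst e"
      using pc c(3) dom by auto
    note dM = chart_deriv_factor[OF c(1,2) pc[unfolded c(3)]]
    note dN = chart_deriv_other[OF c(1,2) pc[unfolded c(3)]]
    have "(\<Sum>j<cm_dim M. a (oM + j) * chart_deriv d i (f j) (pr p)) = 0" if "i < cm_dim M" for i
      using a[rule_format, OF indexM[OF that]] that by (simp add: c(3) dM sum_index FM FN) (simp add: chart_deriv_line)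
    then have M0: "\<forall>j<cm_dim M. a (oM + j) = 0"
      using f_ind[rule_format, OF c(1) pd(1), of "\<lambda>j. a (oM + j)"] by simp
    have "(\<Sum>j<cm_dim N. a (oN + j) * chart_deriv e i (g j) (qr p)) = 0" if "i < cm_dim N" for i
      using a[rule_format, OF indexN[OF that]] that by (simp add: c(3) dN sum_index FM FN) (simp add: chart_deriv_line)
    then have "\<forall>j<cm_dim N. a (oN + j) = 0"
      using g_ind[rule_format, OF c(2) pd(2), of "\<lambda>j. a (oN + j)"] by simp
    with M0 have "a k = 0" if "k = oM + i \<and> i < cm_dim M \<or> k = oN + i \<and> i < cm_dim N" for i
      using that by auto
    then show "a k = 0"
      using index_cases[OF k] by blast
  qed
qed

end

section \<open>Projective space and very ample bundles\<close>

lemma proj_point_self: "z \<in> proj_point z"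
  unfolding proj_point_def by (intro CollectI exI[of _ 1]) simp

lemma proj_point_scale:
  assumes "a \<noteq> 0"
  shows "proj_point (\<lambda>j. a * z j) = proj_point z"
proof (intro equalityI subsetI)
  fix w assume "w \<in> proj_point (\<lambda>j. a * z j)"
  then obtain b where "b \<noteq> 0" "w = (\<lambda>j. b * (a * z j))"
    by (auto simp: proj_point_def)
  then show "w \<in> proj_point z"
    unfolding proj_point_def using assms by (intro CollectI exI[of _ "b * a"]) (simp add: mult.assoc)
next
  fix w assume "w \<in> proj_point z"
  then obtain b where "b \<noteq> 0" "w = (\<lambda>j. b * z j)"
    by (auto simp: proj_point_def)
  then show "w \<in> proj_point (\<lambda>j. a * z j)"
    unfolding proj_point_def using assms by (intro CollectI exI[of _ "b / a"]) simp
qed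

lemma proj_point_eqD:
  assumes "proj_point z = proj_point w"
  obtains a where "a \<noteq> 0" "z = (\<lambda>j. a * w j)"
  using proj_point_self[of z] assms by (auto simp: proj_point_def)

lemma proj_coord_point:
  "proj_coord k (proj_point z) j = z (if j < k then j else Suc j) / z k"
proof -
  have "(SOME w. w \<in> proj_point z) \<in> proj_point z"
    by (rule someI[where P = "\<lambda>w. w \<in> proj_point z", OF proj_point_self])
  then obtain a where "a \<noteq> 0" "(SOME w. w \<in> proj_point z) = (\<lambda>j. a * z j)"
    by (auto simp: proj_point_def)
  then show ?thesis
    by (simp add: proj_coord_def Let_def)
qed

abbreviation "nonzero_vectors N \<equiv> Cn (Suc N) - {\<lambda>_. 0}"

lemma topspace_proj_topology: "topspace (proj_topology N) = proj_point ` nonzero_vectors N"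
proof -
  have "openin (proj_topology N) (proj_point ` nonzero_vectors N)"
    unfolding openin_proj_topology by (auto intro: back_subst[of "openin (top_of_set (nonzero_vectors N))", OF openin_subtopology_self])
  then show ?thesis
    using openin_subset[of "proj_topology N"] openin_topspace[of "proj_topology N"] openin_proj_topology by blast
qed

lemma continuous_map_proj_point: "continuous_map (top_of_set (nonzero_vectors N)) (proj_topology N) proj_point"
  unfolding continuous_map_def by (auto simp: topspace_proj_topology openin_proj_topology)

text \<open>The universal property of the quotient topology.\<close>

lemma continuous_map_from_proj_topology:
  fixes g :: "(nat \<Rightarrow> complex) set \<Rightarrow> 'b::topological_space"
  assumes "continuous_on (nonzero_vectors N) (\<lambda>z. g (proj_point z))"
  shows "continuous_map (proj_topology N) euclidean g"
  unfolding continuous_map_def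
proof (intro conjI allI impI)
  fix T :: "'b set" assume "openin euclidean T"
  then have "openin (top_of_set (nonzero_vectors N)) {z \<in> topspace (top_of_set (nonzero_vectors N)). g (proj_point z) \<in> T}"
    using assms by (intro openin_continuous_map_preimage[where Y = euclidean]) auto
  moreover have "{z \<in> nonzero_vectors N. proj_point z \<in> {L \<in> topspace (proj_topology N). g L \<in> T}} =
      {z \<in> topspace (top_of_set (nonzero_vectors N)). g (proj_point z) \<in> T}"
    by (auto simp: topspace_proj_topology)
  ultimately show "openin (proj_topology N) {L \<in> topspace (proj_topology N). g L \<in> T}"
    unfolding openin_proj_topology by (auto simp: topspace_proj_topology)
qed simp

text \<open>The functions \<open>z\<^sub>j cnj z\<^sub>k / |z|\<^sup>2\<close> are continuous and separate points.\<close>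

definition proj_matrix :: "nat \<Rightarrow> nat \<Rightarrow> nat \<Rightarrow> (nat \<Rightarrow> complex) set \<Rightarrow> complex"
  where "proj_matrix N j k L = (let z = (SOME z. z \<in> L) in z j * cnj (z k) / of_real (\<Sum>l\<le>N. (cmod (z l))\<^sup>2))"

lemma proj_matrix_point: "proj_matrix N j k (proj_point z) = z j * cnj (z k) / of_real (\<Sum>l\<le>N. (cmod (z l))\<^sup>2)"
proof -
  have "(SOME w. w \<in> proj_point z) \<in> proj_point z"
    by (rule someI[where P = "\<lambda>w. w \<in> proj_point z", OF proj_point_self])
  then obtain a where a: "a \<noteq> 0" "(SOME w. w \<in> proj_point z) = (\<lambda>j. a * z j)"
    by (auto simp: proj_point_def)
  have "(\<Sum>l\<le>N. (cmod (a * z l))\<^sup>2) = (cmod a)\<^sup>2 * (\<Sum>l\<le>N. (cmod (z l))\<^sup>2)"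
    by (simp add: norm_mult power_mult_distrib sum_distrib_left)
  moreover have "a * z j * cnj (a * z k) = of_real ((cmod a)\<^sup>2) * (z j * cnj (z k))"
    using complex_norm_square[of a] by (simp add: mult_ac)
  ultimately show ?thesis
    unfolding proj_matrix_def Let_def a(2) using a(1) by (simp only: of_real_mult) (simp add: mult_divide_mult_cancel_left)
qed

lemma sum_norm_squares_pos:
  assumes "z \<in> nonzero_vectors N"
  shows "0 < (\<Sum>l\<le>N. (cmod (z l))\<^sup>2)"
proof -
  obtain k where "z k \<noteq> 0"
    using assms by auto
  moreover from this have "k \<le> N"
    using assms by (auto simp: Cn_def not_less_eq_eq)
  ultimately show ?thesis
    by (intro sum_pos2[of _ k]) auto
qed

lemma continuous_map_proj_matrix: "continuous_map (proj_topology N) euclidean (proj_matrix N j k)"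
proof (rule continuous_map_from_proj_topology)
  have "continuous_on (nonzero_vectors N) (\<lambda>z. z i)" for i
    by (rule continuous_on_subset[OF continuous_on_product_coordinates subset_UNIV])
  then show "continuous_on (nonzero_vectors N) (\<lambda>z. proj_matrix N j k (proj_point z))"
    unfolding proj_matrix_point using sum_norm_squares_pos
    by (intro continuous_intros) (force simp del: of_real_sum)+
qed

lemma Hausdorff_proj_topology: "Hausdorff_space (proj_topology N)"
  unfolding Hausdorff_space_def
proof (intro allI impI, elim conjE)
  fix L L' assume L: "L \<in> topspace (proj_topology N)" "L' \<in> topspace (proj_topology N)" "L \<noteq> L'"
  then obtain z w where z: "z \<in> nonzero_vectors N" "L = proj_point z" and w: "w \<in> nonzero_vectors N" "L' = proj_point w"
    unfolding topspace_proj_topology by blast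
  have "\<exists>j k. proj_matrix N j k L \<noteq> proj_matrix N j k L'"
  proof (rule ccontr)
    assume "\<not> ?thesis"
    then have eq: "z j * cnj (z k) / of_real (\<Sum>l\<le>N. (cmod (z l))\<^sup>2) = w j * cnj (w k) / of_real (\<Sum>l\<le>N. (cmod (w l))\<^sup>2)" for j k
      by (simp add: z w proj_matrix_point del: of_real_sum)
    obtain k where k: "z k \<noteq> 0"
      using z by auto
    \<comment> \<open>The matrices \<open>z_j cnj z_k / |z|^2\<close> are the orthogonal projections
      onto the lines. Solving the equality of the two matrices for \<open>z j\<close>, in a column
      \<open>k\<close> with \<open>z k \<noteq> 0\<close>, exhibits \<open>z\<close> as a multiple
      of \<open>w\<close>.\<close>
    define a where "a = cnj (w k) / of_real (\<Sum>l\<le>N. (cmod (w l))\<^sup>2) * (of_real (\<Sum>l\<le>N. (cmod (z l))\<^sup>2) / cnj (z k))"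
    have za: "z j = a * w j" for j
    proof -
      define p q where "p = complex_of_real (\<Sum>l\<le>N. (cmod (z l))\<^sup>2)" and "q = complex_of_real (\<Sum>l\<le>N. (cmod (w l))\<^sup>2)"
      have "p \<noteq> 0"
        using sum_norm_squares_pos[OF z(1)] unfolding p_def by (simp del: of_real_sum)
      have "z j = z j * cnj (z k) / p * (p / cnj (z k))"
        using \<open>p \<noteq> 0\<close> k by simp
      also have "\<dots> = w j * cnj (w k) / q * (p / cnj (z k))"
        using eq[of j k] unfolding p_def q_def by (simp only:)
      finally show ?thesis
        by (simp add: a_def p_def[symmetric] q_def[symmetric] mult_ac del: of_real_sum)
    qed
    then have "a \<noteq> 0"
      using k by auto
    moreover have "z = (\<lambda>j. a * w j)"
      using za by auto
    ultimately show False
      using L(3) proj_point_scale[of a w] z(2) w(2) by simp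
  qed
  then obtain j k where "proj_matrix N j k L \<noteq> proj_matrix N j k L'"
    by blast
  from hausdorff[OF this] obtain U V where UV: "open U" "open V" "proj_matrix N j k L \<in> U" "proj_matrix N j k L' \<in> V" "U \<inter> V = {}"
    by (elim exE conjE) (rule that)
  let ?W = "\<lambda>U. {L \<in> topspace (proj_topology N). proj_matrix N j k L \<in> U}"
  have "openin (proj_topology N) (?W U)" "openin (proj_topology N) (?W V)"
    using UV by (auto intro!: openin_continuous_map_preimage[OF continuous_map_proj_matrix])
  then show "\<exists>U V. openin (proj_topology N) U \<and> openin (proj_topology N) V \<and> L \<in> U \<and> L' \<in> V \<and> disjnt U V"
    using UV L by (intro exI[of _ "?W U"] exI[of _ "?W V"]) (auto simp: disjnt_def)
qed

section \<open>Charts of projective space and families of sections\<close>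

definition proj_chart :: "nat \<Rightarrow> nat \<Rightarrow> (nat \<Rightarrow> complex) set chart"
  where "proj_chart N k = (proj_point ` {z \<in> Cn (Suc N). z k \<noteq> 0}, proj_coord k)"

lemma projective_space_simps:
  "cm_top (projective_space N) = proj_topology N" "cm_dim (projective_space N) = N"
  "cm_atlas (projective_space N) = proj_chart N ` {..N}"
  by (auto simp: projective_space_def proj_chart_def)

lemma proj_chart_dom:
  assumes "z \<in> nonzero_vectors N"
  shows "proj_point z \<in> fst (proj_chart N k) \<longleftrightarrow> z k \<noteq> 0"
proof
  assume "proj_point z \<in> fst (proj_chart N k)"
  then obtain w where "proj_point z = proj_point w" "w k \<noteq> 0"
    by (auto simp: proj_chart_def)
  then show "z k \<noteq> 0"
    by (metis proj_point_eqD mult_eq_0_iff)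
qed (use assms in \<open>auto simp: proj_chart_def\<close>)

lemma openin_proj_chart: "openin (proj_topology N) (fst (proj_chart N k))"
  unfolding openin_proj_topology
proof
  show "fst (proj_chart N k) \<subseteq> proj_point ` nonzero_vectors N"
    by (auto simp: proj_chart_def)
  have "open {z :: nat \<Rightarrow> complex. z k \<noteq> 0}"
    by (intro open_Collect_neq continuous_on_product_coordinates continuous_on_const)
  then have "openin (top_of_set (nonzero_vectors N)) (nonzero_vectors N \<inter> {z. z k \<noteq> 0})"
    by blast
  moreover have "{z \<in> nonzero_vectors N. proj_point z \<in> fst (proj_chart N k)} = nonzero_vectors N \<inter> {z. z k \<noteq> 0}"
    using proj_chart_dom by blast
  ultimately show "openin (top_of_set (nonzero_vectors N)) {z \<in> nonzero_vectors N. proj_point z \<in> fst (proj_chart N k)}"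
    by simp
qed

text \<open>In homogeneous coordinates, a tangent vector is in the kernel of the differential of \<open>[s\<^sub>0 : \<dots> : s\<^sub>N]\<close>
  if it maps the vector of sections to one of its multiples.\<close>

definition projective_family :: "'a cmfd \<Rightarrow> ('i, 'a) line_bundle \<Rightarrow> 'k set \<Rightarrow> ('k \<Rightarrow> 'i \<Rightarrow> 'a \<Rightarrow> complex) \<Rightarrow> bool"
  where "projective_family M E K s \<longleftrightarrow>
    (\<forall>m\<in>K. holomorphic_section M E (s m)) \<and>
    (\<forall>i\<in>lb_index E. \<forall>x\<in>lb_dom E i. \<exists>m\<in>K. s m i x \<noteq> 0) \<and>
    (\<forall>i\<in>lb_index E. \<forall>j\<in>lb_index E. \<forall>x\<in>lb_dom E i. \<forall>y\<in>lb_dom E j. \<forall>a.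
      a \<noteq> 0 \<and> (\<forall>m\<in>K. s m i x = a * s m j y) \<longrightarrow> x = y) \<and>
    (\<forall>i\<in>lb_index E. \<forall>c\<in>cm_atlas M. \<forall>x\<in>fst c \<inter> lb_dom E i. \<forall>\<xi> \<mu>.
      (\<forall>m\<in>K. (\<Sum>k<cm_dim M. \<xi> k * chart_deriv c k (s m i) x) = \<mu> * s m i x) \<longrightarrow> (\<forall>k<cm_dim M. \<xi> k = 0))"

lemma projective_family_reindex:
  assumes "projective_family M E K s" "bij_betw h L K"
  shows "projective_family M E L (\<lambda>m. s (h m))"
proof -
  have K: "K = h ` L"
    using assms(2) by (auto simp: bij_betw_def)
  show ?thesis
    using assms(1) unfolding K projective_family_def by simp
qed

text \<open>Powers and Segre products of families are indexed by pairs, whereas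
  \<open>very_ample\<close> numbers the sections by an initial segment of the naturals.\<close>

lemma projective_family_nat:
  fixes K :: "'k set"
  assumes "projective_family M E K s" "finite K" "K \<noteq> {}"
  shows "\<exists>(N :: nat) s'. projective_family M E {..N} s'"
proof -
  obtain N where "card K = Suc N"
    using assms(2,3) by (cases "card K") auto
  then obtain h where "bij_betw h {..N} K"
    using ex_bij_betw_nat_finite[OF assms(2)] by (auto simp: atLeast0LessThan lessThan_Suc_atMost)
  then show ?thesis
    using projective_family_reindex[OF assms(1)] by blast
qed

section \<open>Maps to projective space given by sections\<close>

context
  fixes M :: "'a cmfd" and E :: "('i, 'a) line_bundle"
  assumes M: "complex_manifold M" and E: "holomorphic_line_bundle M E"
begin

lemma lb_dom_open: "i \<in> lb_index E \<Longrightarrow> openin (cm_top M) (lb_dom E i)"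
  using E by (simp add: holomorphic_line_bundle_def)

lemma lb_dom_around:
  assumes "x \<in> cm_space M"
  obtains i where "i \<in> lb_index E" "x \<in> lb_dom E i"
proof -
  have "x \<in> (\<Union>i\<in>lb_index E. lb_dom E i)"
    using assms E by (simp add: holomorphic_line_bundle_def)
  then show ?thesis
    by (rule UN_E) (rule that)
qed

lemma section_chart_diff:
  assumes "holomorphic_section M E s" "i \<in> lb_index E" "c \<in> cm_atlas M" "x \<in> fst c" "x \<in> lb_dom E i" "k < cm_dim M"
  shows "chart_diff c k (s i) x"
  using assms holomorphic_fun_chart_diff[OF M lb_dom_open] by (auto simp: holomorphic_section_def)

context
  fixes N :: nat and s :: "nat \<Rightarrow> 'i \<Rightarrow> 'a \<Rightarrow> complex" and f :: "'a \<Rightarrow> (nat \<Rightarrow> complex) set"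
  assumes sec: "\<And>m. m \<le> N \<Longrightarrow> holomorphic_section M E (s m)"
    and nz: "\<And>i x. i \<in> lb_index E \<Longrightarrow> x \<in> lb_dom E i \<Longrightarrow> \<exists>m\<le>N. s m i x \<noteq> 0"
    and f: "\<And>i x. i \<in> lb_index E \<Longrightarrow> x \<in> lb_dom E i \<Longrightarrow> f x = proj_point (\<lambda>m. if m \<le> N then s m i x else 0)"
begin

lemma section_vector_nonzero:
  "i \<in> lb_index E \<Longrightarrow> x \<in> lb_dom E i \<Longrightarrow> (\<lambda>m. if m \<le> N then s m i x else 0) \<in> nonzero_vectors N"
  using nz by (force simp: Cn_def fun_eq_iff)

lemma proj_map_dom:
  assumes "i \<in> lb_index E" "x \<in> lb_dom E i" "k \<le> N"
  shows "f x \<in> fst (proj_chart N k) \<longleftrightarrow> s k i x \<noteq> 0"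
  using proj_chart_dom[OF section_vector_nonzero[OF assms(1,2)], of k] assms by (simp add: f)

lemma proj_map_coord:
  assumes "i \<in> lb_index E" "x \<in> lb_dom E i" "k \<le> N" "j < N"
  shows "proj_coord k (f x) j = s (if j < k then j else Suc j) i x / s k i x"
  using assms by (simp add: f proj_coord_point)

lemma continuous_proj_map: "continuous_map (cm_top M) (proj_topology N) f"
proof (rule continuous_map_locally)
  fix x assume "x \<in> cm_space M"
  then obtain i where i: "i \<in> lb_index E" "x \<in> lb_dom E i"
    using lb_dom_around by blast
  have "continuous_map (subtopology (cm_top M) (lb_dom E i)) euclidean (\<lambda>x. if m \<le> N then s m i x else 0)" for m
    using sec[of m] i(1) holomorphic_fun_continuous[OF M lb_dom_open[OF i(1)]] by (cases "m \<le> N") (auto simp: holomorphic_section_def)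
  then have "continuous_map (subtopology (cm_top M) (lb_dom E i)) (product_topology (\<lambda>m. euclidean) UNIV)
      (\<lambda>x m. if m \<le> N then s m i x else 0)"
    by (simp add: continuous_map_componentwise_UNIV)
  then have "continuous_map (subtopology (cm_top M) (lb_dom E i)) (top_of_set (nonzero_vectors N)) (\<lambda>x m. if m \<le> N then s m i x else 0)"
    using section_vector_nonzero[OF i(1)] unfolding euclidean_product_topology
    by (auto simp: continuous_map_in_subtopology)
  from continuous_map_compose[OF this continuous_map_proj_point]
  have "continuous_map (subtopology (cm_top M) (lb_dom E i)) (proj_topology N) f"
    by (rule continuous_map_eq) (use f[OF i(1)] in auto)
  then show "\<exists>T. openin (cm_top M) T \<and> x \<in> T \<and> continuous_map (subtopology (cm_top M) T) (proj_topology N) f"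
    using i lb_dom_open by blast
qed

lemma openin_proj_map_chart: "openin (cm_top M) {x \<in> cm_space M. f x \<in> fst (proj_chart N k)}"
  by (rule openin_continuous_map_preimage[OF continuous_proj_map openin_proj_chart])

lemma holomorphic_proj_map: "holomorphic_map M (projective_space N) f"
  unfolding holomorphic_map_def projective_space_simps case_prod_beta
proof (intro conjI ballI allI impI continuous_proj_map)
  fix c j assume "c \<in> proj_chart N ` {..N}" and j: "j < N"
  then obtain k where k: "k \<le> N" "c = proj_chart N k"
    by auto
  let ?S = "{x \<in> cm_space M. f x \<in> fst (proj_chart N k)}"
  have "holomorphic_fun M ?S (\<lambda>x. proj_coord k (f x) j)"
  proof (rule holomorphic_fun_locally[OF M openin_proj_map_chart])
    fix x assume x: "x \<in> ?S"
    then obtain i where i: "i \<in> lb_index E" "x \<in> lb_dom E i"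
      using lb_dom_around by blast
    define j' where "j' = (if j < k then j else Suc j)"
    have j': "j' \<le> N"
      using j by (auto simp: j'_def)
    have oT: "openin (cm_top M) (?S \<inter> lb_dom E i)"
      using openin_proj_map_chart lb_dom_open[OF i(1)] by (rule openin_Int)
    have hol: "holomorphic_fun M (?S \<inter> lb_dom E i) (s m i)" if "m \<le> N" for m
      using sec[OF that] i(1) by (intro holomorphic_fun_subset[OF M _ lb_dom_open[OF i(1)] oT]) (auto simp: holomorphic_section_def)
    have "holomorphic_fun M (?S \<inter> lb_dom E i) (\<lambda>x. s j' i x / s k i x)"
      using proj_map_dom[OF i(1) _ k(1)] by (intro holomorphic_fun_divide[OF M oT] hol j' k) auto
    moreover have "\<forall>y\<in>(?S \<inter> lb_dom E i) \<inter> ?S. proj_coord k (f y) j = s j' i y / s k i y"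
      using proj_map_coord[OF i(1) _ k(1) j] by (simp add: j'_def)
    ultimately show "\<exists>T g. openin (cm_top M) T \<and> x \<in> T \<and> holomorphic_fun M T g \<and> (\<forall>y\<in>T \<inter> ?S. proj_coord k (f y) j = g y)"
      using oT x i(2) by blast
  qed
  then show "holomorphic_fun M {x \<in> cm_space M. f x \<in> fst c} (\<lambda>x. snd c (f x) j)"
    by (simp add: k(2) proj_chart_def)
qed

lemma proj_map_deriv:
  assumes i: "i \<in> lb_index E" and x: "x \<in> lb_dom E i" "x \<in> fst c" and c: "c \<in> cm_atlas M" and k: "k \<le> N" "s k i x \<noteq> 0"
    and j: "j < N" and l: "l < cm_dim M"
  defines "j' \<equiv> if j < k then j else Suc j"
  shows "chart_deriv c l (\<lambda>y. proj_coord k (f y) j) x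
    = (chart_deriv c l (s j' i) x * s k i x - s j' i x * chart_deriv c l (s k i) x) / (s k i x)\<^sup>2"
proof -
  have j': "j' \<le> N"
    using j by (auto simp: j'_def)
  have "chart_deriv c l (\<lambda>y. proj_coord k (f y) j) x = chart_deriv c l (\<lambda>y. s j' i y / s k i y) x"
    using proj_map_coord[OF i _ k(1) j]
    by (intro chart_deriv_cong[OF M c x(2) x(1) lb_dom_open[OF i] l]) (simp add: j'_def)
  also have "\<dots> = (chart_deriv c l (s j' i) x * s k i x - s j' i x * chart_deriv c l (s k i) x) / (s k i x)\<^sup>2"
    using section_chart_diff[OF sec i c x(2,1) l] j' k by (intro chart_deriv_divide[OF M c x(2)]) auto
  finally show ?thesis .
qed

text \<open>By the quotient rule, the derivative of \<open>s m / s k\<close> along \<xi> vanishes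
  exactly if \<open>D s_m * s_k = s_m * D s_k\<close>. Over all \<open>m\<close> this says that the
  derivative of the vector of sections is \<mu> times the vector itself, with \<mu> the logarithmic
  derivative of \<open>s k\<close>.\<close>

lemma immersion_iff:
  "holomorphic_immersion M (projective_space N) f \<longleftrightarrow>
    (\<forall>i\<in>lb_index E. \<forall>c\<in>cm_atlas M. \<forall>x\<in>fst c \<inter> lb_dom E i. \<forall>\<xi> \<mu>.
      (\<forall>m\<in>{..N}. (\<Sum>k<cm_dim M. \<xi> k * chart_deriv c k (s m i) x) = \<mu> * s m i x) \<longrightarrow> (\<forall>k<cm_dim M. \<xi> k = 0))"
    (is "?L \<longleftrightarrow> ?R")
proof
  assume ?L
  then have imm: "\<And>c b x \<xi>. c \<in> cm_atlas M \<Longrightarrow> b \<in> proj_chart N ` {..N} \<Longrightarrow> x \<in> fst c \<Longrightarrow> f x \<in> fst b \<Longrightarrow>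
      (\<forall>j<N. (\<Sum>l<cm_dim M. \<xi> l * chart_deriv c l (\<lambda>y. snd b (f y) j) x) = 0) \<Longrightarrow> (\<forall>l<cm_dim M. \<xi> l = 0)"
    unfolding holomorphic_immersion_def projective_space_simps case_prod_beta prod.collapse by blast
  show ?R
  proof (intro ballI allI impI)
    fix i c x \<xi> \<mu> l
    assume i: "i \<in> lb_index E" and c: "c \<in> cm_atlas M" and x: "x \<in> fst c \<inter> lb_dom E i"
      and D: "\<forall>m\<in>{..N}. (\<Sum>k<cm_dim M. \<xi> k * chart_deriv c k (s m i) x) = \<mu> * s m i x" and l: "l < cm_dim M"
    obtain k where k: "k \<le> N" "s k i x \<noteq> 0"
      using nz[OF i] x by blast
    have "(\<Sum>l<cm_dim M. \<xi> l * chart_deriv c l (\<lambda>y. snd (proj_chart N k) (f y) j) x) = 0" if j: "j < N" for j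
    proof -
      define j' where "j' = (if j < k then j else Suc j)"
      have j': "j' \<le> N"
        using j by (auto simp: j'_def)
      have "(\<Sum>l<cm_dim M. \<xi> l * chart_deriv c l (\<lambda>y. proj_coord k (f y) j) x)
          = (\<Sum>l<cm_dim M. \<xi> l * ((chart_deriv c l (s j' i) x * s k i x - s j' i x * chart_deriv c l (s k i) x) / (s k i x)\<^sup>2))"
        using x by (intro sum.cong refl) (simp add: proj_map_deriv[OF i _ _ c k j] j'_def)
      also have "\<dots> = ((\<Sum>l<cm_dim M. \<xi> l * chart_deriv c l (s j' i) x) * s k i x
          - s j' i x * (\<Sum>l<cm_dim M. \<xi> l * chart_deriv c l (s k i) x)) / (s k i x)\<^sup>2"
        unfolding sum_distrib_right sum_distrib_left sum_subtractf[symmetric] sum_divide_distrib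
        by (intro sum.cong refl) (simp add: right_diff_distrib mult_ac)
      also have "\<dots> = 0"
        using D j' k by simp
      finally show ?thesis
        by (simp add: proj_chart_def)
    qed
    moreover have "f x \<in> fst (proj_chart N k)"
      using proj_map_dom[OF i _ k(1)] x k by simp
    ultimately show "\<xi> l = 0"
      using imm[OF c, of "proj_chart N k" x \<xi>] x k l by simp
  qed
next
  assume R: ?R
  show ?L
    unfolding holomorphic_immersion_def projective_space_simps case_prod_beta prod.collapse
  proof (intro conjI ballI impI allI holomorphic_proj_map)
    fix c b x \<xi> l
    assume c: "c \<in> cm_atlas M" and "b \<in> proj_chart N ` {..N}" and x: "x \<in> fst c" "f x \<in> fst b"
      and D: "\<forall>j<N. (\<Sum>l<cm_dim M. \<xi> l * chart_deriv c l (\<lambda>y. snd b (f y) j) x) = 0" and l: "l < cm_dim M"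
    then obtain k where k: "k \<le> N" "b = proj_chart N k"
      by auto
    have "x \<in> cm_space M"
      using x chart_subset[OF M c] by blast
    then obtain i where i: "i \<in> lb_index E" "x \<in> lb_dom E i"
      using lb_dom_around by blast
    have sk: "s k i x \<noteq> 0"
      using proj_map_dom[OF i k(1)] x k by simp
    define \<mu> where "\<mu> = (\<Sum>l<cm_dim M. \<xi> l * chart_deriv c l (s k i) x) / s k i x"
    have "(\<Sum>l<cm_dim M. \<xi> l * chart_deriv c l (s m i) x) = \<mu> * s m i x" if m: "m \<le> N" for m
    proof (cases "m = k")
      case True
      then show ?thesis using sk by (simp add: \<mu>_def)
    next
      case False
      \<comment> \<open>Inverts the index shift of \<open>proj_coord\<close>, which omits the entry
        \<open>k\<close>.\<close>
      define j where "j = (if m < k then m else m - 1)"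
      have j: "j < N" "(if j < k then j else Suc j) = m"
        using False m k by (auto simp: j_def)
      have "0 = (\<Sum>l<cm_dim M. \<xi> l * chart_deriv c l (\<lambda>y. proj_coord k (f y) j) x)"
        using D j by (simp add: k(2) proj_chart_def)
      also have "\<dots> = (\<Sum>l<cm_dim M. \<xi> l * ((chart_deriv c l (s m i) x * s k i x - s m i x * chart_deriv c l (s k i) x) / (s k i x)\<^sup>2))"
        using proj_map_deriv[OF i x(1) c k(1) sk j(1)] by (intro sum.cong refl) (simp add: j(2))
      also have "\<dots> = ((\<Sum>l<cm_dim M. \<xi> l * chart_deriv c l (s m i) x) * s k i x
          - s m i x * (\<Sum>l<cm_dim M. \<xi> l * chart_deriv c l (s k i) x)) / (s k i x)\<^sup>2"
        unfolding sum_distrib_right sum_distrib_left sum_subtractf[symmetric] sum_divide_distrib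
        by (intro sum.cong refl) (simp add: right_diff_distrib mult_ac)
      finally have "(\<Sum>l<cm_dim M. \<xi> l * chart_deriv c l (s m i) x) * s k i x
          = s m i x * (\<Sum>l<cm_dim M. \<xi> l * chart_deriv c l (s k i) x)"
        using sk by simp
      then show ?thesis
        using sk by (simp add: \<mu>_def nonzero_eq_divide_eq mult.commute)
    qed
    then show "\<xi> l = 0"
      using R[rule_format, of i c x \<xi> \<mu> l] i c x l by simp
  qed
qed

lemma inj_iff:
  "inj_on f (cm_space M) \<longleftrightarrow>
    (\<forall>i\<in>lb_index E. \<forall>j\<in>lb_index E. \<forall>x\<in>lb_dom E i. \<forall>y\<in>lb_dom E j. \<forall>a.
      a \<noteq> 0 \<and> (\<forall>m\<in>{..N}. s m i x = a * s m j y) \<longrightarrow> x = y)" (is "?L \<longleftrightarrow> ?R")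
proof
  assume ?L
  show ?R
  proof (intro ballI allI impI, elim conjE)
    fix i j x y a
    assume ij: "i \<in> lb_index E" "j \<in> lb_index E" and xy: "x \<in> lb_dom E i" "y \<in> lb_dom E j"
      and a: "a \<noteq> 0" "\<forall>m\<in>{..N}. s m i x = a * s m j y"
    have "(\<lambda>m. if m \<le> N then s m i x else 0) = (\<lambda>m. a * (if m \<le> N then s m j y else 0))"
      using a by auto
    then have "f x = f y"
      using proj_point_scale[OF a(1), of "\<lambda>m. if m \<le> N then s m j y else 0"] ij xy by (simp add: f)
    moreover have "x \<in> cm_space M" "y \<in> cm_space M"
      using openin_subset[OF lb_dom_open] ij xy by blast+
    ultimately show "x = y"
      using \<open>?L\<close> by (auto dest: inj_onD)
  qed
next
  assume R: ?R
  show ?L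
  proof (rule inj_onI)
    fix x y assume "x \<in> cm_space M" "y \<in> cm_space M" and eq: "f x = f y"
    then obtain i j where ij: "i \<in> lb_index E" "j \<in> lb_index E" and xy: "x \<in> lb_dom E i" "y \<in> lb_dom E j"
      by (meson lb_dom_around)
    have "proj_point (\<lambda>m. if m \<le> N then s m i x else 0) = proj_point (\<lambda>m. if m \<le> N then s m j y else 0)"
      using eq f[OF ij(1) xy(1)] f[OF ij(2) xy(2)] by simp
    then obtain a where a: "a \<noteq> 0" "(\<lambda>m. if m \<le> N then s m i x else 0) = (\<lambda>m. a * (if m \<le> N then s m j y else 0))"
      by (rule proj_point_eqD)
    have "s m i x = a * s m j y" if "m \<le> N" for m
      using fun_cong[OF a(2), of m] that by simp
    then show "x = y"
      using R[rule_format, OF ij xy, of a] a(1) by simp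
  qed
qed

end

text \<open>An injective continuous map from a compact space to a Hausdorff space is closed and
  hence an embedding. Being an embedding therefore amounts to separation of points and of tangent
  vectors by the sections.\<close>

lemma very_ample_iff:
  assumes compact: "compact_space (cm_top M)"
  shows "very_ample M E \<longleftrightarrow> (\<exists>(N :: nat) s. projective_family M E {..N} s)"
proof
  assume "very_ample M E"
  then obtain N s f where sec': "\<forall>m\<le>N. holomorphic_section M E (s m)"
    and nz': "\<forall>i\<in>lb_index E. \<forall>x\<in>lb_dom E i. \<exists>m\<le>N. s m i x \<noteq> 0"
    and f': "\<forall>i\<in>lb_index E. \<forall>x\<in>lb_dom E i. f x = proj_point (\<lambda>m. if m \<le> N then s m i x else 0)"
    and emb: "holomorphic_embedding M (projective_space N) f"
    unfolding very_ample_def by (elim exE conjE) (rule that)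
  note sec = sec'[rule_format] and nz = nz'[rule_format] and f = f'[rule_format]
  have "inj_on f (cm_space M)"
    using emb by (auto simp: holomorphic_embedding_def embedding_map_def dest: homeomorphic_imp_injective_map)
  note inj = iffD1[OF inj_iff[OF sec nz f] this]
  have "holomorphic_immersion M (projective_space N) f"
    using emb by (simp add: holomorphic_embedding_def)
  note imm = iffD1[OF immersion_iff[OF sec nz f] this]
  have "projective_family M E {..N} s"
    unfolding projective_family_def
  proof (intro conjI)
    show "\<forall>m\<in>{..N}. holomorphic_section M E (s m)"
      using sec by simp
    show "\<forall>i\<in>lb_index E. \<forall>x\<in>lb_dom E i. \<exists>m\<in>{..N}. s m i x \<noteq> 0"
      using nz by (simp add: Bex_def)
  qed (rule inj imm; assumption)+
  then show "\<exists>(N :: nat) s. projective_family M E {..N} s"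
    by (intro exI)
next
  assume "\<exists>(N :: nat) s. projective_family M E {..N} s"
  then obtain N :: nat and s where fam: "projective_family M E {..N} s"
    by (elim exE) (rule that)
  have sec: "holomorphic_section M E (s m)" if "m \<le> N" for m
    using that fam[unfolded projective_family_def, THEN conjunct1] by simp
  have nz: "\<exists>m\<le>N. s m i x \<noteq> 0" if "i \<in> lb_index E" "x \<in> lb_dom E i" for i x
    using fam[unfolded projective_family_def, THEN conjunct2, THEN conjunct1] that by auto
  \<comment> \<open>Some trivialisation around \<open>x\<close> is chosen. Another one multiplies
    the vector of sections by a nonzero transition factor and leaves its line unchanged.\<close>
  define f where "f x = proj_point (\<lambda>m. if m \<le> N then s m (SOME i. i \<in> lb_index E \<and> x \<in> lb_dom E i) x else 0)" for x
  have f: "f x = proj_point (\<lambda>m. if m \<le> N then s m i x else 0)" if i: "i \<in> lb_index E" "x \<in> lb_dom E i" for i x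
  proof -
    define j where "j = (SOME i. i \<in> lb_index E \<and> x \<in> lb_dom E i)"
    have j: "j \<in> lb_index E" "x \<in> lb_dom E j"
      using someI[of "\<lambda>i. i \<in> lb_index E \<and> x \<in> lb_dom E i" i] i by (auto simp: j_def)
    have trans: "s m j x = lb_trans E j i x * s m i x" if "m \<le> N" for m
      using conjunct2[OF sec[OF that, unfolded holomorphic_section_def]] i j by blast
    have vec: "(\<lambda>m. if m \<le> N then s m j x else 0) = (\<lambda>m. lb_trans E j i x * (if m \<le> N then s m i x else 0))"
    proof
      fix m
      show "(if m \<le> N then s m j x else 0) = lb_trans E j i x * (if m \<le> N then s m i x else 0)"
        by (cases "m \<le> N") (simp_all only: trans if_True if_False mult_zero_right)
    qed
    have "lb_trans E j i x \<noteq> 0"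
      using E i j by (auto simp: holomorphic_line_bundle_def)
    then show ?thesis
      unfolding f_def j_def[symmetric] vec by (rule proj_point_scale)
  qed
  have "inj_on f (cm_space M)"
    by (rule iffD2[OF inj_iff[where N = N and s = s]], erule sec, erule (1) nz, erule (1) f,
      rule fam[unfolded projective_family_def, THEN conjunct2, THEN conjunct2, THEN conjunct1])
  moreover have "holomorphic_immersion M (projective_space N) f"
    by (rule iffD2[OF immersion_iff[where N = N and s = s]], erule sec, erule (1) nz, erule (1) f,
      rule fam[unfolded projective_family_def, THEN conjunct2, THEN conjunct2, THEN conjunct2])
  moreover have "continuous_map (cm_top M) (proj_topology N) f"
    by (rule continuous_proj_map[where N = N and s = s], erule sec, erule (1) nz, erule (1) f)
  moreover from this have "closed_map (cm_top M) (proj_topology N) f"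
    by (intro T1_Spaces.continuous_imp_closed_map compact Hausdorff_proj_topology)
  ultimately have emb: "holomorphic_embedding M (projective_space N) f"
    by (simp add: holomorphic_embedding_def projective_space_simps injective_closed_imp_embedding_map)
  show "very_ample M E"
    unfolding very_ample_def
    by (rule exI[of _ N], rule exI[of _ s], rule exI[of _ f], intro conjI allI impI ballI,
      erule sec, erule (1) nz, erule (1) f, rule emb)
qed

end

section \<open>Segre embeddings and external tensor products\<close>

text \<open>\<open>s\<^sub>a s\<^sub>b\<^sup>t\<^sup>-\<^sup>1\<close>: the second factor has no common zeros, which makes it harmless.\<close>

lemma projective_family_power:
  assumes M: "complex_manifold M" and E: "holomorphic_line_bundle M (lb_power k E)"
    and s: "projective_family M (lb_power k E) K s" and t: "0 < t"
  shows "projective_family M (lb_power (k * t) E) (K \<times> K) (\<lambda>(a, b) i x. s a i x * s b i x ^ (t - 1))"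
proof -
  define \<sigma> where "\<sigma> = (\<lambda>(a, b) i x. s a i x * s b i x ^ (t - 1))"
  have simps [simp]: "lb_index (lb_power l E) = lb_index E" "lb_dom (lb_power l E) = lb_dom E" for l
    by (simp_all add: lb_power_def)
  have op: "openin (cm_top M) (lb_dom E i)" if "i \<in> lb_index E" for i
    using lb_dom_open[OF M E] that by simp
  have sec: "holomorphic_section M (lb_power k E) (s a)" if "a \<in> K" for a
    using s[unfolded projective_family_def, THEN conjunct1] that by blast
  have hol: "holomorphic_fun M (lb_dom E i) (s a i)" if "a \<in> K" "i \<in> lb_index E" for a i
    using sec[OF that(1)] that(2) by (simp add: holomorphic_section_def)
  have trans: "s a i x = lb_trans E i j x ^ k * s a j x" if "a \<in> K" "i \<in> lb_index E" "j \<in> lb_index E" "x \<in> lb_dom E i" "x \<in> lb_dom E j" for a i j x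
  proof -
    have "s a i x = lb_trans (lb_power k E) i j x * s a j x"
      by (rule conjunct2[OF sec[OF that(1), unfolded holomorphic_section_def], rule_format]) (use that in simp_all)
    then show ?thesis
      by (simp add: lb_power_def)
  qed
  have nz: "\<exists>a\<in>K. s a i x \<noteq> 0" if "i \<in> lb_index E" "x \<in> lb_dom E i" for i x
    by (rule s[unfolded projective_family_def, THEN conjunct2, THEN conjunct1, rule_format]) (use that in simp_all)
  have sep: "x = y" if "i \<in> lb_index E" "j \<in> lb_index E" "x \<in> lb_dom E i" "y \<in> lb_dom E j" "a \<noteq> 0" "\<forall>m\<in>K. s m i x = a * s m j y" for i j x y a
    by (rule s[unfolded projective_family_def, THEN conjunct2, THEN conjunct2, THEN conjunct1, rule_format]) (use that in \<open>simp_all\<close>)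
  note imm = s[unfolded projective_family_def, THEN conjunct2, THEN conjunct2, THEN conjunct2]
  show ?thesis
    unfolding \<sigma>_def[symmetric] projective_family_def simps
  proof (intro conjI)
    show "\<forall>m\<in>K \<times> K. holomorphic_section M (lb_power (k * t) E) (\<sigma> m)"
      unfolding holomorphic_section_def simps
    proof (intro ballI conjI)
      fix m i assume m: "m \<in> K \<times> K" and i: "i \<in> lb_index E"
      show "holomorphic_fun M (lb_dom E i) (\<sigma> m i)"
        using m hol[OF _ i] op[OF i]
        by (auto simp: \<sigma>_def intro!: holomorphic_fun_mult[OF M] holomorphic_fun_power[OF M])
    next
      fix m i j x assume m: "m \<in> K \<times> K" and ij: "i \<in> lb_index E" "j \<in> lb_index E" and x: "x \<in> lb_dom E i \<inter> lb_dom E j"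
      obtain a b where ab: "m = (a, b)" "a \<in> K" "b \<in> K"
        using m by auto
      have "\<sigma> m i x = (lb_trans E i j x ^ k * s a j x) * (lb_trans E i j x ^ k * s b j x) ^ (t - 1)"
        using trans[OF ab(2) ij, of x] trans[OF ab(3) ij, of x] x by (simp add: \<sigma>_def ab(1))
      also have "\<dots> = (lb_trans E i j x ^ k * (lb_trans E i j x ^ k) ^ (t - 1)) * \<sigma> m j x"
        by (simp add: \<sigma>_def ab(1) power_mult_distrib mult_ac)
      also have "lb_trans E i j x ^ k * (lb_trans E i j x ^ k) ^ (t - 1) = (lb_trans E i j x ^ k) ^ t"
        using t by (metis power_eq_if not_gr_zero)
      also have "\<dots> = lb_trans E i j x ^ (k * t)"
        by (simp add: power_mult)
      finally show "\<sigma> m i x = lb_trans (lb_power (k * t) E) i j x * \<sigma> m j x"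
        by (simp add: lb_power_def)
    qed
    show "\<forall>i\<in>lb_index E. \<forall>x\<in>lb_dom E i. \<exists>m\<in>K \<times> K. \<sigma> m i x \<noteq> 0"
    proof (intro ballI)
      fix i x assume "i \<in> lb_index E" "x \<in> lb_dom E i"
      then obtain a where "a \<in> K" "s a i x \<noteq> 0"
        using nz by blast
      then show "\<exists>m\<in>K \<times> K. \<sigma> m i x \<noteq> 0"
        by (intro bexI[of _ "(a, a)"]) (simp_all add: \<sigma>_def)
    qed
    show "\<forall>i\<in>lb_index E. \<forall>j\<in>lb_index E. \<forall>x\<in>lb_dom E i. \<forall>y\<in>lb_dom E j. \<forall>a.
        a \<noteq> 0 \<and> (\<forall>m\<in>K \<times> K. \<sigma> m i x = a * \<sigma> m j y) \<longrightarrow> x = y"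
    proof (intro ballI allI impI, elim conjE)
      fix i j x y \<alpha>
      assume ij: "i \<in> lb_index E" "j \<in> lb_index E" and xy: "x \<in> lb_dom E i" "y \<in> lb_dom E j"
        and "\<alpha> \<noteq> 0" and eq: "\<forall>m\<in>K \<times> K. \<sigma> m i x = \<alpha> * \<sigma> m j y"
      obtain b where b: "b \<in> K" "s b i x \<noteq> 0"
        using nz[OF ij(1) xy(1)] by blast
      \<comment> \<open>One index \<open>b\<close> with \<open>s b i x \<noteq> 0\<close> is kept
        fixed; dividing by the power of \<open>s b\<close> turns proportionality of the products
        into proportionality of the original family.\<close>
      define \<beta> where "\<beta> = \<alpha> * s b j y ^ (t - 1) / s b i x ^ (t - 1)"
      have \<beta>: "s a i x = \<beta> * s a j y" if "a \<in> K" for a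
      proof -
        have "s a i x * s b i x ^ (t - 1) = \<alpha> * (s a j y * s b j y ^ (t - 1))"
          using bspec[OF eq, of "(a, b)"] that b by (simp add: \<sigma>_def)
        then have "s a i x = \<alpha> * (s a j y * s b j y ^ (t - 1)) / s b i x ^ (t - 1)"
          using b(2) by (simp only: nonzero_eq_divide_eq power_not_zero not_False_eq_True)
        then show ?thesis
          by (simp only: \<beta>_def mult_ac times_divide_eq_left times_divide_eq_right)
      qed
      moreover have "\<beta> \<noteq> 0"
        using \<beta>[OF b(1)] b(2) by auto
      ultimately show "x = y"
        by (intro sep[OF ij xy]) auto
    qed
    show "\<forall>i\<in>lb_index E. \<forall>c\<in>cm_atlas M. \<forall>x\<in>fst c \<inter> lb_dom E i. \<forall>\<xi> \<mu>.
        (\<forall>m\<in>K \<times> K. (\<Sum>l<cm_dim M. \<xi> l * chart_deriv c l (\<sigma> m i) x) = \<mu> * \<sigma> m i x) \<longrightarrow> (\<forall>l<cm_dim M. \<xi> l = 0)"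
    proof (intro ballI allI impI)
      fix i c x \<xi> \<mu> l
      assume i: "i \<in> lb_index E" and c: "c \<in> cm_atlas M" and x: "x \<in> fst c \<inter> lb_dom E i"
        and D: "\<forall>m\<in>K \<times> K. (\<Sum>l<cm_dim M. \<xi> l * chart_deriv c l (\<sigma> m i) x) = \<mu> * \<sigma> m i x" and l: "l < cm_dim M"
      obtain b where b: "b \<in> K" "s b i x \<noteq> 0"
        using nz[OF i] x by blast
      define q where "q y = s b i y ^ (t - 1)" for y
      have qx: "q x \<noteq> 0"
        using b by (simp add: q_def)
      have hq: "holomorphic_fun M (lb_dom E i) q"
        unfolding q_def by (rule holomorphic_fun_power[OF M op[OF i] hol[OF b(1) i]])
      \<comment> \<open>By the product rule, the common factor \<open>q\<close> shifts \<mu> by its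
        logarithmic derivative along \<xi>, which is the same for every \<open>a\<close>.\<close>
      have "(\<Sum>l<cm_dim M. \<xi> l * chart_deriv c l (s a i) x) = (\<mu> - (\<Sum>l<cm_dim M. \<xi> l * chart_deriv c l q x) / q x) * s a i x"
        if a: "a \<in> K" for a
      proof -
        have "\<sigma> (a, b) i = (\<lambda>y. s a i y * q y)"
          by (simp add: \<sigma>_def q_def)
        moreover have "chart_deriv c l (\<lambda>y. s a i y * q y) x = s a i x * chart_deriv c l q x + chart_deriv c l (s a i) x * q x"
          if "l < cm_dim M" for l
          using x that by (intro chart_deriv_mult[OF M c] holomorphic_fun_chart_diff[OF M op[OF i] _ c] hol a i hq) auto
        ultimately have "\<mu> * (s a i x * q x)
            = (\<Sum>l<cm_dim M. \<xi> l * (s a i x * chart_deriv c l q x + chart_deriv c l (s a i) x * q x))"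
          using bspec[OF D, of "(a, b)"] a b by simp
        also have "\<dots> = s a i x * (\<Sum>l<cm_dim M. \<xi> l * chart_deriv c l q x) + (\<Sum>l<cm_dim M. \<xi> l * chart_deriv c l (s a i) x) * q x"
          unfolding sum_distrib_left sum_distrib_right sum.distrib[symmetric] by (intro sum.cong refl) (simp add: ring_distribs mult_ac)
        finally have "(\<Sum>l<cm_dim M. \<xi> l * chart_deriv c l (s a i) x) * q x
            = (\<mu> * q x - (\<Sum>l<cm_dim M. \<xi> l * chart_deriv c l q x)) * s a i x"
          by (simp add: algebra_simps)
        then have "(\<Sum>l<cm_dim M. \<xi> l * chart_deriv c l (s a i) x)
            = (\<mu> * q x - (\<Sum>l<cm_dim M. \<xi> l * chart_deriv c l q x)) * s a i x / q x"
          using qx by (simp only: nonzero_eq_divide_eq not_False_eq_True)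
        then show ?thesis
          using qx by (simp add: diff_divide_distrib left_diff_distrib)
      qed
      then have "\<forall>a\<in>K. (\<Sum>l<cm_dim M. \<xi> l * chart_deriv c l (s a i) x)
          = (\<mu> - (\<Sum>l<cm_dim M. \<xi> l * chart_deriv c l q x) / q x) * s a i x"
        by blast
      then have "\<forall>l<cm_dim M. \<xi> l = 0"
        by (intro imm[THEN bspec, THEN bspec, THEN bspec, THEN spec[where x = \<xi>],
            THEN spec[where x = "\<mu> - (\<Sum>l<cm_dim M. \<xi> l * chart_deriv c l q x) / q x"], THEN mp, of i c x])
          (use i c x in simp_all)
      then show "\<xi> l = 0"
        using l by blast
    qed
  qed
qed

lemma external_tensor_simps:
  "lb_index (external_tensor M E N F) = lb_index E \<times> lb_index F"
  "lb_dom (external_tensor M E N F) p = {z \<in> cm_space (product_manifold M N). fst z \<in> lb_dom E (fst p) \<and> snd z \<in> lb_dom F (snd p)}"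
  "lb_trans (external_tensor M E N F) p q = (\<lambda>z. lb_trans E (fst p) (fst q) (fst z) * lb_trans F (snd p) (snd q) (snd z))"
  by (auto simp: external_tensor_def lb_tensor_def lb_pullback_def case_prod_beta)

text \<open>An equality of records, because \<open>lb_power\<close> keeps the given cover.\<close>

lemma lb_power_external_tensor: "lb_power k (external_tensor M E N F) = external_tensor M (lb_power k E) N (lb_power k F)"
  by (rule line_bundle.equality)
    (auto simp: lb_power_def external_tensor_def lb_tensor_def lb_pullback_def power_mult_distrib fun_eq_iff)

context
  fixes M :: "'a cmfd" and N :: "'b cmfd" and E :: "('i, 'a) line_bundle" and F :: "('j, 'b) line_bundle"
  assumes M: "complex_manifold M" and N: "complex_manifold N"
    and E: "holomorphic_line_bundle M E" and F: "holomorphic_line_bundle N F"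
begin

interpretation fac: factor M N "product_manifold M N" Pair fst snd "join_chart (cm_dim M)" 0 "cm_dim M"
  by (rule factor_product[OF M N])

interpretation sw: factor N M "product_manifold M N" "\<lambda>y x. (x, y)" snd fst "\<lambda>e d. join_chart (cm_dim M) d e" "cm_dim M" 0
  by (rule fac.swap)

lemma external_dom:
  assumes "i \<in> lb_index E" "j \<in> lb_index F"
  shows "lb_dom (external_tensor M E N F) (i, j) = lb_dom E i \<times> lb_dom F j"
  using openin_subset[OF lb_dom_open[OF M E assms(1)]] openin_subset[OF lb_dom_open[OF N F assms(2)]]
  by (auto simp: external_tensor_simps product_manifold_simps)

lemma holomorphic_fun_external:
  assumes S: "openin (cm_top M) S" and T: "openin (cm_top N) T" and f: "holomorphic_fun M S f" and g: "holomorphic_fun N T g"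
  shows "holomorphic_fun (product_manifold M N) (S \<times> T) (\<lambda>p. f (fst p) * g (snd p))"
proof -
  have oST: "openin (cm_top (product_manifold M N)) (S \<times> T)"
    using S T by (simp add: product_manifold_simps openin_prod_Times_iff)
  have sub: "S \<times> T \<subseteq> cm_space (product_manifold M N)"
    using oST by (rule openin_subset)
  have "holomorphic_fun (product_manifold M N) (S \<times> T) (\<lambda>p. f (fst p))"
    by (rule holomorphic_fun_subset[OF fac.P fac.holomorphic_fun_pullback[OF S f] fac.openin_pr[OF S] oST]) (use sub in auto)
  moreover have "holomorphic_fun (product_manifold M N) (S \<times> T) (\<lambda>p. g (snd p))"
    by (rule holomorphic_fun_subset[OF fac.P sw.holomorphic_fun_pullback[OF T g] sw.openin_pr[OF T] oST]) (use sub in auto)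
  ultimately show ?thesis
    by (rule holomorphic_fun_mult[OF fac.P oST])
qed

lemma holomorphic_line_bundle_external: "holomorphic_line_bundle (product_manifold M N) (external_tensor M E N F)"
proof -
  let ?P = "product_manifold M N" and ?L = "external_tensor M E N F"
  have Eop: "\<And>i. i \<in> lb_index E \<Longrightarrow> openin (cm_top M) (lb_dom E i)" and Fop: "\<And>j. j \<in> lb_index F \<Longrightarrow> openin (cm_top N) (lb_dom F j)"
    using lb_dom_open[OF M E] lb_dom_open[OF N F] by auto
  have Et: "holomorphic_fun M (lb_dom E i \<inter> lb_dom E i') (lb_trans E i i')"
      "\<And>x. x \<in> lb_dom E i \<Longrightarrow> x \<in> lb_dom E i' \<Longrightarrow> lb_trans E i i' x \<noteq> 0"
      "\<And>x. x \<in> lb_dom E i \<Longrightarrow> lb_trans E i i x = 1"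
      "\<And>x i''. i'' \<in> lb_index E \<Longrightarrow> x \<in> lb_dom E i \<Longrightarrow> x \<in> lb_dom E i' \<Longrightarrow> x \<in> lb_dom E i'' \<Longrightarrow>
        lb_trans E i i' x * lb_trans E i' i'' x = lb_trans E i i'' x"
    if "i \<in> lb_index E" "i' \<in> lb_index E" for i i'
    using E that by (simp_all add: holomorphic_line_bundle_def)
  have Ft: "holomorphic_fun N (lb_dom F i \<inter> lb_dom F i') (lb_trans F i i')"
      "\<And>x. x \<in> lb_dom F i \<Longrightarrow> x \<in> lb_dom F i' \<Longrightarrow> lb_trans F i i' x \<noteq> 0"
      "\<And>x. x \<in> lb_dom F i \<Longrightarrow> lb_trans F i i x = 1"
      "\<And>x i''. i'' \<in> lb_index F \<Longrightarrow> x \<in> lb_dom F i \<Longrightarrow> x \<in> lb_dom F i' \<Longrightarrow> x \<in> lb_dom F i'' \<Longrightarrow>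
        lb_trans F i i' x * lb_trans F i' i'' x = lb_trans F i i'' x"
    if "i \<in> lb_index F" "i' \<in> lb_index F" for i i'
    using F that by (simp_all add: holomorphic_line_bundle_def)
  have idx: "p \<in> lb_index ?L \<longleftrightarrow> fst p \<in> lb_index E \<and> snd p \<in> lb_index F" for p
    by (simp add: external_tensor_simps mem_Times_iff)
  have dom: "lb_dom ?L p = lb_dom E (fst p) \<times> lb_dom F (snd p)" if "p \<in> lb_index ?L" for p
    using external_dom[of "fst p" "snd p"] that by (simp add: idx)
  show ?thesis
    unfolding holomorphic_line_bundle_def
  proof (intro conjI ballI)
    show "openin (cm_top ?P) (lb_dom ?L p)" if "p \<in> lb_index ?L" for p
      using that Eop Fop by (simp add: dom idx product_manifold_simps openin_prod_Times_iff)
    show "(\<Union>p\<in>lb_index ?L. lb_dom ?L p) = cm_space ?P"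
    proof
      show "(\<Union>p\<in>lb_index ?L. lb_dom ?L p) \<subseteq> cm_space ?P"
        by (auto simp: external_tensor_simps)
      show "cm_space ?P \<subseteq> (\<Union>p\<in>lb_index ?L. lb_dom ?L p)"
      proof
        fix z assume z: "z \<in> cm_space ?P"
        obtain i where i: "i \<in> lb_index E" "fst z \<in> lb_dom E i"
          using lb_dom_around[OF M E fac.pr_space[OF z]] .
        obtain j where j: "j \<in> lb_index F" "snd z \<in> lb_dom F j"
          using lb_dom_around[OF N F fac.qr_space[OF z]] .
        show "z \<in> (\<Union>p\<in>lb_index ?L. lb_dom ?L p)"
          by (rule UN_I[of "(i, j)"]) (use i j z in \<open>simp_all add: external_tensor_simps\<close>)
      qed
    qed
    fix p q assume p: "p \<in> lb_index ?L" and q: "q \<in> lb_index ?L"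
    have "openin (cm_top M) (lb_dom E (fst p) \<inter> lb_dom E (fst q))" "openin (cm_top N) (lb_dom F (snd p) \<inter> lb_dom F (snd q))"
      using p q Eop Fop by (simp_all add: idx openin_Int)
    from holomorphic_fun_external[OF this, of "lb_trans E (fst p) (fst q)" "lb_trans F (snd p) (snd q)"]
    show "holomorphic_fun ?P (lb_dom ?L p \<inter> lb_dom ?L q) (lb_trans ?L p q)"
      using Et(1) Ft(1) p q by (simp add: dom idx Times_Int_Times external_tensor_simps(3))
    show "lb_trans ?L p q z \<noteq> 0" if "z \<in> lb_dom ?L p \<inter> lb_dom ?L q" for z
      using that p q Et(2)[of "fst p" "fst q"] Ft(2)[of "snd p" "snd q"] by (auto simp: idx external_tensor_simps)
  next
    fix p z assume "p \<in> lb_index ?L" "z \<in> lb_dom ?L p"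
    then show "lb_trans ?L p p z = 1"
      using Et(3)[of "fst p"] Ft(3)[of "snd p"] by (auto simp: idx external_tensor_simps)
  next
    fix p q r z assume *: "p \<in> lb_index ?L" "q \<in> lb_index ?L" "r \<in> lb_index ?L" "z \<in> lb_dom ?L p \<inter> lb_dom ?L q \<inter> lb_dom ?L r"
    have "lb_trans E (fst p) (fst q) (fst z) * lb_trans E (fst q) (fst r) (fst z) = lb_trans E (fst p) (fst r) (fst z)"
      by (rule Et(4)) (use * in \<open>auto simp: idx external_tensor_simps(2)\<close>)
    moreover have "lb_trans F (snd p) (snd q) (snd z) * lb_trans F (snd q) (snd r) (snd z) = lb_trans F (snd p) (snd r) (snd z)"
      by (rule Ft(4)) (use * in \<open>auto simp: idx external_tensor_simps(2)\<close>)
    ultimately show "lb_trans ?L p q z * lb_trans ?L q r z = lb_trans ?L p r z"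
      unfolding external_tensor_simps(3) by (metis (no_types, lifting) mult.assoc mult.left_commute)
  qed
qed

lemma holomorphic_section_external:
  assumes s: "holomorphic_section M E s" and t: "holomorphic_section N F t"
  shows "holomorphic_section (product_manifold M N) (external_tensor M E N F) (\<lambda>p z. s (fst p) (fst z) * t (snd p) (snd z))"
  unfolding holomorphic_section_def
proof (intro conjI ballI)
  fix p assume "p \<in> lb_index (external_tensor M E N F)"
  then obtain i j where p: "p = (i, j)" "i \<in> lb_index E" "j \<in> lb_index F"
    by (auto simp: external_tensor_simps)
  show "holomorphic_fun (product_manifold M N) (lb_dom (external_tensor M E N F) p) (\<lambda>z. s (fst p) (fst z) * t (snd p) (snd z))"
    using s t p holomorphic_fun_external[OF lb_dom_open[OF M E p(2)] lb_dom_open[OF N F p(3)], of "s i" "t j"]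
    by (simp add: external_dom holomorphic_section_def)
next
  fix p q z assume *: "p \<in> lb_index (external_tensor M E N F)" "q \<in> lb_index (external_tensor M E N F)"
    "z \<in> lb_dom (external_tensor M E N F) p \<inter> lb_dom (external_tensor M E N F) q"
  have "s (fst p) (fst z) = lb_trans E (fst p) (fst q) (fst z) * s (fst q) (fst z)"
    by (rule s[unfolded holomorphic_section_def, THEN conjunct2, rule_format]) (use * in \<open>auto simp: external_tensor_simps\<close>)
  moreover have "t (snd p) (snd z) = lb_trans F (snd p) (snd q) (snd z) * t (snd q) (snd z)"
    by (rule t[unfolded holomorphic_section_def, THEN conjunct2, rule_format]) (use * in \<open>auto simp: external_tensor_simps\<close>)
  ultimately show "s (fst p) (fst z) * t (snd p) (snd z)
      = lb_trans (external_tensor M E N F) p q z * (s (fst q) (fst z) * t (snd q) (snd z))"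
    unfolding external_tensor_simps(3) by (metis (no_types, lifting) mult.assoc mult.left_commute)
qed

text \<open>The Segre embedding in terms of sections. Fixing \<open>b\<close> with
  \<open>t b\<close> nonzero at the point reduces separation of points and tangent vectors to the
  family on \<open>M\<close>; fixing \<open>a\<close> reduces it to the family on
  \<open>N\<close>.\<close>

lemma projective_family_external:
  assumes s: "projective_family M E K s" and t: "projective_family N F L t"
  shows "projective_family (product_manifold M N) (external_tensor M E N F) (K \<times> L)
    (\<lambda>m p z. s (fst m) (fst p) (fst z) * t (snd m) (snd p) (snd z))"
proof -
  let ?P = "product_manifold M N" and ?L = "external_tensor M E N F"
  define \<sigma> where "\<sigma> = (\<lambda>m p z. s (fst m) (fst p) (fst z) * t (snd m) (snd p) (snd z))"
  have secs: "holomorphic_section M E (s a)" if "a \<in> K" for a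
    using s[unfolded projective_family_def, THEN conjunct1] that by blast
  have sect: "holomorphic_section N F (t b)" if "b \<in> L" for b
    using t[unfolded projective_family_def, THEN conjunct1] that by blast
  have nzs: "\<exists>a\<in>K. s a i x \<noteq> 0" if "i \<in> lb_index E" "x \<in> lb_dom E i" for i x
    by (rule s[unfolded projective_family_def, THEN conjunct2, THEN conjunct1, rule_format]) (use that in simp_all)
  have nzt: "\<exists>b\<in>L. t b i x \<noteq> 0" if "i \<in> lb_index F" "x \<in> lb_dom F i" for i x
    by (rule t[unfolded projective_family_def, THEN conjunct2, THEN conjunct1, rule_format]) (use that in simp_all)
  have seps: "x = y" if "i \<in> lb_index E" "j \<in> lb_index E" "x \<in> lb_dom E i" "y \<in> lb_dom E j" "a \<noteq> 0" "\<forall>m\<in>K. s m i x = a * s m j y" for i j x y a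
    by (rule s[unfolded projective_family_def, THEN conjunct2, THEN conjunct2, THEN conjunct1, rule_format]) (use that in \<open>simp_all\<close>)
  have sept: "x = y" if "i \<in> lb_index F" "j \<in> lb_index F" "x \<in> lb_dom F i" "y \<in> lb_dom F j" "a \<noteq> 0" "\<forall>m\<in>L. t m i x = a * t m j y" for i j x y a
    by (rule t[unfolded projective_family_def, THEN conjunct2, THEN conjunct2, THEN conjunct1, rule_format]) (use that in \<open>simp_all\<close>)
  note imms = s[unfolded projective_family_def, THEN conjunct2, THEN conjunct2, THEN conjunct2]
  note immt = t[unfolded projective_family_def, THEN conjunct2, THEN conjunct2, THEN conjunct2]
  have idx: "fst p \<in> lb_index E" "snd p \<in> lb_index F" if "p \<in> lb_index ?L" for p
    using that by (auto simp: external_tensor_simps)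
  have dom: "fst z \<in> lb_dom E (fst p)" "snd z \<in> lb_dom F (snd p)" if "z \<in> lb_dom ?L p" for z p
    using that by (auto simp: external_tensor_simps)
  show ?thesis
    unfolding \<sigma>_def[symmetric] projective_family_def
  proof (intro conjI)
    show "\<forall>m\<in>K \<times> L. holomorphic_section ?P ?L (\<sigma> m)"
      unfolding \<sigma>_def using holomorphic_section_external[OF secs sect] by auto
    show "\<forall>p\<in>lb_index ?L. \<forall>z\<in>lb_dom ?L p. \<exists>m\<in>K \<times> L. \<sigma> m p z \<noteq> 0"
    proof (intro ballI)
      fix p z assume p: "p \<in> lb_index ?L" "z \<in> lb_dom ?L p"
      obtain a b where "a \<in> K" "s a (fst p) (fst z) \<noteq> 0" "b \<in> L" "t b (snd p) (snd z) \<noteq> 0"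
        using nzs[OF idx(1) dom(1)] nzt[OF idx(2) dom(2)] p by blast
      then show "\<exists>m\<in>K \<times> L. \<sigma> m p z \<noteq> 0"
        by (intro bexI[of _ "(a, b)"]) (simp_all add: \<sigma>_def)
    qed
    show "\<forall>p\<in>lb_index ?L. \<forall>q\<in>lb_index ?L. \<forall>z\<in>lb_dom ?L p. \<forall>w\<in>lb_dom ?L q. \<forall>a.
        a \<noteq> 0 \<and> (\<forall>m\<in>K \<times> L. \<sigma> m p z = a * \<sigma> m q w) \<longrightarrow> z = w"
    proof (intro ballI allI impI, elim conjE)
      fix p q z w \<alpha>
      assume p: "p \<in> lb_index ?L" "z \<in> lb_dom ?L p" and q: "q \<in> lb_index ?L" "w \<in> lb_dom ?L q"
        and "\<alpha> \<noteq> 0" and eq: "\<forall>m\<in>K \<times> L. \<sigma> m p z = \<alpha> * \<sigma> m q w"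
      obtain a where a: "a \<in> K" "s a (fst p) (fst z) \<noteq> 0"
        using nzs[OF idx(1)[OF p(1)] dom(1)[OF p(2)]] by blast
      obtain b where b: "b \<in> L" "t b (snd p) (snd z) \<noteq> 0"
        using nzt[OF idx(2)[OF p(1)] dom(2)[OF p(2)]] by blast
      have eq': "s a' (fst p) (fst z) * t b' (snd p) (snd z) = \<alpha> * (s a' (fst q) (fst w) * t b' (snd q) (snd w))"
        if "a' \<in> K" "b' \<in> L" for a' b'
        using bspec[OF eq, of "(a', b')"] that by (simp add: \<sigma>_def)
      \<comment> \<open>They are nonzero because \<open>s a\<close> and \<open>t b\<close> do not
        vanish at \<open>z\<close>.\<close>
      define \<beta> \<gamma> where "\<beta> = \<alpha> * t b (snd q) (snd w) / t b (snd p) (snd z)"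
        and "\<gamma> = \<alpha> * s a (fst q) (fst w) / s a (fst p) (fst z)"
      have \<beta>: "s a' (fst p) (fst z) = \<beta> * s a' (fst q) (fst w)" if "a' \<in> K" for a'
      proof -
        have "s a' (fst p) (fst z) = \<alpha> * (s a' (fst q) (fst w) * t b (snd q) (snd w)) / t b (snd p) (snd z)"
          using eq'[OF that b(1)] b(2) by (simp only: nonzero_eq_divide_eq not_False_eq_True)
        then show ?thesis
          by (simp only: \<beta>_def mult_ac times_divide_eq_left times_divide_eq_right)
      qed
      have \<gamma>: "t b' (snd p) (snd z) = \<gamma> * t b' (snd q) (snd w)" if "b' \<in> L" for b'
      proof -
        have "t b' (snd p) (snd z) * s a (fst p) (fst z) = \<alpha> * (s a (fst q) (fst w) * t b' (snd q) (snd w))"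
          using eq'[OF a(1) that] by (simp only: mult.commute)
        then have "t b' (snd p) (snd z) = \<alpha> * (s a (fst q) (fst w) * t b' (snd q) (snd w)) / s a (fst p) (fst z)"
          using a(2) by (simp only: nonzero_eq_divide_eq not_False_eq_True)
        then show ?thesis
          by (simp only: \<gamma>_def mult_ac times_divide_eq_left times_divide_eq_right)
      qed
      have "fst z = fst w"
        using \<beta>[OF a(1)] a(2) \<beta>
        by (intro seps[OF idx(1)[OF p(1)] idx(1)[OF q(1)] dom(1)[OF p(2)] dom(1)[OF q(2)], of \<beta>]) auto
      moreover have "snd z = snd w"
        using \<gamma>[OF b(1)] b(2) \<gamma>
        by (intro sept[OF idx(2)[OF p(1)] idx(2)[OF q(1)] dom(2)[OF p(2)] dom(2)[OF q(2)], of \<gamma>]) auto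
      ultimately show "z = w"
        by (rule prod_eqI)
    qed
    show "\<forall>p\<in>lb_index ?L. \<forall>c\<in>cm_atlas ?P. \<forall>z\<in>fst c \<inter> lb_dom ?L p. \<forall>\<xi> \<mu>.
        (\<forall>m\<in>K \<times> L. (\<Sum>k<cm_dim ?P. \<xi> k * chart_deriv c k (\<sigma> m p) z) = \<mu> * \<sigma> m p z) \<longrightarrow> (\<forall>k<cm_dim ?P. \<xi> k = 0)"
    proof (intro ballI allI impI)
      fix p c z \<xi> \<mu> k
      assume p: "p \<in> lb_index ?L" and c: "c \<in> cm_atlas ?P" and z: "z \<in> fst c \<inter> lb_dom ?L p"
        and D: "\<forall>m\<in>K \<times> L. (\<Sum>k<cm_dim ?P. \<xi> k * chart_deriv c k (\<sigma> m p) z) = \<mu> * \<sigma> m p z" and k: "k < cm_dim ?P"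
      obtain d e where c': "d \<in> cm_atlas M" "e \<in> cm_atlas N" "c = join_chart (cm_dim M) d e"
        using c unfolding fac.atlas by blast
      define i j x y where "i = fst p" and "j = snd p" and "x = fst z" and "y = snd z"
      have i: "i \<in> lb_index E" "x \<in> lb_dom E i" "x \<in> fst d" and j: "j \<in> lb_index F" "y \<in> lb_dom F j" "y \<in> fst e"
        using idx[OF p] dom[of z p] z by (auto simp: i_def j_def x_def y_def c'(3) fst_join_chart)
      have zc: "z \<in> fst (join_chart (cm_dim M) d e)"
        using z c'(3) by simp
      obtain a where a: "a \<in> K" "s a i x \<noteq> 0"
        using nzs[OF i(1,2)] by blast
      obtain b where b: "b \<in> L" "t b j y \<noteq> 0"
        using nzt[OF j(1,2)] by blast
      define Ds where "Ds a = (\<Sum>l<cm_dim M. \<xi> l * chart_deriv d l (s a i) x)" for a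
      define Dt where "Dt b = (\<Sum>l<cm_dim N. \<xi> (cm_dim M + l) * chart_deriv e l (t b j) y)" for b
      \<comment> \<open>Leibniz rule: a tangent vector of the product splits into its two blocks,
        and each block differentiates only its own factor. With \<open>b\<close> fixed, the term
        \<open>Dt b / t b j y\<close> merely changes the multiplier \<mu>.\<close>
      have eq: "Ds a' * t b' j y + s a' i x * Dt b' = \<mu> * (s a' i x * t b' j y)" if "a' \<in> K" "b' \<in> L" for a' b'
      proof -
        have ds: "chart_deriv c l (\<sigma> (a', b') p) z = t b' j y * chart_deriv d l (s a' i) x" if "l < cm_dim M" for l
        proof -
          have "chart_deriv c l (\<sigma> (a', b') p) z = chart_deriv d l (\<lambda>x. t b' j y * s a' i x) x"
            using fac.chart_deriv_factor[OF c'(1,2) zc that, of "\<sigma> (a', b') p"]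
            by (simp add: c'(3) \<sigma>_def i_def j_def x_def y_def mult.commute)
          also have "\<dots> = t b' j y * chart_deriv d l (s a' i) x"
            by (intro chart_deriv_cmult[OF M c'(1)] section_chart_diff[OF M E secs i(1) c'(1) i(3,2)] that \<open>a' \<in> K\<close>)
          finally show ?thesis .
        qed
        have dt: "chart_deriv c (cm_dim M + l) (\<sigma> (a', b') p) z = s a' i x * chart_deriv e l (t b' j) y" if "l < cm_dim N" for l
        proof -
          have "chart_deriv c (cm_dim M + l) (\<sigma> (a', b') p) z = chart_deriv e l (\<lambda>y. s a' i x * t b' j y) y"
            using fac.chart_deriv_other[OF c'(1,2) zc that, of "\<sigma> (a', b') p"]
            by (simp add: c'(3) \<sigma>_def i_def j_def x_def y_def)
          also have "\<dots> = s a' i x * chart_deriv e l (t b' j) y"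
            by (intro chart_deriv_cmult[OF N c'(2)] section_chart_diff[OF N F sect j(1) c'(2) j(3,2)] that \<open>b' \<in> L\<close>)
          finally show ?thesis .
        qed
        have "\<mu> * (s a' i x * t b' j y) = (\<Sum>k<cm_dim ?P. \<xi> k * chart_deriv c k (\<sigma> (a', b') p) z)"
          using bspec[OF D, of "(a', b')"] that by (simp add: \<sigma>_def i_def j_def x_def y_def)
        also have "\<dots> = (\<Sum>l<cm_dim M. \<xi> l * (t b' j y * chart_deriv d l (s a' i) x))
            + (\<Sum>l<cm_dim N. \<xi> (cm_dim M + l) * (s a' i x * chart_deriv e l (t b' j) y))"
          unfolding fac.sum_index by (simp add: ds dt)
        also have "\<dots> = Ds a' * t b' j y + s a' i x * Dt b'"
          unfolding Ds_def Dt_def sum_distrib_left sum_distrib_right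
          by (intro arg_cong2[where f = "(+)"] sum.cong refl) (simp_all only: mult_ac)
        finally show ?thesis by simp
      qed
      have "Ds a' = (\<mu> - Dt b / t b j y) * s a' i x" if "a' \<in> K" for a'
      proof -
        have "Ds a' * t b j y = (\<mu> * t b j y - Dt b) * s a' i x"
          using eq[OF that b(1)] by (simp add: algebra_simps)
        then have "Ds a' = (\<mu> * t b j y - Dt b) * s a' i x / t b j y"
          using b(2) by (simp only: nonzero_eq_divide_eq not_False_eq_True)
        then show ?thesis
          using b(2) by (simp add: diff_divide_distrib left_diff_distrib)
      qed
      then have "\<forall>a'\<in>K. (\<Sum>l<cm_dim M. \<xi> l * chart_deriv d l (s a' i) x) = (\<mu> - Dt b / t b j y) * s a' i x"
        by (simp add: Ds_def)
      then have 1: "\<forall>l<cm_dim M. \<xi> l = 0"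
        by (intro imms[THEN bspec, THEN bspec, THEN bspec, THEN spec[where x = \<xi>],
            THEN spec[where x = "\<mu> - Dt b / t b j y"], THEN mp, of i d x]) (use i c'(1) in simp_all)
      have "Dt b' = (\<mu> - Ds a / s a i x) * t b' j y" if "b' \<in> L" for b'
      proof -
        have "Dt b' * s a i x = (\<mu> * s a i x - Ds a) * t b' j y"
          using eq[OF a(1) that] by (simp add: algebra_simps)
        then have "Dt b' = (\<mu> * s a i x - Ds a) * t b' j y / s a i x"
          using a(2) by (simp only: nonzero_eq_divide_eq not_False_eq_True)
        then show ?thesis
          using a(2) by (simp add: diff_divide_distrib left_diff_distrib)
      qed
      then have "\<forall>b'\<in>L. (\<Sum>l<cm_dim N. \<xi> (cm_dim M + l) * chart_deriv e l (t b' j) y) = (\<mu> - Ds a / s a i x) * t b' j y"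
        by (simp add: Dt_def)
      then have 2: "\<forall>l<cm_dim N. \<xi> (cm_dim M + l) = 0"
        by (intro immt[THEN bspec, THEN bspec, THEN bspec, THEN spec[where x = "\<lambda>l. \<xi> (cm_dim M + l)"],
            THEN spec[where x = "\<mu> - Ds a / s a i x"], THEN mp, of j e y]) (use j c'(2) in simp_all)
      show "\<xi> k = 0"
      proof (cases "k < cm_dim M")
        case True
        then show ?thesis using 1 by blast
      next
        case False
        then have "k - cm_dim M < cm_dim N" "\<xi> k = \<xi> (cm_dim M + (k - cm_dim M))"
          using k by (auto simp: product_manifold_simps)
        then show ?thesis
          using 2 by simp
      qed
    qed
  qed
qed

end

lemma holomorphic_line_bundle_power:
  assumes M: "complex_manifold M" and E: "holomorphic_line_bundle M E"
  shows "holomorphic_line_bundle M (lb_power k E)"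
proof -
  have "openin (cm_top M) (lb_dom E i \<inter> lb_dom E j)" if "i \<in> lb_index E" "j \<in> lb_index E" for i j
    using that lb_dom_open[OF M E] by blast
  then show ?thesis
    using E by (auto simp: holomorphic_line_bundle_def lb_power_def holomorphic_fun_power[OF M] simp flip: power_mult_distrib)
qed

lemma ample_external_tensor:
  assumes M: "complex_manifold M" "compact_space (cm_top M)" "holomorphic_line_bundle M E" "ample M E"
    and N: "complex_manifold N" "compact_space (cm_top N)" "holomorphic_line_bundle N F" "ample N F"
  shows "ample (product_manifold M N) (external_tensor M E N F)"
proof -
  obtain k where k: "1 \<le> k" "very_ample M (lb_power k E)"
    using M(4) by (auto simp: ample_def)
  obtain l where l: "1 \<le> l" "very_ample N (lb_power l F)"
    using N(4) by (auto simp: ample_def)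
  note pE = holomorphic_line_bundle_power[OF M(1,3)] and pF = holomorphic_line_bundle_power[OF N(1,3)]
  obtain A :: nat and s where s: "projective_family M (lb_power k E) {..A} s"
    using k(2)[unfolded very_ample_iff[OF M(1) pE M(2)]] by (elim exE) (rule that)
  obtain B :: nat and t where t: "projective_family N (lb_power l F) {..B} t"
    using l(2)[unfolded very_ample_iff[OF N(1) pF N(2)]] by (elim exE) (rule that)
  note s' = projective_family_power[OF M(1) pE s, of l]
  \<comment> \<open>The two exponents must agree literally, since \<open>ample\<close> takes one
    power of the whole external tensor product.\<close>
  note t' = projective_family_power[OF N(1) pF t, of k, unfolded mult.commute[of l k]]
  have "\<exists>(C :: nat) \<sigma>. projective_family (product_manifold M N) (external_tensor M (lb_power (k * l) E) N (lb_power (k * l) F)) {..C} \<sigma>"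
    by (rule projective_family_nat, rule projective_family_external[OF M(1) N(1) pE pF s' t']) (use k l in auto)
  moreover have "holomorphic_line_bundle (product_manifold M N) (external_tensor M (lb_power (k * l) E) N (lb_power (k * l) F))"
    by (rule holomorphic_line_bundle_external[OF M(1) N(1) pE pF])
  moreover have "compact_space (cm_top (product_manifold M N))"
    using M(2) N(2) by (simp add: product_manifold_simps compact_space_prod_topology)
  ultimately have "very_ample (product_manifold M N) (external_tensor M (lb_power (k * l) E) N (lb_power (k * l) F))"
    by (simp only: very_ample_iff[OF complex_manifold_product[OF M(1) N(1)]])
  moreover have "1 \<le> k * l"
    using k l by simp
  ultimately show ?thesis
    unfolding ample_def lb_power_external_tensor by blast
qed

section \<open>Polarisations, divisors and their complements on the product\<close>

lemma polarised_manifold_product: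
  assumes "polarised_manifold M E" "polarised_manifold N F"
  shows "polarised_manifold (product_manifold M N) (external_tensor M E N F)"
  using assms unfolding polarised_manifold_def
  by (simp add: complex_manifold_product holomorphic_line_bundle_external ample_external_tensor
      product_manifold_simps(1) compact_space_prod_topology)

text \<open>A product of fibre coordinates vanishes if and only if one of them does. Trivialisations
  of the product are pairs, so one of \<open>E\<close> at a given point has to be completed by one
  of \<open>F\<close>, which exists because the domains cover.\<close>

lemma divisor_support_external:
  assumes M: "complex_manifold M" "holomorphic_line_bundle M E" and N: "complex_manifold N" "holomorphic_line_bundle N F"
  shows "cm_space (product_manifold M N) - divisor_support (external_tensor M E N F) (\<lambda>p z. s (fst p) (fst z) * t (snd p) (snd z))
    = (cm_space M - divisor_support E s) \<times> (cm_space N - divisor_support F t)" (is "?L = ?R")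
proof
  show "?R \<subseteq> ?L"
    by (auto simp: divisor_support_def external_tensor_simps product_manifold_simps)
  show "?L \<subseteq> ?R"
  proof
    fix z assume z: "z \<in> ?L"
    then have sp: "fst z \<in> cm_space M" "snd z \<in> cm_space N"
      by (auto simp: product_manifold_simps)
    have nz: "s i (fst z) * t j (snd z) \<noteq> 0"
      if "i \<in> lb_index E" "fst z \<in> lb_dom E i" "j \<in> lb_index F" "snd z \<in> lb_dom F j" for i j
      using z that by (force simp: divisor_support_def external_tensor_simps)
    obtain i where i: "i \<in> lb_index E" "fst z \<in> lb_dom E i"
      using lb_dom_around[OF M sp(1)] .
    obtain j where j: "j \<in> lb_index F" "snd z \<in> lb_dom F j"
      using lb_dom_around[OF N sp(2)] .
    show "z \<in> ?R"
      using sp nz[OF _ _ j] nz[OF i] by (auto simp: divisor_support_def mem_Times_iff)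
  qed
qed

text \<open>The component of \<open>z\<close> contains the product of the components of its
  coordinates, which is connected; a nonzero value of each section there gives one of the
  product.\<close>

lemma nontrivial_section_external:
  assumes s: "nontrivial_section M E s" and t: "nontrivial_section N F t"
  shows "nontrivial_section (product_manifold M N) (external_tensor M E N F) (\<lambda>p z. s (fst p) (fst z) * t (snd p) (snd z))"
  unfolding nontrivial_section_def
proof
  let ?P = "prod_topology (cm_top M) (cm_top N)"
  fix C assume "C \<in> connected_components_of (cm_top (product_manifold M N))"
  then obtain z where z: "z \<in> topspace ?P" "C = connected_component_of_set ?P z"
    by (auto simp: connected_components_of_def product_manifold_simps)
  let ?A = "connected_component_of_set (cm_top M) (fst z)" and ?B = "connected_component_of_set (cm_top N) (snd z)"
  have sp: "fst z \<in> cm_space M" "snd z \<in> cm_space N"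
    using z by auto
  have "connectedin ?P (?A \<times> ?B)"
    by (simp add: connectedin_Times connectedin_connected_component_of)
  moreover have "z \<in> ?A \<times> ?B"
    using sp by (simp add: mem_Times_iff connected_component_of_refl)
  ultimately have sub: "?A \<times> ?B \<subseteq> C"
    unfolding z(2) by (rule connected_component_of_maximal)
  have "?A \<in> connected_components_of (cm_top M)" "?B \<in> connected_components_of (cm_top N)"
    using sp by (auto simp: connected_components_of_def)
  then obtain i x j y where "i \<in> lb_index E" "x \<in> ?A \<inter> lb_dom E i" "s i x \<noteq> 0"
      "j \<in> lb_index F" "y \<in> ?B \<inter> lb_dom F j" "t j y \<noteq> 0"
    using s t unfolding nontrivial_section_def by meson
  moreover have "(x, y) \<in> topspace ?P"
    using calculation connected_component_of_subset_topspace[of "cm_top M" "fst z"]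
      connected_component_of_subset_topspace[of "cm_top N" "snd z"] by auto
  ultimately show "\<exists>p\<in>lb_index (external_tensor M E N F). \<exists>w\<in>C \<inter> lb_dom (external_tensor M E N F) p.
      s (fst p) (fst w) * t (snd p) (snd w) \<noteq> 0"
    using sub by (intro bexI[of _ "(i, j)"] bexI[of _ "(x, y)"]) (auto simp: external_tensor_simps product_manifold_simps)
qed

lemma polarised_density_property_product:
  assumes pM: "polarised_manifold M E" and pN: "polarised_manifold N F"
    and dM: "polarised_density_property M E" and dN: "polarised_density_property N F"
  shows "polarised_density_property (product_manifold M N) (external_tensor M E N F)"
  unfolding polarised_density_property_def
proof
  let ?P = "product_manifold M N" and ?L = "external_tensor M E N F"
  have M: "complex_manifold M" "holomorphic_line_bundle M E" and N: "complex_manifold N" "holomorphic_line_bundle N F"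
    using pM pN by (auto simp: polarised_manifold_def)
  fix z assume "z \<in> cm_space ?P"
  then have sp: "fst z \<in> cm_space M" "snd z \<in> cm_space N"
    by (auto simp: product_manifold_simps)
  obtain D1 where D1: "D1 \<in> complete_linear_system M E" "fst z \<in> cm_space M - D1"
      "stein_manifold (open_submanifold M (cm_space M - D1))" "density_property (open_submanifold M (cm_space M - D1))"
    using dM sp(1) unfolding polarised_density_property_def by blast
  obtain D2 where D2: "D2 \<in> complete_linear_system N F" "snd z \<in> cm_space N - D2"
      "stein_manifold (open_submanifold N (cm_space N - D2))" "density_property (open_submanifold N (cm_space N - D2))"
    using dN sp(2) unfolding polarised_density_property_def by blast
  obtain s where s: "D1 = divisor_support E s" "holomorphic_section M E s" "nontrivial_section M E s"
    using D1(1) by (auto simp: complete_linear_system_def)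
  obtain t where t: "D2 = divisor_support F t" "holomorphic_section N F t" "nontrivial_section N F t"
    using D2(1) by (auto simp: complete_linear_system_def)
  define \<sigma> where "\<sigma> = (\<lambda>p z. s (fst p) (fst z) * t (snd p) (snd z))"
  define M' N' where "M' = open_submanifold M (cm_space M - D1)" and "N' = open_submanifold N (cm_space N - D2)"
  have compl: "cm_space ?P - divisor_support ?L \<sigma> = (cm_space M - D1) \<times> (cm_space N - D2)"
    unfolding \<sigma>_def s(1) t(1) by (rule divisor_support_external[OF M N])
  have sub: "open_submanifold ?P (cm_space ?P - divisor_support ?L \<sigma>) = product_manifold M' N'"
    unfolding compl M'_def N'_def by (rule open_submanifold_product)
  \<comment> \<open>Being a complex manifold is part of being Stein, so this need not be derived for
    open submanifolds.\<close>
  have M'N': "complex_manifold M'" "complex_manifold N'"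
    using D1(3) D2(3) by (auto simp: stein_manifold_def M'_def N'_def)
  show "\<exists>D\<in>complete_linear_system ?P ?L. z \<in> cm_space ?P - D \<and>
      stein_manifold (open_submanifold ?P (cm_space ?P - D)) \<and> density_property (open_submanifold ?P (cm_space ?P - D))"
  proof (intro bexI[of _ "divisor_support ?L \<sigma>"] conjI)
    show "z \<in> cm_space ?P - divisor_support ?L \<sigma>"
      unfolding compl using D1(2) D2(2) by (simp add: mem_Times_iff)
    show "stein_manifold (open_submanifold ?P (cm_space ?P - divisor_support ?L \<sigma>))"
      unfolding sub using D1(3) D2(3) by (intro factor.stein_factor[OF factor_product[OF M'N']]) (simp_all add: M'_def N'_def)
    show "density_property (open_submanifold ?P (cm_space ?P - divisor_support ?L \<sigma>))"
      unfolding sub using D1(4) D2(4) by (intro factor.density_property_factor[OF factor_product[OF M'N']]) (simp_all add: M'_def N'_def)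
    have "holomorphic_section ?P ?L \<sigma>" "nontrivial_section ?P ?L \<sigma>"
      unfolding \<sigma>_def using holomorphic_section_external[OF M(1) N(1) M(2) N(2) s(2) t(2)] nontrivial_section_external[OF s(3) t(3)] by auto
    then show "divisor_support ?L \<sigma> \<in> complete_linear_system ?P ?L"
      by (auto simp: complete_linear_system_def)
  qed
qed

theorem proposition4p5:
  fixes X1 :: "'a cmfd" and E1 :: "('i, 'a) line_bundle"
    and X2 :: "'b cmfd" and E2 :: "('j, 'b) line_bundle"
  assumes "polarised_manifold X1 E1" and "polarised_manifold X2 E2"
    and "polarised_density_property X1 E1" and "polarised_density_property X2 E2"
  shows "polarised_manifold (product_manifold X1 X2) (external_tensor X1 E1 X2 E2)
       \<and> polarised_density_property (product_manifold X1 X2) (external_tensor X1 E1 X2 E2)"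
  using polarised_manifold_product[OF assms(1,2)] polarised_density_property_product[OF assms] by blast

end
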